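(* Let $\mathcal C$ be a $\operatorname{Hom}$-finite 2-Calabi–Yau algebraic triangulated category with a cluster tilting object, and let $\mathcal B$ be a functorially finite extension closed subcategory of $\mathcal C$. Then: (a) The stably 2-Calabi–Yau category $\mathcal B$ also has some cluster tilting object. Any maximal rigid object in $\mathcal B$ is a cluster tilting object in $\mathcal B$. (b) There is some rigid object $A$ in $\mathcal C$ such that $T\oplus A$ is a cluster tilting object in $\mathcal C$ for any cluster tilting object $T$ in $\mathcal B$. (c) Any cluster tilting object $T$ in $\mathcal B$ determines a substructure for the weak cluster structures on $\mathcal B$ and $\mathcal C$ given by cluster tilting objects.
   Context: Conventions. All categories are Krull–Schmidt $k$-categories over an algebraically closed field $k$; subcategories are full and closed under isomorphisms, finite direct sums and direct summands; an object $X$ is identified with $\operatorname{add}X$ and with its set of indecomposable summands. $D=\operatorname{Hom}_k(-,k)$, $\operatorname{Ext}^1(A,B)=\operatorname{Hom}(A,B[1])$. A triangulated category is algebraic if it is the stable category of a Frobenius category. A $\operatorname{Hom}$-finite triangulated category is 2-Calabi–Yau (2-CY) if there are functorial isomorphisms $D\operatorname{Ext}^1(A,B)\simeq\operatorname{Ext}^1(B,A)$. For a functorially finite extension closed subcategory $\mathcal B$ of a $\operatorname{Hom}$-finite triangulated 2-CY category $\mathcal C$, an object $X\in\mathcal B$ is projective in $\mathcal B$ if $\operatorname{Hom}(X,\mathcal B[1])=0$; the factor category of $\mathcal B$ by the projectives of $\mathcal B$ is a triangulated 2-CY category, and $\mathcal B$ is called stably 2-CY. An object $T$ of $\mathcal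 B$ (or of $\mathcal C$) is rigid if $\operatorname{Ext}^1(T,T)=0$, maximal rigid in $\mathcal B$ if $\operatorname{add}T$ is maximal among rigid subcategories of $\mathcal B$, and cluster tilting in $\mathcal B$ if it is rigid, and every $X\in\mathcal B$ with $\operatorname{Ext}^1(T,X)=0$ lies in $\operatorname{add}T$. Weak cluster structure. Given is a collection of sets $\underline x$ of non-isomorphic indecomposables (clusters; their elements are cluster variables) and a fixed set $\underline p$ of indecomposables that are not cluster variables (coefficients); $T=\underline x\cup\underline p$ is an extended cluster. These give a weak cluster structure if: for each extended cluster $T$ and cluster variable $M$ in $T$ there is a unique indecomposable $M^*\not\simeq M$ such that replacing $M$ by $M^*$ gives an extended cluster $T^*$ (exchange), and there are triangles $M^*\xrightarrow{f}B\xrightarrow{g}M$ and $M\xrightarrow{s}B'\xrightarrow{t}M^*$ with $g,t$ minimal right and $f,s$ minimal left $\operatorname{add}(T\setminus\{M\})$-approximations. The weak cluster structures on $\mathcal C$ and $\mathcal B$ here have as extended clusters the cluster tilting objects, and as coefficients the indecomposable projectives (none for $\mathcal C$; the indecomposable projectives in $\mathcal B$ for $\mathcal B$). Substructure. Let $\mathcal B\subseteq\mathcal C$ be extension closed, both with weak cluster structures. An extended cluster $T$ in $\mathcal B$ induces (determines) a substructure of $\mathcal C$ if there is a set $A$ of indecomposable objects in $\mathcal C$ such that $T'\cup A$ is an extended cluster in $\mathcal C$ for every extended cluster $T'$ in $\mathcal B$ obtained from $T$ by a finite number of exchanges. *)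

theory Defs
  imports "HOL-Algebra.Algebra"
begin

text \<open>Frees \<open>X\<close> for use as a variable.\<close>

no_notation var (\<open>X\<index>\<close>)

section \<open>Linear algebra\<close>

definition lin_map ::
  "('k, 'r) ring_scheme \<Rightarrow> ('k, 'm, 'a) module_scheme \<Rightarrow> ('k, 'n, 'b) module_scheme \<Rightarrow> ('m \<Rightarrow> 'n) set"
  where
  "lin_map K M N = {\<phi> \<in> carrier M \<rightarrow> carrier N.
     (\<forall>x\<in>carrier M. \<forall>y\<in>carrier M. \<phi> (x \<oplus>\<^bsub>M\<^esub> y) = \<phi> x \<oplus>\<^bsub>N\<^esub> \<phi> y) \<and>
     (\<forall>a\<in>carrier K. \<forall>x\<in>carrier M. \<phi> (a \<odot>\<^bsub>M\<^esub> x) = a \<odot>\<^bsub>N\<^esub> \<phi> x)}"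

definition self_module :: "('k, 'r) ring_scheme \<Rightarrow> ('k, 'k) module" where
  "self_module K = \<lparr>carrier = carrier K, monoid.mult = (\<otimes>\<^bsub>K\<^esub>), monoid.one = \<one>\<^bsub>K\<^esub>,
                    ring.zero = \<zero>\<^bsub>K\<^esub>, ring.add = (\<oplus>\<^bsub>K\<^esub>), smult = (\<otimes>\<^bsub>K\<^esub>)\<rparr>"

text \<open>In the next two modules only the additive group and the scalar multiplication matter;
  the fields \<open>mult\<close> and \<open>one\<close> come with the record type and are left undefined.
  Functionals are made extensional so that they are determined by their values on the carrier.\<close>

definition dual_module ::
  "('k, 'r) ring_scheme \<Rightarrow> ('k, 'm, 'a) module_scheme \<Rightarrow> ('k, 'm \<Rightarrow> 'k) module" where
  "dual_module K M =
     \<lparr>carrier = lin_map K M (self_module K) \<inter> extensional (carrier M),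
      monoid.mult = undefined, monoid.one = undefined,
      ring.zero = (\<lambda>x\<in>carrier M. \<zero>\<^bsub>K\<^esub>),
      ring.add = (\<lambda>\<phi> \<psi>. \<lambda>x\<in>carrier M. \<phi> x \<oplus>\<^bsub>K\<^esub> \<psi> x),
      smult = (\<lambda>a \<phi>. \<lambda>x\<in>carrier M. a \<otimes>\<^bsub>K\<^esub> \<phi> x)\<rparr>"

definition quot_module ::
  "('k, 'm, 'a) module_scheme \<Rightarrow> 'm set \<Rightarrow> ('k, 'm set) module" where
  "quot_module M N =
     \<lparr>carrier = a_rcosets\<^bsub>M\<^esub> N, monoid.mult = undefined, monoid.one = undefined,
      ring.zero = N, ring.add = set_add M,
      smult = (\<lambda>a U. \<Union>u\<in>U. N +>\<^bsub>M\<^esub> (a \<odot>\<^bsub>M\<^esub> u))\<rparr>"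

definition fin_dim :: "('k, 'r) ring_scheme \<Rightarrow> ('k, 'm, 'a) module_scheme \<Rightarrow> bool" where
  "fin_dim K M \<longleftrightarrow> (\<exists>B. finite B \<and> B \<subseteq> carrier M \<and>
     (\<forall>x\<in>carrier M. \<exists>c \<in> B \<rightarrow> carrier K. x = (\<Oplus>\<^bsub>M\<^esub>b\<in>B. c b \<odot>\<^bsub>M\<^esub> b)))"

section \<open>Linear categories\<close>

text \<open>\<open>cmp C X Y Z g f\<close> is the composite of \<open>f : X \<rightarrow> Y\<close> and \<open>g : Y \<rightarrow> Z\<close>. The objects are passed to
  the operations because Hom-spaces of different pairs of objects need not be disjoint.\<close>

record ('o, 'k, 'm) lin_cat =
  ob :: "'o set"
  Hom :: "'o \<Rightarrow> 'o \<Rightarrow> ('k, 'm) module"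
  idm :: "'o \<Rightarrow> 'm"
  cmp :: "'o \<Rightarrow> 'o \<Rightarrow> 'o \<Rightarrow> 'm \<Rightarrow> 'm \<Rightarrow> 'm"

abbreviation mor :: "('o, 'k, 'm, 'c) lin_cat_scheme \<Rightarrow> 'o \<Rightarrow> 'o \<Rightarrow> 'm set" where
  "mor C X Y \<equiv> carrier (Hom C X Y)"

abbreviation zerom :: "('o, 'k, 'm, 'c) lin_cat_scheme \<Rightarrow> 'o \<Rightarrow> 'o \<Rightarrow> 'm" where
  "zerom C X Y \<equiv> \<zero>\<^bsub>Hom C X Y\<^esub>"

locale k_category = field K
  for K :: "('k, 'r) ring_scheme" (structure) +
  fixes C :: "('o, 'k, 'm, 'c) lin_cat_scheme"
  assumes Hom_module: "\<lbrakk>X \<in> ob C; Y \<in> ob C\<rbrakk> \<Longrightarrow> module K (Hom C X Y)"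
    and idm_mor: "X \<in> ob C \<Longrightarrow> idm C X \<in> mor C X X"
    and cmp_linear_left: "\<lbrakk>X \<in> ob C; Y \<in> ob C; Z \<in> ob C; f \<in> mor C X Y\<rbrakk> \<Longrightarrow>
          (\<lambda>g. cmp C X Y Z g f) \<in> lin_map K (Hom C Y Z) (Hom C X Z)"
    and cmp_linear_right: "\<lbrakk>X \<in> ob C; Y \<in> ob C; Z \<in> ob C; g \<in> mor C Y Z\<rbrakk> \<Longrightarrow>
          (\<lambda>f. cmp C X Y Z g f) \<in> lin_map K (Hom C X Y) (Hom C X Z)"
    and cmp_assoc: "\<lbrakk>W \<in> ob C; X \<in> ob C; Y \<in> ob C; Z \<in> ob C;
          f \<in> mor C W X; g \<in> mor C X Y; h \<in> mor C Y Z\<rbrakk> \<Longrightarrow>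
          cmp C W Y Z h (cmp C W X Y g f) = cmp C W X Z (cmp C X Y Z h g) f"
    and cmp_idm_left: "\<lbrakk>X \<in> ob C; Y \<in> ob C; f \<in> mor C X Y\<rbrakk> \<Longrightarrow> cmp C X Y Y (idm C Y) f = f"
    and cmp_idm_right: "\<lbrakk>X \<in> ob C; Y \<in> ob C; f \<in> mor C X Y\<rbrakk> \<Longrightarrow> cmp C X X Y f (idm C X) = f"

definition iso_mor :: "('o, 'k, 'm, 'c) lin_cat_scheme \<Rightarrow> 'o \<Rightarrow> 'o \<Rightarrow> 'm \<Rightarrow> bool" where
  "iso_mor C X Y f \<longleftrightarrow> f \<in> mor C X Y \<and>
     (\<exists>g\<in>mor C Y X. cmp C X Y X g f = idm C X \<and> cmp C Y X Y f g = idm C Y)"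

definition isomorphic :: "('o, 'k, 'm, 'c) lin_cat_scheme \<Rightarrow> 'o \<Rightarrow> 'o \<Rightarrow> bool" where
  "isomorphic C X Y \<longleftrightarrow> (\<exists>f. iso_mor C X Y f)"

definition iso_class :: "('o, 'k, 'm, 'c) lin_cat_scheme \<Rightarrow> 'o \<Rightarrow> 'o set" where
  "iso_class C X = {Y \<in> ob C. isomorphic C X Y}"

text \<open>\<open>S\<close> is a biproduct of the objects in the list \<open>Xs\<close>; for the empty list this says that
  \<open>S\<close> is a zero object.\<close>

definition is_dsum :: "('o, 'k, 'm, 'c) lin_cat_scheme \<Rightarrow> 'o list \<Rightarrow> 'o \<Rightarrow> bool" where
  "is_dsum C Xs S \<longleftrightarrow> S \<in> ob C \<and> set Xs \<subseteq> ob C \<and>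
     (\<exists>i p. (\<forall>j<length Xs. i j \<in> mor C (Xs ! j) S \<and> p j \<in> mor C S (Xs ! j)) \<and>
        (\<forall>j<length Xs. \<forall>l<length Xs. cmp C (Xs ! j) S (Xs ! l) (p l) (i j) =
           (if j = l then idm C (Xs ! j) else zerom C (Xs ! j) (Xs ! l))) \<and>
        (\<Oplus>\<^bsub>Hom C S S\<^esub>j\<in>{..<length Xs}. cmp C S (Xs ! j) S (i j) (p j)) = idm C S)"

definition is_zero_ob :: "('o, 'k, 'm, 'c) lin_cat_scheme \<Rightarrow> 'o \<Rightarrow> bool" where
  "is_zero_ob C X \<longleftrightarrow> X \<in> ob C \<and> idm C X = zerom C X X"

definition indecomposable :: "('o, 'k, 'm, 'c) lin_cat_scheme \<Rightarrow> 'o \<Rightarrow> bool" where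
  "indecomposable C X \<longleftrightarrow> X \<in> ob C \<and> \<not> is_zero_ob C X \<and>
     (\<forall>Y Z. is_dsum C [Y, Z] X \<longrightarrow> is_zero_ob C Y \<or> is_zero_ob C Z)"

text \<open>The endomorphism ring is local: it is nonzero and the sum of two non-units is a non-unit.\<close>

definition local_end :: "('o, 'k, 'm, 'c) lin_cat_scheme \<Rightarrow> 'o \<Rightarrow> bool" where
  "local_end C X \<longleftrightarrow> idm C X \<noteq> zerom C X X \<and>
     (\<forall>f\<in>mor C X X. \<forall>g\<in>mor C X X. \<not> iso_mor C X X f \<longrightarrow> \<not> iso_mor C X X g \<longrightarrow>
        \<not> iso_mor C X X (f \<oplus>\<^bsub>Hom C X X\<^esub> g))"

locale additive_category = k_category +
  assumes dsum_exists: "set Xs \<subseteq> ob C \<Longrightarrow> \<exists>S. is_dsum C Xs S"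

locale krull_schmidt_category = additive_category +
  assumes krull_schmidt:
    "X \<in> ob C \<Longrightarrow> \<exists>Xs. is_dsum C Xs X \<and> (\<forall>Y\<in>set Xs. local_end C Y)"

locale hom_finite_category = k_category +
  assumes hom_finite: "\<lbrakk>X \<in> ob C; Y \<in> ob C\<rbrakk> \<Longrightarrow> fin_dim K (Hom C X Y)"

text \<open>Full subcategories are given by their sets of objects. All subcategories are closed under
  isomorphisms, finite direct sums and direct summands.\<close>

definition subcategory :: "('o, 'k, 'm, 'c) lin_cat_scheme \<Rightarrow> 'o set \<Rightarrow> bool" where
  "subcategory C U \<longleftrightarrow> U \<subseteq> ob C \<and>
     (\<forall>X\<in>U. iso_class C X \<subseteq> U) \<and>
     (\<forall>Xs S. set Xs \<subseteq> U \<longrightarrow> is_dsum C Xs S \<longrightarrow> S \<in> U) \<and>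
     (\<forall>X Y S. S \<in> U \<longrightarrow> is_dsum C [X, Y] S \<longrightarrow> X \<in> U \<and> Y \<in> U)"

definition add_of :: "('o, 'k, 'm, 'c) lin_cat_scheme \<Rightarrow> 'o set \<Rightarrow> 'o set" where
  "add_of C U = {X. \<exists>Xs Y S. set Xs \<subseteq> U \<and> is_dsum C Xs S \<and> is_dsum C [X, Y] S}"

text \<open>The indecomposable summands of \<open>T\<close>. As a set of objects this is closed under isomorphism,
  and it represents the set of isomorphism classes of indecomposable summands.\<close>

definition ind_summands :: "('o, 'k, 'm, 'c) lin_cat_scheme \<Rightarrow> 'o \<Rightarrow> 'o set" where
  "ind_summands C T = {X. indecomposable C X \<and> (\<exists>Y. is_dsum C [X, Y] T)}"

subsection \<open>Approximations\<close>

definition right_approx ::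
  "('o, 'k, 'm, 'c) lin_cat_scheme \<Rightarrow> 'o set \<Rightarrow> 'o \<Rightarrow> 'o \<Rightarrow> 'm \<Rightarrow> bool" where
  "right_approx C U V M g \<longleftrightarrow> V \<in> U \<and> g \<in> mor C V M \<and>
     (\<forall>X\<in>U. \<forall>h\<in>mor C X M. \<exists>k\<in>mor C X V. cmp C X V M g k = h)"

definition left_approx ::
  "('o, 'k, 'm, 'c) lin_cat_scheme \<Rightarrow> 'o set \<Rightarrow> 'o \<Rightarrow> 'o \<Rightarrow> 'm \<Rightarrow> bool" where
  "left_approx C U M V f \<longleftrightarrow> V \<in> U \<and> f \<in> mor C M V \<and>
     (\<forall>X\<in>U. \<forall>h\<in>mor C M X. \<exists>k\<in>mor C V X. cmp C M V X k f = h)"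

definition min_right_approx ::
  "('o, 'k, 'm, 'c) lin_cat_scheme \<Rightarrow> 'o set \<Rightarrow> 'o \<Rightarrow> 'o \<Rightarrow> 'm \<Rightarrow> bool" where
  "min_right_approx C U V M g \<longleftrightarrow> right_approx C U V M g \<and>
     (\<forall>h\<in>mor C V V. cmp C V V M g h = g \<longrightarrow> iso_mor C V V h)"

definition min_left_approx ::
  "('o, 'k, 'm, 'c) lin_cat_scheme \<Rightarrow> 'o set \<Rightarrow> 'o \<Rightarrow> 'o \<Rightarrow> 'm \<Rightarrow> bool" where
  "min_left_approx C U M V f \<longleftrightarrow> left_approx C U M V f \<and>
     (\<forall>h\<in>mor C V V. cmp C M V V h f = f \<longrightarrow> iso_mor C V V h)"

definition functorially_finite :: "('o, 'k, 'm, 'c) lin_cat_scheme \<Rightarrow> 'o set \<Rightarrow> bool" where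
  "functorially_finite C U \<longleftrightarrow>
     (\<forall>M\<in>ob C. (\<exists>V g. right_approx C U V M g) \<and> (\<exists>V f. left_approx C U M V f))"

subsection \<open>Functors\<close>

definition linear_functor ::
  "('k, 'r) ring_scheme \<Rightarrow> ('o, 'k, 'm, 'c) lin_cat_scheme \<Rightarrow> ('p, 'k, 'n, 'd) lin_cat_scheme \<Rightarrow>
   ('o \<Rightarrow> 'p) \<Rightarrow> ('o \<Rightarrow> 'o \<Rightarrow> 'm \<Rightarrow> 'n) \<Rightarrow> bool" where
  "linear_functor K C D Fo Fm \<longleftrightarrow> Fo \<in> ob C \<rightarrow> ob D \<and>
     (\<forall>X\<in>ob C. \<forall>Y\<in>ob C. Fm X Y \<in> lin_map K (Hom C X Y) (Hom D (Fo X) (Fo Y))) \<and>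
     (\<forall>X\<in>ob C. Fm X X (idm C X) = idm D (Fo X)) \<and>
     (\<forall>X\<in>ob C. \<forall>Y\<in>ob C. \<forall>Z\<in>ob C. \<forall>f\<in>mor C X Y. \<forall>g\<in>mor C Y Z.
        Fm X Z (cmp C X Y Z g f) = cmp D (Fo X) (Fo Y) (Fo Z) (Fm Y Z g) (Fm X Y f))"

definition equivalence ::
  "('k, 'r) ring_scheme \<Rightarrow> ('o, 'k, 'm, 'c) lin_cat_scheme \<Rightarrow> ('p, 'k, 'n, 'd) lin_cat_scheme \<Rightarrow>
   ('o \<Rightarrow> 'p) \<Rightarrow> ('o \<Rightarrow> 'o \<Rightarrow> 'm \<Rightarrow> 'n) \<Rightarrow> bool" where
  "equivalence K C D Fo Fm \<longleftrightarrow> linear_functor K C D Fo Fm \<and>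
     (\<forall>X\<in>ob C. \<forall>Y\<in>ob C. bij_betw (Fm X Y) (mor C X Y) (mor D (Fo X) (Fo Y))) \<and>
     (\<forall>Z\<in>ob D. \<exists>X\<in>ob C. isomorphic D (Fo X) Z)"

subsection \<open>Factor categories\<close>

definition factoring ::
  "('o, 'k, 'm, 'c) lin_cat_scheme \<Rightarrow> 'o set \<Rightarrow> 'o \<Rightarrow> 'o \<Rightarrow> 'm set" where
  "factoring C U X Y = {f. \<exists>P\<in>U. \<exists>a\<in>mor C X P. \<exists>b\<in>mor C P Y. f = cmp C X P Y b a}"

definition factor_class ::
  "('o, 'k, 'm, 'c) lin_cat_scheme \<Rightarrow> 'o set \<Rightarrow> 'o \<Rightarrow> 'o \<Rightarrow> 'm \<Rightarrow> 'm set" where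
  "factor_class C U X Y f = factoring C U X Y +>\<^bsub>Hom C X Y\<^esub> f"

definition factor_cat ::
  "('o, 'k, 'm, 'c) lin_cat_scheme \<Rightarrow> 'o set \<Rightarrow> ('o, 'k, 'm set) lin_cat" where
  "factor_cat C U =
     \<lparr>ob = ob C,
      Hom = (\<lambda>X Y. quot_module (Hom C X Y) (factoring C U X Y)),
      idm = (\<lambda>X. factor_class C U X X (idm C X)),
      cmp = (\<lambda>X Y Z G F. \<Union>g\<in>G. \<Union>f\<in>F. factor_class C U X Z (cmp C X Y Z g f))\<rparr>"

section \<open>Triangulated categories\<close>

text \<open>A sextuple \<open>(X, Y, Z, f, g, h)\<close> stands for
  \<open>X \<rightarrow>\<^sup>f Y \<rightarrow>\<^sup>g Z \<rightarrow>\<^sup>h X[1]\<close>; \<open>sh\<close> and \<open>shm\<close> are the shift on objects and morphisms.\<close>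

type_synonym ('o, 'm) triangle = "'o \<times> 'o \<times> 'o \<times> 'm \<times> 'm \<times> 'm"

record ('o, 'k, 'm) tri_cat = "('o, 'k, 'm) lin_cat" +
  sh :: "'o \<Rightarrow> 'o"
  shm :: "'o \<Rightarrow> 'o \<Rightarrow> 'm \<Rightarrow> 'm"
  tri :: "('o, 'm) triangle set"

definition is_sextuple ::
  "('o, 'k, 'm, 'c) tri_cat_scheme \<Rightarrow> ('o, 'm) triangle \<Rightarrow> bool" where
  "is_sextuple C = (\<lambda>(X, Y, Z, f, g, h). X \<in> ob C \<and> Y \<in> ob C \<and> Z \<in> ob C \<and>
     f \<in> mor C X Y \<and> g \<in> mor C Y Z \<and> h \<in> mor C Z (sh C X))"

definition tri_mor ::
  "('o, 'k, 'm, 'c) tri_cat_scheme \<Rightarrow> ('o, 'm) triangle \<Rightarrow> ('o, 'm) triangle \<Rightarrow>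
   'm \<Rightarrow> 'm \<Rightarrow> 'm \<Rightarrow> bool" where
  "tri_mor C = (\<lambda>(X, Y, Z, f, g, h) (X', Y', Z', f', g', h') a b c.
     a \<in> mor C X X' \<and> b \<in> mor C Y Y' \<and> c \<in> mor C Z Z' \<and>
     cmp C X Y Y' b f = cmp C X X' Y' f' a \<and>
     cmp C Y Z Z' c g = cmp C Y Y' Z' g' b \<and>
     cmp C Z (sh C X) (sh C X') (shm C X X' a) h = cmp C Z Z' (sh C X') h' c)"

definition tri_iso ::
  "('o, 'k, 'm, 'c) tri_cat_scheme \<Rightarrow> ('o, 'm) triangle \<Rightarrow> ('o, 'm) triangle \<Rightarrow> bool" where
  "tri_iso C = (\<lambda>(X, Y, Z, f, g, h) (X', Y', Z', f', g', h').
     is_sextuple C (X, Y, Z, f, g, h) \<and> is_sextuple C (X', Y', Z', f', g', h') \<and>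
     (\<exists>a b c. tri_mor C (X, Y, Z, f, g, h) (X', Y', Z', f', g', h') a b c \<and>
        iso_mor C X X' a \<and> iso_mor C Y Y' b \<and> iso_mor C Z Z' c))"

text \<open>The shift is only required to be an autoequivalence.\<close>

locale triangulated_category = additive_category K C
  for K :: "('k, 'r) ring_scheme" (structure) and C :: "('o, 'k, 'm, 'c) tri_cat_scheme" +
  assumes shift_equivalence: "equivalence K C C (sh C) (shm C)"
    and tri_sextuple: "t \<in> tri C \<Longrightarrow> is_sextuple C t"
    and tri_iso_closed: "\<lbrakk>t \<in> tri C; tri_iso C t t'\<rbrakk> \<Longrightarrow> t' \<in> tri C"
    and tri_identity: "\<lbrakk>X \<in> ob C; is_zero_ob C N\<rbrakk> \<Longrightarrow>
          (X, X, N, idm C X, zerom C X N, zerom C N (sh C X)) \<in> tri C"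
    and tri_complete: "\<lbrakk>X \<in> ob C; Y \<in> ob C; f \<in> mor C X Y\<rbrakk> \<Longrightarrow> \<exists>Z g h. (X, Y, Z, f, g, h) \<in> tri C"
    and tri_rotate: "is_sextuple C (X, Y, Z, f, g, h) \<Longrightarrow>
          (X, Y, Z, f, g, h) \<in> tri C \<longleftrightarrow>
          (Y, Z, sh C X, g, h, \<ominus>\<^bsub>Hom C (sh C X) (sh C Y)\<^esub> shm C X Y f) \<in> tri C"
    and tri_extend: "\<lbrakk>(X, Y, Z, f, g, h) \<in> tri C; (X', Y', Z', f', g', h') \<in> tri C;
          a \<in> mor C X X'; b \<in> mor C Y Y'; cmp C X Y Y' b f = cmp C X X' Y' f' a\<rbrakk> \<Longrightarrow>
          \<exists>c. tri_mor C (X, Y, Z, f, g, h) (X', Y', Z', f', g', h') a b c"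
    and octahedral: "\<lbrakk>(X, Y, Z', f, f', f'') \<in> tri C; (Y, Z, X', g, g', g'') \<in> tri C;
          (X, Z, Y', cmp C X Y Z g f, h', h'') \<in> tri C\<rbrakk> \<Longrightarrow>
          \<exists>u v. (Z', Y', X', u, v, cmp C X' (sh C Y) (sh C Z') (shm C Y Z' f') g'') \<in> tri C \<and>
             cmp C Y Z' Y' u f' = cmp C Y Z Y' h' g \<and>
             cmp C Z' Y' (sh C X) h'' u = f'' \<and>
             cmp C Z Y' X' v h' = g' \<and>
             cmp C Y' X' (sh C Y) g'' v = cmp C Y' (sh C X) (sh C Y) (shm C X Y f) h''"

text \<open>\<open>\<phi> X : Fo (X[1]) \<rightarrow> (Fo X)[1]\<close> is the natural isomorphism which is part of a triangle
  functor. A triangle functor which is an equivalence of categories has a quasi-inverse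
  triangle functor, so only one direction is asked for.\<close>

definition triangle_equivalent ::
  "('k, 'r) ring_scheme \<Rightarrow> ('o, 'k, 'm, 'c) tri_cat_scheme \<Rightarrow> ('p, 'k, 'n, 'd) tri_cat_scheme \<Rightarrow>
   bool" where
  "triangle_equivalent K C D \<longleftrightarrow> (\<exists>Fo Fm \<phi>. equivalence K C D Fo Fm \<and>
     (\<forall>X\<in>ob C. iso_mor D (Fo (sh C X)) (sh D (Fo X)) (\<phi> X)) \<and>
     (\<forall>X\<in>ob C. \<forall>Y\<in>ob C. \<forall>f\<in>mor C X Y.
        cmp D (Fo (sh C X)) (Fo (sh C Y)) (sh D (Fo Y)) (\<phi> Y) (Fm (sh C X) (sh C Y) (shm C X Y f)) =
        cmp D (Fo (sh C X)) (sh D (Fo X)) (sh D (Fo Y)) (shm D (Fo X) (Fo Y) (Fm X Y f)) (\<phi> X)) \<and>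
     (\<forall>(X, Y, Z, f, g, h)\<in>tri C.
        (Fo X, Fo Y, Fo Z, Fm X Y f, Fm Y Z g,
         cmp D (Fo Z) (Fo (sh C X)) (sh D (Fo X)) (\<phi> X) (Fm Z (sh C X) h)) \<in> tri D))"

text \<open>The functor \<open>D Ext\<^sup>1(A, B)\<close> is covariant in \<open>A\<close> and contravariant in \<open>B\<close>: for
  \<open>u : A \<rightarrow> A'\<close> and \<open>v : B' \<rightarrow> B\<close> it sends \<open>\<psi>\<close> to \<open>e \<mapsto> \<psi> (v[1] e u)\<close>. Correspondingly
  \<open>Ext\<^sup>1(B, A) \<rightarrow> Ext\<^sup>1(B', A')\<close> is \<open>x \<mapsto> u[1] x v\<close>.\<close>

definition two_CY :: "('k, 'r) ring_scheme \<Rightarrow> ('o, 'k, 'm, 'c) tri_cat_scheme \<Rightarrow> bool" where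
  "two_CY K C \<longleftrightarrow> (\<exists>\<Phi>.
     (\<forall>A\<in>ob C. \<forall>B\<in>ob C.
        \<Phi> A B \<in> lin_map K (dual_module K (Hom C A (sh C B))) (Hom C B (sh C A)) \<and>
        bij_betw (\<Phi> A B) (carrier (dual_module K (Hom C A (sh C B)))) (mor C B (sh C A))) \<and>
     (\<forall>A\<in>ob C. \<forall>A'\<in>ob C. \<forall>B\<in>ob C. \<forall>B'\<in>ob C. \<forall>u\<in>mor C A A'. \<forall>v\<in>mor C B' B.
        \<forall>\<psi>\<in>carrier (dual_module K (Hom C A (sh C B))).
          \<Phi> A' B' (\<lambda>e\<in>mor C A' (sh C B').
                    \<psi> (cmp C A (sh C B') (sh C B) (shm C B' B v) (cmp C A A' (sh C B') e u))) =
          cmp C B' (sh C A) (sh C A') (shm C A A' u) (cmp C B' B (sh C A) (\<Phi> A B \<psi>) v)))"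

section \<open>Frobenius categories and algebraic triangulated categories\<close>

definition is_kernel ::
  "('o, 'k, 'm, 'c) lin_cat_scheme \<Rightarrow> 'o \<Rightarrow> 'o \<Rightarrow> 'o \<Rightarrow> 'm \<Rightarrow> 'm \<Rightarrow> bool" where
  "is_kernel C X Y Z f g \<longleftrightarrow> cmp C X Y Z g f = zerom C X Z \<and>
     (\<forall>W\<in>ob C. \<forall>h\<in>mor C W Y. cmp C W Y Z g h = zerom C W Z \<longrightarrow>
        (\<exists>!k. k \<in> mor C W X \<and> cmp C W X Y f k = h))"

definition is_cokernel ::
  "('o, 'k, 'm, 'c) lin_cat_scheme \<Rightarrow> 'o \<Rightarrow> 'o \<Rightarrow> 'o \<Rightarrow> 'm \<Rightarrow> 'm \<Rightarrow> bool" where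
  "is_cokernel C X Y Z f g \<longleftrightarrow> cmp C X Y Z g f = zerom C X Z \<and>
     (\<forall>W\<in>ob C. \<forall>h\<in>mor C Y W. cmp C X Y W h f = zerom C X W \<longrightarrow>
        (\<exists>!k. k \<in> mor C Z W \<and> cmp C Y Z W k g = h))"

text \<open>\<open>f : X \<rightarrow> Y\<close>, \<open>f' : X \<rightarrow> Y'\<close>, \<open>g : Y \<rightarrow> W\<close>, \<open>g' : Y' \<rightarrow> W\<close>.\<close>

definition is_pushout ::
  "('o, 'k, 'm, 'c) lin_cat_scheme \<Rightarrow> 'o \<Rightarrow> 'o \<Rightarrow> 'o \<Rightarrow> 'o \<Rightarrow> 'm \<Rightarrow> 'm \<Rightarrow> 'm \<Rightarrow> 'm \<Rightarrow> bool" where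
  "is_pushout C X Y Y' W f f' g g' \<longleftrightarrow>
     W \<in> ob C \<and> g \<in> mor C Y W \<and> g' \<in> mor C Y' W \<and> cmp C X Y W g f = cmp C X Y' W g' f' \<and>
     (\<forall>V\<in>ob C. \<forall>h\<in>mor C Y V. \<forall>h'\<in>mor C Y' V. cmp C X Y V h f = cmp C X Y' V h' f' \<longrightarrow>
        (\<exists>!k. k \<in> mor C W V \<and> cmp C Y W V k g = h \<and> cmp C Y' W V k g' = h'))"

text \<open>\<open>f : Y \<rightarrow> X\<close>, \<open>f' : Y' \<rightarrow> X\<close>, \<open>g : W \<rightarrow> Y\<close>, \<open>g' : W \<rightarrow> Y'\<close>.\<close>

definition is_pullback ::
  "('o, 'k, 'm, 'c) lin_cat_scheme \<Rightarrow> 'o \<Rightarrow> 'o \<Rightarrow> 'o \<Rightarrow> 'o \<Rightarrow> 'm \<Rightarrow> 'm \<Rightarrow> 'm \<Rightarrow> 'm \<Rightarrow> bool" where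
  "is_pullback C X Y Y' W f f' g g' \<longleftrightarrow>
     W \<in> ob C \<and> g \<in> mor C W Y \<and> g' \<in> mor C W Y' \<and> cmp C W Y X f g = cmp C W Y' X f' g' \<and>
     (\<forall>V\<in>ob C. \<forall>h\<in>mor C V Y. \<forall>h'\<in>mor C V Y'. cmp C V Y X f h = cmp C V Y' X f' h' \<longrightarrow>
        (\<exists>!k. k \<in> mor C V W \<and> cmp C V W Y g k = h \<and> cmp C V W Y' g' k = h'))"

text \<open>A conflation \<open>(X, Y, Z, f, g)\<close> is a short exact sequence \<open>X \<rightarrow>\<^sup>f Y \<rightarrow>\<^sup>g Z\<close>.\<close>

record ('o, 'k, 'm) ex_cat = "('o, 'k, 'm) lin_cat" +
  confl :: "('o \<times> 'o \<times> 'o \<times> 'm \<times> 'm) set"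

definition inflation :: "('o, 'k, 'm, 'c) ex_cat_scheme \<Rightarrow> 'o \<Rightarrow> 'o \<Rightarrow> 'm \<Rightarrow> bool" where
  "inflation E X Y f \<longleftrightarrow> (\<exists>Z g. (X, Y, Z, f, g) \<in> confl E)"

definition deflation :: "('o, 'k, 'm, 'c) ex_cat_scheme \<Rightarrow> 'o \<Rightarrow> 'o \<Rightarrow> 'm \<Rightarrow> bool" where
  "deflation E Y Z g \<longleftrightarrow> (\<exists>X f. (X, Y, Z, f, g) \<in> confl E)"

locale exact_category = additive_category K E
  for K :: "('k, 'r) ring_scheme" (structure) and E :: "('o, 'k, 'm, 'c) ex_cat_scheme" +
  assumes confl_kernel_cokernel: "(X, Y, Z, f, g) \<in> confl E \<Longrightarrow>
          X \<in> ob E \<and> Y \<in> ob E \<and> Z \<in> ob E \<and> f \<in> mor E X Y \<and> g \<in> mor E Y Z \<and>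
          is_kernel E X Y Z f g \<and> is_cokernel E X Y Z f g"
    and confl_iso_closed: "\<lbrakk>(X, Y, Z, f, g) \<in> confl E; X' \<in> ob E; Y' \<in> ob E; Z' \<in> ob E;
          f' \<in> mor E X' Y'; g' \<in> mor E Y' Z';
          iso_mor E X X' a; iso_mor E Y Y' b; iso_mor E Z Z' c;
          cmp E X Y Y' b f = cmp E X X' Y' f' a; cmp E Y Z Z' c g = cmp E Y Y' Z' g' b\<rbrakk> \<Longrightarrow>
          (X', Y', Z', f', g') \<in> confl E"
    and inflation_idm: "X \<in> ob E \<Longrightarrow> inflation E X X (idm E X)"
    and deflation_idm: "X \<in> ob E \<Longrightarrow> deflation E X X (idm E X)"
    and inflation_cmp: "\<lbrakk>inflation E X Y f; inflation E Y Z g\<rbrakk> \<Longrightarrow> inflation E X Z (cmp E X Y Z g f)"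
    and deflation_cmp: "\<lbrakk>deflation E X Y f; deflation E Y Z g\<rbrakk> \<Longrightarrow> deflation E X Z (cmp E X Y Z g f)"
    and inflation_pushout: "\<lbrakk>inflation E X Y i; X' \<in> ob E; f \<in> mor E X X'\<rbrakk> \<Longrightarrow>
          \<exists>W g i'. is_pushout E X Y X' W i f g i' \<and> inflation E X' W i'"
    and deflation_pullback: "\<lbrakk>deflation E Y X p; X' \<in> ob E; f \<in> mor E X' X\<rbrakk> \<Longrightarrow>
          \<exists>W g p'. is_pullback E X Y X' W p f g p' \<and> deflation E W X' p'"

definition ex_projective :: "('o, 'k, 'm, 'c) ex_cat_scheme \<Rightarrow> 'o \<Rightarrow> bool" where
  "ex_projective E P \<longleftrightarrow> P \<in> ob E \<and> (\<forall>Y Z p. deflation E Y Z p \<longrightarrow>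
     (\<forall>h\<in>mor E P Z. \<exists>k\<in>mor E P Y. cmp E P Y Z p k = h))"

definition ex_injective :: "('o, 'k, 'm, 'c) ex_cat_scheme \<Rightarrow> 'o \<Rightarrow> bool" where
  "ex_injective E I \<longleftrightarrow> I \<in> ob E \<and> (\<forall>X Y i. inflation E X Y i \<longrightarrow>
     (\<forall>h\<in>mor E X I. \<exists>k\<in>mor E Y I. cmp E X Y I k i = h))"

locale frobenius_category = exact_category +
  assumes enough_projectives: "X \<in> ob E \<Longrightarrow> \<exists>P p. ex_projective E P \<and> deflation E P X p"
    and enough_injectives: "X \<in> ob E \<Longrightarrow> \<exists>I i. ex_injective E I \<and> inflation E X I i"
    and projective_iff_injective: "ex_projective E P \<longleftrightarrow> ex_injective E P"

text \<open>A choice, for every object \<open>X\<close>, of a conflation \<open>X \<rightarrow> I X \<rightarrow> S X\<close> with \<open>I X\<close> injective. It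
  determines the shift functor \<open>S\<close> of the stable category.\<close>

definition injective_hulls ::
  "('o, 'k, 'm, 'c) ex_cat_scheme \<Rightarrow> ('o \<Rightarrow> 'o) \<Rightarrow> ('o \<Rightarrow> 'o) \<Rightarrow> ('o \<Rightarrow> 'm) \<Rightarrow> ('o \<Rightarrow> 'm) \<Rightarrow> bool" where
  "injective_hulls E I S \<iota> \<pi> \<longleftrightarrow>
     (\<forall>X\<in>ob E. ex_injective E (I X) \<and> (X, I X, S X, \<iota> X, \<pi> X) \<in> confl E)"

abbreviation stable_class ::
  "('o, 'k, 'm, 'c) ex_cat_scheme \<Rightarrow> 'o \<Rightarrow> 'o \<Rightarrow> 'm \<Rightarrow> 'm set" where
  "stable_class E X Y f \<equiv> factor_class E {P. ex_projective E P} X Y f"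

text \<open>The shift of the class of \<open>f : X \<rightarrow> Y\<close> is the class of any \<open>b\<close> in a commutative diagram
  with rows \<open>X \<rightarrow> I X \<rightarrow> S X\<close>, \<open>Y \<rightarrow> I Y \<rightarrow> S Y\<close> and columns \<open>f, a, b\<close>.\<close>

definition stable_shift ::
  "('o, 'k, 'm, 'c) ex_cat_scheme \<Rightarrow> ('o \<Rightarrow> 'o) \<Rightarrow> ('o \<Rightarrow> 'o) \<Rightarrow> ('o \<Rightarrow> 'm) \<Rightarrow> ('o \<Rightarrow> 'm) \<Rightarrow>
   'o \<Rightarrow> 'o \<Rightarrow> 'm set \<Rightarrow> 'm set" where
  "stable_shift E I S \<iota> \<pi> X Y F =
     \<Union> {stable_class E (S X) (S Y) b | f a b.
          f \<in> F \<and> a \<in> mor E (I X) (I Y) \<and> b \<in> mor E (S X) (S Y) \<and>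
          cmp E X (I X) (I Y) a (\<iota> X) = cmp E X Y (I Y) (\<iota> Y) f \<and>
          cmp E (I X) (S X) (S Y) b (\<pi> X) = cmp E (I X) (I Y) (S Y) (\<pi> Y) a}"

text \<open>For \<open>f : X \<rightarrow> Y\<close> let \<open>Z\<close> be the pushout of \<open>\<iota> X\<close> and \<open>f\<close>, with \<open>a : I X \<rightarrow> Z\<close> and
  \<open>g : Y \<rightarrow> Z\<close>, and let \<open>h : Z \<rightarrow> S X\<close> be given by \<open>h a = \<pi> X\<close>, \<open>h g = 0\<close>.\<close>

definition standard_triangles ::
  "('o, 'k, 'm, 'c) ex_cat_scheme \<Rightarrow> ('o \<Rightarrow> 'o) \<Rightarrow> ('o \<Rightarrow> 'o) \<Rightarrow> ('o \<Rightarrow> 'm) \<Rightarrow> ('o \<Rightarrow> 'm) \<Rightarrow>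
   ('o, 'm set) triangle set" where
  "standard_triangles E I S \<iota> \<pi> =
     {(X, Y, Z, stable_class E X Y f, stable_class E Y Z g, stable_class E Z (S X) h) |
        X Y Z f g h. X \<in> ob E \<and> Y \<in> ob E \<and> f \<in> mor E X Y \<and> h \<in> mor E Z (S X) \<and>
        (\<exists>a. is_pushout E X (I X) Y Z (\<iota> X) f a g \<and>
           cmp E (I X) Z (S X) h a = \<pi> X \<and> cmp E Y Z (S X) h g = zerom E Y (S X))}"

definition stable_cat_of ::
  "('o, 'k, 'm, 'c) ex_cat_scheme \<Rightarrow> ('o \<Rightarrow> 'o) \<Rightarrow> ('o \<Rightarrow> 'o) \<Rightarrow> ('o \<Rightarrow> 'm) \<Rightarrow> ('o \<Rightarrow> 'm) \<Rightarrow>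
   ('o, 'm set) triangle set \<Rightarrow> ('o, 'k, 'm set) tri_cat" where
  "stable_cat_of E I S \<iota> \<pi> \<Delta> = lin_cat.extend (factor_cat E {P. ex_projective E P})
     \<lparr>sh = S, shm = stable_shift E I S \<iota> \<pi>, tri = \<Delta>\<rparr>"

definition stable_cat ::
  "('o, 'k, 'm, 'c) ex_cat_scheme \<Rightarrow> ('o \<Rightarrow> 'o) \<Rightarrow> ('o \<Rightarrow> 'o) \<Rightarrow> ('o \<Rightarrow> 'm) \<Rightarrow> ('o \<Rightarrow> 'm) \<Rightarrow>
   ('o, 'k, 'm set) tri_cat" where
  "stable_cat E I S \<iota> \<pi> = stable_cat_of E I S \<iota> \<pi>
     {t. \<exists>t'\<in>standard_triangles E I S \<iota> \<pi>. tri_iso (stable_cat_of E I S \<iota> \<pi> {}) t' t}"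

text \<open>\<open>C\<close> is algebraic, with the Frobenius category \<open>E\<close> as a witness. (The witness is a parameter
  because types cannot be quantified existentially; as a hypothesis this makes no difference.)
  Like all categories here, \<open>E\<close> is a Krull--Schmidt category.\<close>

definition algebraic_by ::
  "('k, 'r) ring_scheme \<Rightarrow> ('p, 'k, 'n, 'd) ex_cat_scheme \<Rightarrow> ('o, 'k, 'm, 'c) tri_cat_scheme \<Rightarrow>
   bool" where
  "algebraic_by K E C \<longleftrightarrow> frobenius_category K E \<and> krull_schmidt_category K E \<and>
     (\<exists>I S \<iota> \<pi>. injective_hulls E I S \<iota> \<pi> \<and> triangle_equivalent K (stable_cat E I S \<iota> \<pi>) C)"

section \<open>Rigid and cluster tilting objects\<close>

definition ext_vanishes :: "('o, 'k, 'm, 'c) tri_cat_scheme \<Rightarrow> 'o \<Rightarrow> 'o \<Rightarrow> bool" where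
  "ext_vanishes C X Y \<longleftrightarrow> mor C X (sh C Y) = {zerom C X (sh C Y)}"

definition extension_closed :: "('o, 'k, 'm, 'c) tri_cat_scheme \<Rightarrow> 'o set \<Rightarrow> bool" where
  "extension_closed C U \<longleftrightarrow>
     (\<forall>X Y Z f g h. (X, Y, Z, f, g, h) \<in> tri C \<longrightarrow> X \<in> U \<longrightarrow> Z \<in> U \<longrightarrow> Y \<in> U)"

text \<open>In the following, \<open>B\<close> is an extension closed subcategory of \<open>C\<close>, the case \<open>B = ob C\<close>
  being the one of \<open>C\<close> itself. Extensions between objects of \<open>B\<close> are computed in \<open>C\<close>.\<close>

definition rigid :: "('o, 'k, 'm, 'c) tri_cat_scheme \<Rightarrow> 'o set \<Rightarrow> 'o \<Rightarrow> bool" where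
  "rigid C B T \<longleftrightarrow> T \<in> B \<and> ext_vanishes C T T"

definition rigid_subcategory :: "('o, 'k, 'm, 'c) tri_cat_scheme \<Rightarrow> 'o set \<Rightarrow> 'o set \<Rightarrow> bool" where
  "rigid_subcategory C B U \<longleftrightarrow> subcategory C U \<and> U \<subseteq> B \<and> (\<forall>X\<in>U. \<forall>Y\<in>U. ext_vanishes C X Y)"

definition maximal_rigid :: "('o, 'k, 'm, 'c) tri_cat_scheme \<Rightarrow> 'o set \<Rightarrow> 'o \<Rightarrow> bool" where
  "maximal_rigid C B T \<longleftrightarrow> T \<in> B \<and> rigid_subcategory C B (add_of C {T}) \<and>
     (\<forall>U. rigid_subcategory C B U \<longrightarrow> add_of C {T} \<subseteq> U \<longrightarrow> U = add_of C {T})"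

definition cluster_tilting :: "('o, 'k, 'm, 'c) tri_cat_scheme \<Rightarrow> 'o set \<Rightarrow> 'o \<Rightarrow> bool" where
  "cluster_tilting C B T \<longleftrightarrow> rigid C B T \<and> (\<forall>X\<in>B. ext_vanishes C T X \<longrightarrow> X \<in> add_of C {T})"

definition projective_in :: "('o, 'k, 'm, 'c) tri_cat_scheme \<Rightarrow> 'o set \<Rightarrow> 'o \<Rightarrow> bool" where
  "projective_in C B X \<longleftrightarrow> X \<in> B \<and> (\<forall>Y\<in>B. ext_vanishes C X Y)"

section \<open>Weak cluster structures\<close>

text \<open>Sets of (non-isomorphic) indecomposables are sets of isomorphism classes; they are
  represented by sets of objects which are closed under isomorphism.\<close>

definition indec_set :: "('o, 'k, 'm, 'c) lin_cat_scheme \<Rightarrow> 'o set \<Rightarrow> 'o set \<Rightarrow> bool" where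
  "indec_set C B x \<longleftrightarrow> x \<subseteq> B \<and> (\<forall>X\<in>x. indecomposable C X \<and> iso_class C X \<subseteq> x)"

definition replace_by :: "('o, 'k, 'm, 'c) lin_cat_scheme \<Rightarrow> 'o set \<Rightarrow> 'o \<Rightarrow> 'o \<Rightarrow> 'o set" where
  "replace_by C T M N = (T - iso_class C M) \<union> iso_class C N"

definition exchange_triangles ::
  "('o, 'k, 'm, 'c) tri_cat_scheme \<Rightarrow> 'o set \<Rightarrow> 'o \<Rightarrow> 'o \<Rightarrow> bool" where
  "exchange_triangles C T M N \<longleftrightarrow> (let U = add_of C (T - iso_class C M) in
     (\<exists>V f g h. (N, V, M, f, g, h) \<in> tri C \<and>
        min_right_approx C U V M g \<and> min_left_approx C U N V f) \<and>
     (\<exists>V' s t h. (M, V', N, s, t, h) \<in> tri C \<and>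
        min_right_approx C U V' N t \<and> min_left_approx C U M V' s))"

text \<open>\<open>N\<close> is a possible exchange for \<open>M\<close> in \<open>T\<close>, where \<open>\<T>\<close> is the collection of extended clusters.\<close>

definition exchange ::
  "('o, 'k, 'm, 'c) lin_cat_scheme \<Rightarrow> 'o set \<Rightarrow> 'o set set \<Rightarrow> 'o set \<Rightarrow> 'o \<Rightarrow> 'o \<Rightarrow> bool" where
  "exchange C B \<T> T M N \<longleftrightarrow>
     N \<in> B \<and> indecomposable C N \<and> \<not> isomorphic C M N \<and> replace_by C T M N \<in> \<T>"

text \<open>The structure is given by the extended clusters \<open>\<T>\<close> and the coefficients \<open>p\<close>; the
  clusters are the sets \<open>T - p\<close> for \<open>T \<in> \<T>\<close>, so no coefficient is a cluster variable.\<close>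

definition weak_cluster_structure ::
  "('o, 'k, 'm, 'c) tri_cat_scheme \<Rightarrow> 'o set \<Rightarrow> 'o set set \<Rightarrow> 'o set \<Rightarrow> bool" where
  "weak_cluster_structure C B \<T> p \<longleftrightarrow> indec_set C B p \<and>
     (\<forall>T\<in>\<T>. indec_set C B T \<and> p \<subseteq> T \<and>
        (\<forall>M\<in>T - p. \<exists>N. exchange C B \<T> T M N \<and>
           (\<forall>N'. exchange C B \<T> T M N' \<longrightarrow> isomorphic C N N') \<and>
           exchange_triangles C T M N))"

inductive_set reachable ::
  "('o, 'k, 'm, 'c) lin_cat_scheme \<Rightarrow> 'o set \<Rightarrow> 'o set set \<Rightarrow> 'o set \<Rightarrow> 'o set \<Rightarrow> 'o set set"
  for C B \<T> p T where
    start: "T \<in> reachable C B \<T> p T"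
  | step: "\<lbrakk>T' \<in> reachable C B \<T> p T; M \<in> T' - p; exchange C B \<T> T' M N\<rbrakk> \<Longrightarrow>
       replace_by C T' M N \<in> reachable C B \<T> p T"

text \<open>The extended cluster \<open>T\<close> of the structure \<open>(\<T>, p)\<close> on \<open>B\<close> determines a substructure of the
  structure \<open>(\<S>, q)\<close> on \<open>C\<close>.\<close>

definition determines_substructure ::
  "('o, 'k, 'm, 'c) tri_cat_scheme \<Rightarrow> 'o set \<Rightarrow> 'o set set \<Rightarrow> 'o set \<Rightarrow> 'o set set \<Rightarrow> 'o set \<Rightarrow>
   'o set \<Rightarrow> bool" where
  "determines_substructure C B \<T> p \<S> q T \<longleftrightarrow>
     subcategory C B \<and> extension_closed C B \<and>
     weak_cluster_structure C B \<T> p \<and> weak_cluster_structure C (ob C) \<S> q \<and> T \<in> \<T> \<and>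
     (\<exists>A. indec_set C (ob C) A \<and> (\<forall>T'\<in>reachable C B \<T> p T. T' \<union> A \<in> \<S>))"

definition ct_clusters :: "('o, 'k, 'm, 'c) tri_cat_scheme \<Rightarrow> 'o set \<Rightarrow> 'o set set" where
  "ct_clusters C B = {ind_summands C T | T. cluster_tilting C B T}"

text \<open>For \<open>B = ob C\<close> this is empty: \<open>X\<close> is isomorphic to some \<open>Y[1]\<close>, so a projective \<open>X\<close> has
  zero identity.\<close>

definition ct_coefficients :: "('o, 'k, 'm, 'c) tri_cat_scheme \<Rightarrow> 'o set \<Rightarrow> 'o set" where
  "ct_coefficients C B = {X. indecomposable C X \<and> projective_in C B X}"

end

theory Submission
  imports Defs
begin

text \<open>Let \<open>T\<close> be cluster tilting in \<open>C\<close> and let \<open>B\<^sup>\<bottom>\<close> be the class of objects without extensions with \<open>B\<close>. By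
  Wakamatsu's lemma a minimal left \<open>B\<close>-approximation of \<open>T\<close> gives a triangle \<open>T \<rightarrow> B0 \<rightarrow> W \<rightarrow> T[1]\<close> with
  \<open>W \<in> B\<^sup>\<bottom>\<close>; both \<open>B0\<close> and \<open>W\<close> are rigid. A rigid \<open>R\<close> such that every map from \<open>T\<close> to an object of the
  right perpendicular class of \<open>R\<close> factors through \<open>add R\<close> is cluster tilting: extensions \<open>f : X \<rightarrow> Y[1]\<close>
  and \<open>g : Y \<rightarrow> X[1]\<close> in this class kill all maps from \<open>T\<close>, so \<open>g[1] f = 0\<close>, and the Calabi--Yau pairing
  forces \<open>f = 0\<close>. Hence \<open>B0 \<oplus> W\<close> is cluster tilting in \<open>C\<close>. An indecomposable object without extensions
  with the projectives \<open>B \<inter> B\<^sup>\<bottom>\<close> of \<open>B\<close> lies in \<open>B\<close> or in \<open>B\<^sup>\<bottom>\<close>, so that questions about \<open>B\<close> can be answered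
  in \<open>C\<close> after adding \<open>W\<close>; in particular \<open>A = W\<close> works for all cluster tilting objects of \<open>B\<close>, and the weak
  cluster structure on \<open>B\<close> is obtained from the one on \<open>C\<close>. In \<open>C\<close> the exchange triangles are given by
  minimal approximations, and the uniqueness of the exchange follows from the theorem of Dehy and Keller
  that the terms of a minimal presentation of a rigid object have no common summand.\<close>

section \<open>Arrows\<close>

text \<open>The factor category of B by its projectives is never formed: extensions in B are
  extensions in C, and B is studied through the pair consisting of B and its perpendicular class.
  The difficulty is to test an arbitrary R in B against the given T, which need not lie in B.
  Suppose R is rigid, contains all projectives of B, and admits no further compatible rigid
  indecomposable in B. Take a left add(R + W)-approximation of T. Its cone Y is rigid and has no
  extensions with R + W. Each indecomposable summand of Y lies in B or in the perpendicular class;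
  in the first case the maximality of R, in the second the fact that B0 + W is cluster tilting, puts
  it into add(R + W). Hence extensions of Y by an object X perpendicular to R + W vanish, and maps
  from T to X extend along the approximation, as the criterion requires. Maximal rigid and cluster
  tilting objects of B are covered by this one argument. Modules over End T and dimension counts do
  not occur: additive closures are expressed by identities lying in an ideal of maps, and summands
  are compared through local endomorphism rings.\<close>

text \<open>An arrow carries its source and target. The value \<open>None\<close> stands for an ill-typed expression and
  is absorbing, so that associativity and distributivity hold without side conditions.\<close>

type_synonym ('o, 'm) arrow = "('o \<times> 'm \<times> 'o) option"

definition src :: "('o, 'm) arrow \<Rightarrow> 'o" where "src a = fst (the a)"
definition val :: "('o, 'm) arrow \<Rightarrow> 'm" where "val a = fst (snd (the a))"
definition tgt :: "('o, 'm) arrow \<Rightarrow> 'o" where "tgt a = snd (snd (the a))"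

lemma src_Some [simp]: "src (Some (X, f, Y)) = X"
  and val_Some [simp]: "val (Some (X, f, Y)) = f"
  and tgt_Some [simp]: "tgt (Some (X, f, Y)) = Y"
  by (simp_all add: src_def val_def tgt_def)

context k_category
begin

definition arr :: "('o, 'm) arrow \<Rightarrow> bool" where
  "arr a \<longleftrightarrow> (\<exists>X f Y. a = Some (X, f, Y) \<and> X \<in> ob C \<and> Y \<in> ob C \<and> f \<in> mor C X Y)"

definition comp :: "('o, 'm) arrow \<Rightarrow> ('o, 'm) arrow \<Rightarrow> ('o, 'm) arrow" (infixr \<open>\<star>\<close> 70) where
  "b \<star> a = (if arr b \<and> arr a \<and> tgt a = src b
            then Some (src a, cmp C (src a) (tgt a) (tgt b) (val b) (val a), tgt b) else None)"

definition plus :: "('o, 'm) arrow \<Rightarrow> ('o, 'm) arrow \<Rightarrow> ('o, 'm) arrow" (infixl \<open>\<boxplus>\<close> 65) where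
  "a \<boxplus> b = (if arr a \<and> arr b \<and> src a = src b \<and> tgt a = tgt b
            then Some (src a, val a \<oplus>\<^bsub>Hom C (src a) (tgt a)\<^esub> val b, tgt a) else None)"

definition neg :: "('o, 'm) arrow \<Rightarrow> ('o, 'm) arrow" where
  "neg a = (if arr a then Some (src a, \<ominus>\<^bsub>Hom C (src a) (tgt a)\<^esub> val a, tgt a) else None)"

definition zr :: "'o \<Rightarrow> 'o \<Rightarrow> ('o, 'm) arrow" where
  "zr X Y = (if X \<in> ob C \<and> Y \<in> ob C then Some (X, zerom C X Y, Y) else None)"

definition un :: "'o \<Rightarrow> ('o, 'm) arrow" where
  "un X = (if X \<in> ob C then Some (X, idm C X, X) else None)"

definition H :: "'o \<Rightarrow> 'o \<Rightarrow> ('o, 'm) arrow set" where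
  "H X Y = {a. arr a \<and> src a = X \<and> tgt a = Y}"

lemma H_iff: "a \<in> H X Y \<longleftrightarrow> arr a \<and> src a = X \<and> tgt a = Y"
  by (simp add: H_def)

lemma arr_None [simp]: "\<not> arr None"
  by (simp add: arr_def)

lemma arr_Some [simp]: "arr (Some (X, f, Y)) \<longleftrightarrow> X \<in> ob C \<and> Y \<in> ob C \<and> f \<in> mor C X Y"
  by (simp add: arr_def)

lemma arrE:
  assumes "arr a"
  obtains X f Y where "a = Some (X, f, Y)" "X \<in> ob C" "Y \<in> ob C" "f \<in> mor C X Y"
  using assms by (auto simp: arr_def)

lemma HE:
  assumes "a \<in> H X Y"
  obtains f where "a = Some (X, f, Y)" "X \<in> ob C" "Y \<in> ob C" "f \<in> mor C X Y"
  using assms by (auto simp: H_iff elim: arrE)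

lemma H_Some [simp]:
  "Some (X, f, Y) \<in> H X' Y' \<longleftrightarrow> X = X' \<and> Y = Y' \<and> X \<in> ob C \<and> Y \<in> ob C \<and> f \<in> mor C X Y"
  by (auto simp: H_iff)

lemma H_ob: "a \<in> H X Y \<Longrightarrow> X \<in> ob C \<and> Y \<in> ob C"
  by (auto elim: HE)

lemma src_ob: "arr a \<Longrightarrow> src a \<in> ob C" and tgt_ob: "arr a \<Longrightarrow> tgt a \<in> ob C"
  by (auto elim: arrE)

lemma arr_mor: "arr a \<Longrightarrow> val a \<in> mor C (src a) (tgt a)" and arr_eta: "arr a \<Longrightarrow> Some (src a, val a, tgt a) = a"
  by (auto elim: arrE)

lemma Hom_group: "X \<in> ob C \<Longrightarrow> Y \<in> ob C \<Longrightarrow> abelian_group (Hom C X Y)"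
  using Hom_module module.axioms(2) by blast

lemma cmp_mor: "\<lbrakk>X \<in> ob C; Y \<in> ob C; Z \<in> ob C; f \<in> mor C X Y; g \<in> mor C Y Z\<rbrakk> \<Longrightarrow>
    cmp C X Y Z g f \<in> mor C X Z"
  using cmp_linear_left[of X Y Z f] by (auto simp: lin_map_def)

lemma cmp_add_left: "\<lbrakk>X \<in> ob C; Y \<in> ob C; Z \<in> ob C; f \<in> mor C X Y; g \<in> mor C Y Z; g' \<in> mor C Y Z\<rbrakk> \<Longrightarrow>
    cmp C X Y Z (g \<oplus>\<^bsub>Hom C Y Z\<^esub> g') f = cmp C X Y Z g f \<oplus>\<^bsub>Hom C X Z\<^esub> cmp C X Y Z g' f"
  using cmp_linear_left[of X Y Z f] by (auto simp: lin_map_def)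

lemma cmp_add_right: "\<lbrakk>X \<in> ob C; Y \<in> ob C; Z \<in> ob C; f \<in> mor C X Y; f' \<in> mor C X Y; g \<in> mor C Y Z\<rbrakk> \<Longrightarrow>
    cmp C X Y Z g (f \<oplus>\<^bsub>Hom C X Y\<^esub> f') = cmp C X Y Z g f \<oplus>\<^bsub>Hom C X Z\<^esub> cmp C X Y Z g f'"
  using cmp_linear_right[of X Y Z g] by (auto simp: lin_map_def)

lemma cmp_smult_right: "\<lbrakk>X \<in> ob C; Y \<in> ob C; Z \<in> ob C; f \<in> mor C X Y; g \<in> mor C Y Z; c \<in> carrier K\<rbrakk> \<Longrightarrow>
    cmp C X Y Z g (c \<odot>\<^bsub>Hom C X Y\<^esub> f) = c \<odot>\<^bsub>Hom C X Z\<^esub> cmp C X Y Z g f"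
  using cmp_linear_right[of X Y Z g] by (auto simp: lin_map_def)

text \<open>\<open>lin_map\<close> records additivity and scalars only, so zero and negatives have
  to be recovered by cancellation. It is applied to composition in either variable and to the
  shift.\<close>

lemma group_hom_zero_neg:
  assumes A: "abelian_group A" and B: "abelian_group B" and m: "\<phi> \<in> carrier A \<rightarrow> carrier B"
    and a: "\<And>x y. x \<in> carrier A \<Longrightarrow> y \<in> carrier A \<Longrightarrow> \<phi> (x \<oplus>\<^bsub>A\<^esub> y) = \<phi> x \<oplus>\<^bsub>B\<^esub> \<phi> y"
  shows "\<phi> \<zero>\<^bsub>A\<^esub> = \<zero>\<^bsub>B\<^esub>" "x \<in> carrier A \<Longrightarrow> \<phi> (\<ominus>\<^bsub>A\<^esub> x) = \<ominus>\<^bsub>B\<^esub> \<phi> x"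
proof -
  interpret A: abelian_group A by fact
  interpret B: abelian_group B by fact
  have z: "\<phi> \<zero>\<^bsub>A\<^esub> \<in> carrier B" using m by auto
  have "\<phi> \<zero>\<^bsub>A\<^esub> \<oplus>\<^bsub>B\<^esub> \<phi> \<zero>\<^bsub>A\<^esub> = \<phi> \<zero>\<^bsub>A\<^esub> \<oplus>\<^bsub>B\<^esub> \<zero>\<^bsub>B\<^esub>"
    using a[of "\<zero>\<^bsub>A\<^esub>" "\<zero>\<^bsub>A\<^esub>"] z by simp
  then show zz: "\<phi> \<zero>\<^bsub>A\<^esub> = \<zero>\<^bsub>B\<^esub>" using z B.add.l_cancel by blast
  assume x: "x \<in> carrier A"
  have "\<phi> (\<ominus>\<^bsub>A\<^esub> x) \<oplus>\<^bsub>B\<^esub> \<phi> x = \<zero>\<^bsub>B\<^esub>"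
    using a[of "\<ominus>\<^bsub>A\<^esub> x" x] x zz by (simp add: A.l_neg)
  moreover have "\<phi> x \<in> carrier B" "\<phi> (\<ominus>\<^bsub>A\<^esub> x) \<in> carrier B"
    using m x A.a_inv_closed[OF x] by auto
  ultimately show "\<phi> (\<ominus>\<^bsub>A\<^esub> x) = \<ominus>\<^bsub>B\<^esub> \<phi> x"
    by (rule B.minus_equality[symmetric])
qed

lemma cmp_zero_left: "\<lbrakk>X \<in> ob C; Y \<in> ob C; Z \<in> ob C; f \<in> mor C X Y\<rbrakk> \<Longrightarrow>
    cmp C X Y Z (zerom C Y Z) f = zerom C X Z"
  and cmp_neg_left: "\<lbrakk>X \<in> ob C; Y \<in> ob C; Z \<in> ob C; f \<in> mor C X Y; g \<in> mor C Y Z\<rbrakk> \<Longrightarrow>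
    cmp C X Y Z (\<ominus>\<^bsub>Hom C Y Z\<^esub> g) f = \<ominus>\<^bsub>Hom C X Z\<^esub> cmp C X Y Z g f"
  using group_hom_zero_neg[of "Hom C Y Z" "Hom C X Z" "\<lambda>g. cmp C X Y Z g f"]
  by (auto simp: Hom_group cmp_mor cmp_add_left)

lemma cmp_zero_right: "\<lbrakk>X \<in> ob C; Y \<in> ob C; Z \<in> ob C; g \<in> mor C Y Z\<rbrakk> \<Longrightarrow>
    cmp C X Y Z g (zerom C X Y) = zerom C X Z"
  and cmp_neg_right: "\<lbrakk>X \<in> ob C; Y \<in> ob C; Z \<in> ob C; f \<in> mor C X Y; g \<in> mor C Y Z\<rbrakk> \<Longrightarrow>
    cmp C X Y Z g (\<ominus>\<^bsub>Hom C X Y\<^esub> f) = \<ominus>\<^bsub>Hom C X Z\<^esub> cmp C X Y Z g f"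
  using group_hom_zero_neg[of "Hom C X Y" "Hom C X Z" "\<lambda>f. cmp C X Y Z g f"]
  by (auto simp: Hom_group cmp_mor cmp_add_right)

lemma mor_zero: "X \<in> ob C \<Longrightarrow> Y \<in> ob C \<Longrightarrow> zerom C X Y \<in> mor C X Y"
  by (rule abelian_monoid.zero_closed[OF abelian_group.axioms(1)[OF Hom_group]])

lemma mor_add: "\<lbrakk>X \<in> ob C; Y \<in> ob C; f \<in> mor C X Y; g \<in> mor C X Y\<rbrakk> \<Longrightarrow>
    f \<oplus>\<^bsub>Hom C X Y\<^esub> g \<in> mor C X Y"
  by (rule abelian_monoid.a_closed[OF abelian_group.axioms(1)[OF Hom_group]])

lemma mor_neg: "\<lbrakk>X \<in> ob C; Y \<in> ob C; f \<in> mor C X Y\<rbrakk> \<Longrightarrow> \<ominus>\<^bsub>Hom C X Y\<^esub> f \<in> mor C X Y"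
  by (rule abelian_group.a_inv_closed[OF Hom_group])

lemma arr_comp [simp]: "arr (b \<star> a) \<longleftrightarrow> arr b \<and> arr a \<and> tgt a = src b"
  by (auto simp: comp_def cmp_mor elim!: arrE)

lemma src_comp [simp]: "arr b \<Longrightarrow> arr a \<Longrightarrow> tgt a = src b \<Longrightarrow> src (b \<star> a) = src a"
  and tgt_comp [simp]: "arr b \<Longrightarrow> arr a \<Longrightarrow> tgt a = src b \<Longrightarrow> tgt (b \<star> a) = tgt b"
  by (simp_all add: comp_def)

lemma arr_plus [simp]: "arr (a \<boxplus> b) \<longleftrightarrow> arr a \<and> arr b \<and> src a = src b \<and> tgt a = tgt b"
  by (auto simp: plus_def mor_add elim!: arrE)

lemma src_plus [simp]: "arr a \<Longrightarrow> arr b \<Longrightarrow> src a = src b \<Longrightarrow> tgt a = tgt b \<Longrightarrow> src (a \<boxplus> b) = src b"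
  and tgt_plus [simp]: "arr a \<Longrightarrow> arr b \<Longrightarrow> src a = src b \<Longrightarrow> tgt a = tgt b \<Longrightarrow> tgt (a \<boxplus> b) = tgt b"
  by (simp_all add: plus_def)

lemma arr_neg [simp]: "arr (neg a) \<longleftrightarrow> arr a"
  by (auto simp: neg_def mor_neg elim!: arrE)

lemma src_neg [simp]: "arr a \<Longrightarrow> src (neg a) = src a" and tgt_neg [simp]: "arr a \<Longrightarrow> tgt (neg a) = tgt a"
  by (simp_all add: neg_def)

lemma arr_zr [simp]: "arr (zr X Y) \<longleftrightarrow> X \<in> ob C \<and> Y \<in> ob C"
  by (auto simp: zr_def mor_zero)

lemma src_zr [simp]: "X \<in> ob C \<Longrightarrow> Y \<in> ob C \<Longrightarrow> src (zr X Y) = X"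
  and tgt_zr [simp]: "X \<in> ob C \<Longrightarrow> Y \<in> ob C \<Longrightarrow> tgt (zr X Y) = Y"
  by (simp_all add: zr_def)

lemma arr_un [simp]: "arr (un X) \<longleftrightarrow> X \<in> ob C"
  by (auto simp: un_def idm_mor)

lemma src_un [simp]: "X \<in> ob C \<Longrightarrow> src (un X) = X" and tgt_un [simp]: "X \<in> ob C \<Longrightarrow> tgt (un X) = X"
  by (simp_all add: un_def)

lemma not_arr_comp: "\<not> (arr b \<and> arr a \<and> tgt a = src b) \<Longrightarrow> b \<star> a = None"
  by (simp only: comp_def if_False)

lemma not_arr_plus: "\<not> (arr a \<and> arr b \<and> src a = src b \<and> tgt a = tgt b) \<Longrightarrow> a \<boxplus> b = None"
  by (simp only: plus_def if_False)

lemma comp_assoc: "(c \<star> b) \<star> a = c \<star> b \<star> a"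
proof (cases "arr a \<and> arr b \<and> arr c \<and> tgt a = src b \<and> tgt b = src c")
  case True
  then show ?thesis by (auto simp: comp_def cmp_assoc cmp_mor elim!: arrE)
next
  case False
  then have "\<not> arr ((c \<star> b) \<star> a)" "\<not> arr (c \<star> b \<star> a)" by (auto dest: src_comp tgt_comp)
  then show ?thesis by (metis arr_comp not_arr_comp)
qed

text \<open>Composites are normalised to the right, where a known equation is visible only together
  with a trailing factor; this form lets it be used there.\<close>

lemma comp_eq_assoc: "b \<star> a = d \<Longrightarrow> b \<star> a \<star> x = d \<star> x"
  by (simp add: comp_assoc[symmetric])

lemma comp_eq_assoc3: "c \<star> b \<star> a = d \<Longrightarrow> c \<star> b \<star> a \<star> x = d \<star> x"
  by (simp add: comp_assoc[symmetric])

lemma comp_plus: "c \<star> (a \<boxplus> b) = c \<star> a \<boxplus> c \<star> b"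
proof (cases "arr a \<and> arr b \<and> arr c \<and> src a = src b \<and> tgt a = tgt b \<and> tgt b = src c")
  case True
  then show ?thesis by (auto simp: comp_def plus_def cmp_add_right mor_add cmp_mor elim!: arrE)
next
  case False
  then have "\<not> arr (c \<star> (a \<boxplus> b))" "\<not> arr (c \<star> a \<boxplus> c \<star> b)" by auto
  then show ?thesis by (metis arr_comp not_arr_comp not_arr_plus arr_plus)
qed

lemma plus_comp: "(a \<boxplus> b) \<star> c = a \<star> c \<boxplus> b \<star> c"
proof (cases "arr a \<and> arr b \<and> arr c \<and> src a = src b \<and> tgt a = tgt b \<and> tgt c = src a")
  case True
  then show ?thesis by (auto simp: comp_def plus_def cmp_add_left mor_add cmp_mor elim!: arrE)
next
  case False
  then have "\<not> arr ((a \<boxplus> b) \<star> c)" "\<not> arr (a \<star> c \<boxplus> b \<star> c)" by auto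
  then show ?thesis by (metis arr_comp not_arr_comp not_arr_plus arr_plus)
qed

lemma neg_None [simp]: "neg None = None"
  by (simp add: neg_def)

lemma comp_neg: "c \<star> (neg a) = neg (c \<star> a)"
proof (cases "arr a \<and> arr c \<and> tgt a = src c")
  case True
  then show ?thesis by (auto simp: comp_def neg_def cmp_neg_right mor_neg cmp_mor elim!: arrE)
next
  case False
  then show ?thesis by (metis arr_neg neg_None not_arr_comp tgt_neg)
qed

lemma neg_comp: "(neg c) \<star> a = neg (c \<star> a)"
proof (cases "arr a \<and> arr c \<and> tgt a = src c")
  case True
  then show ?thesis by (auto simp: comp_def neg_def cmp_neg_left mor_neg cmp_mor elim!: arrE)
next
  case False
  then show ?thesis by (metis arr_neg neg_None not_arr_comp src_neg)
qed

lemma plus_commute: "a \<boxplus> b = b \<boxplus> a"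
proof (cases "arr a \<and> arr b \<and> src a = src b \<and> tgt a = tgt b")
  case True
  then interpret A: abelian_group "Hom C (src b) (tgt b)" using Hom_group src_ob tgt_ob by blast
  show ?thesis using True arr_mor[of a] arr_mor[of b] by (simp add: plus_def A.a_comm)
next
  case False
  then show ?thesis by (metis not_arr_plus)
qed

lemma plus_assoc: "(a \<boxplus> b) \<boxplus> c = a \<boxplus> (b \<boxplus> c)"
proof (cases "arr a \<and> arr b \<and> arr c \<and> src a = src b \<and> tgt a = tgt b \<and> src b = src c \<and> tgt b = tgt c")
  case True
  then interpret A: abelian_group "Hom C (src c) (tgt c)" using Hom_group src_ob tgt_ob by blast
  show ?thesis using True arr_mor[of a] arr_mor[of b] arr_mor[of c] src_ob[of c] tgt_ob[of c]
    by (simp add: plus_def A.a_assoc)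
next
  case False
  then have "\<not> arr ((a \<boxplus> b) \<boxplus> c)" "\<not> arr (a \<boxplus> (b \<boxplus> c))" by auto
  then show ?thesis by (metis arr_plus not_arr_plus)
qed

lemma plus_left_commute: "a \<boxplus> (b \<boxplus> c) = b \<boxplus> (a \<boxplus> c)"
  by (metis plus_assoc plus_commute)

lemmas plus_ac = plus_assoc plus_commute plus_left_commute

lemma plus_zr [simp]: "arr a \<Longrightarrow> src a = X \<Longrightarrow> tgt a = Y \<Longrightarrow> a \<boxplus> zr X Y = a"
proof -
  assume a: "arr a" "src a = X" "tgt a = Y"
  then interpret A: abelian_group "Hom C X Y" using Hom_group src_ob tgt_ob by blast
  show ?thesis using a arr_mor[of a] arr_eta[of a] src_ob[of a] tgt_ob[of a] by (simp add: plus_def zr_def)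
qed

lemma zr_plus [simp]: "arr a \<Longrightarrow> src a = X \<Longrightarrow> tgt a = Y \<Longrightarrow> zr X Y \<boxplus> a = a"
  by (simp add: plus_commute)

lemma plus_neg: "arr a \<Longrightarrow> src a = X \<Longrightarrow> tgt a = Y \<Longrightarrow> a \<boxplus> neg a = zr X Y"
proof -
  assume a: "arr a" "src a = X" "tgt a = Y"
  then interpret A: abelian_group "Hom C X Y" using Hom_group src_ob tgt_ob by blast
  show ?thesis using a arr_mor[of a] src_ob[of a] tgt_ob[of a] by (simp add: plus_def zr_def neg_def A.r_neg)
qed

lemma neg_neg [simp]: "arr a \<Longrightarrow> neg (neg a) = a"
proof -
  assume a: "arr a"
  then interpret A: abelian_group "Hom C (src a) (tgt a)" using Hom_group src_ob tgt_ob by blast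
  show ?thesis using a arr_mor[of a] arr_eta[of a] src_ob[of a] tgt_ob[of a] by (simp add: neg_def)
qed

lemma neg_zr [simp]: "neg (zr X Y) = zr X Y"
proof (cases "X \<in> ob C \<and> Y \<in> ob C")
  case True
  then interpret A: abelian_group "Hom C X Y" using Hom_group by blast
  show ?thesis using True by (simp add: neg_def zr_def)
next
  case False
  then have "zr X Y = None" unfolding zr_def by auto
  then show ?thesis by simp
qed

lemma zr_comp [simp]: "arr a \<Longrightarrow> tgt a = Y \<Longrightarrow> zr Y Z \<star> a = zr (src a) Z"
  by (auto simp: zr_def comp_def cmp_zero_left mor_zero elim!: arrE)

lemma comp_zr [simp]: "arr a \<Longrightarrow> src a = Y \<Longrightarrow> a \<star> zr X Y = zr X (tgt a)"
  by (auto simp: zr_def comp_def cmp_zero_right mor_zero elim!: arrE)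

lemma un_comp [simp]: "arr a \<Longrightarrow> tgt a = Y \<Longrightarrow> un Y \<star> a = a"
  by (auto simp: un_def comp_def cmp_idm_left idm_mor elim!: arrE)

lemma comp_un [simp]: "arr a \<Longrightarrow> src a = X \<Longrightarrow> a \<star> un X = a"
  by (auto simp: un_def comp_def cmp_idm_right idm_mor elim!: arrE)

lemma plus_neg2: "arr a \<Longrightarrow> arr b \<Longrightarrow> src a = src b \<Longrightarrow> tgt a = tgt b \<Longrightarrow> a \<boxplus> (neg a \<boxplus> b) = b"
  and neg_plus2: "arr a \<Longrightarrow> arr b \<Longrightarrow> src a = src b \<Longrightarrow> tgt a = tgt b \<Longrightarrow> neg a \<boxplus> (a \<boxplus> b) = b"
  and neg_plus: "arr a \<Longrightarrow> src a = X \<Longrightarrow> tgt a = Y \<Longrightarrow> neg a \<boxplus> a = zr X Y"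
  by (simp_all add: plus_assoc[symmetric] plus_neg plus_commute[of "neg a" a])

lemma plus_cancel: "\<lbrakk>arr a; arr b; arr c; a \<boxplus> b = a \<boxplus> c; src a = src b; src a = src c; tgt a = tgt b; tgt a = tgt c\<rbrakk>
    \<Longrightarrow> b = c"
  by (metis neg_plus2)

lemma neg_distrib: "neg (a \<boxplus> b) = neg a \<boxplus> neg b"
proof (cases "arr a \<and> arr b \<and> src a = src b \<and> tgt a = tgt b")
  case True
  then have "(a \<boxplus> b) \<boxplus> (neg a \<boxplus> neg b) = zr (src b) (tgt b)"
    by (simp add: plus_ac plus_neg plus_neg2)
  also have "\<dots> = (a \<boxplus> b) \<boxplus> neg (a \<boxplus> b)" using True plus_neg[of "a \<boxplus> b"] by simp
  finally have "(a \<boxplus> b) \<boxplus> (neg a \<boxplus> neg b) = (a \<boxplus> b) \<boxplus> neg (a \<boxplus> b)" .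
  from True this show ?thesis
    by (metis arr_neg arr_plus plus_cancel src_neg src_plus tgt_neg tgt_plus)
next
  case False
  then have "a \<boxplus> b = None" by (rule not_arr_plus)
  moreover have "neg a \<boxplus> neg b = None"
  proof (rule not_arr_plus, rule notI)
    assume "arr (neg a) \<and> arr (neg b) \<and> src (neg a) = src (neg b) \<and> tgt (neg a) = tgt (neg b)"
    moreover from this have "arr a" "arr b" by simp_all
    ultimately show False using False by simp
  qed
  ultimately have "a \<boxplus> b = None" "neg a \<boxplus> neg b = None" by simp_all
  then show ?thesis by simp
qed

lemma diff_eq: "\<lbrakk>arr a; arr b; arr c; src a = src b; src c = src b; tgt a = tgt b; tgt c = tgt b; a \<boxplus> neg b = c\<rbrakk>
    \<Longrightarrow> a = b \<boxplus> c"
  by (metis arr_neg plus_commute plus_neg2 src_neg tgt_neg)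

lemmas arrow_algebra = comp_assoc comp_plus plus_comp comp_neg neg_comp neg_distrib plus_ac plus_neg neg_plus
  plus_neg2 neg_plus2

lemma comp_H [intro]: "a \<in> H X Y \<Longrightarrow> b \<in> H Y Z \<Longrightarrow> b \<star> a \<in> H X Z"
  by (simp add: H_iff)

lemma plus_H [intro]: "a \<in> H X Y \<Longrightarrow> b \<in> H X Y \<Longrightarrow> a \<boxplus> b \<in> H X Y"
  by (simp add: H_iff)

lemma neg_H [intro]: "a \<in> H X Y \<Longrightarrow> neg a \<in> H X Y"
  by (simp add: H_iff)

lemma zr_H [intro]: "X \<in> ob C \<Longrightarrow> Y \<in> ob C \<Longrightarrow> zr X Y \<in> H X Y"
  by (simp add: H_iff)

lemma un_H [intro]: "X \<in> ob C \<Longrightarrow> un X \<in> H X X"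
  by (simp add: H_iff)

lemma diff_H: "a \<in> H X Y \<Longrightarrow> b \<in> H X Y \<Longrightarrow> a \<boxplus> neg b = c \<Longrightarrow> a = b \<boxplus> c"
  using diff_eq[of a b c] by (metis H_iff neg_H plus_H)

lemma Some_comp: "\<lbrakk>X \<in> ob C; Y \<in> ob C; Z \<in> ob C; f \<in> mor C X Y; g \<in> mor C Y Z\<rbrakk> \<Longrightarrow>
    Some (Y, g, Z) \<star> Some (X, f, Y) = Some (X, cmp C X Y Z g f, Z)"
  by (simp add: comp_def)

lemma Some_plus: "\<lbrakk>X \<in> ob C; Y \<in> ob C; f \<in> mor C X Y; g \<in> mor C X Y\<rbrakk> \<Longrightarrow>
    Some (X, f, Y) \<boxplus> Some (X, g, Y) = Some (X, f \<oplus>\<^bsub>Hom C X Y\<^esub> g, Y)"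
  by (simp add: plus_def)

lemma Some_neg: "\<lbrakk>X \<in> ob C; Y \<in> ob C; f \<in> mor C X Y\<rbrakk> \<Longrightarrow>
    neg (Some (X, f, Y)) = Some (X, \<ominus>\<^bsub>Hom C X Y\<^esub> f, Y)"
  by (simp add: neg_def)

lemma H_val: "a \<in> H X Y \<Longrightarrow> Some (X, val a, Y) = a"
  by (auto elim: HE)

section \<open>Isomorphisms, retracts and local objects\<close>

definition iso :: "('o, 'm) arrow \<Rightarrow> bool" where
  "iso a \<longleftrightarrow> arr a \<and> (\<exists>b. b \<in> H (tgt a) (src a) \<and> b \<star> a = un (src a) \<and> a \<star> b = un (tgt a))"

lemma isoI: "a \<in> H X Y \<Longrightarrow> b \<in> H Y X \<Longrightarrow> b \<star> a = un X \<Longrightarrow> a \<star> b = un Y \<Longrightarrow> iso a"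
  by (auto simp: iso_def H_iff)

lemma isoE:
  assumes "iso a" "a \<in> H X Y"
  obtains b where "b \<in> H Y X" "b \<star> a = un X" "a \<star> b = un Y"
  using assms by (auto simp: iso_def H_iff)

lemma iso_mor_iff: "X \<in> ob C \<Longrightarrow> Y \<in> ob C \<Longrightarrow> iso_mor C X Y f \<longleftrightarrow> f \<in> mor C X Y \<and> iso (Some (X, f, Y))"
proof
  assume o: "X \<in> ob C" "Y \<in> ob C" and "iso_mor C X Y f"
  then obtain g where "f \<in> mor C X Y" "g \<in> mor C Y X" "cmp C X Y X g f = idm C X" "cmp C Y X Y f g = idm C Y"
    by (auto simp: iso_mor_def)
  then show "f \<in> mor C X Y \<and> iso (Some (X, f, Y))"
    using o isoI[of "Some (X, f, Y)" X Y "Some (Y, g, X)"] by (simp add: Some_comp un_def)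
next
  assume o: "X \<in> ob C" "Y \<in> ob C" and f: "f \<in> mor C X Y \<and> iso (Some (X, f, Y))"
  then obtain b where b: "b \<in> H Y X" "b \<star> Some (X, f, Y) = un X" "Some (X, f, Y) \<star> b = un Y"
    by (auto elim: isoE)
  then obtain g where "b = Some (Y, g, X)" "g \<in> mor C Y X" by (auto elim: HE)
  then show "iso_mor C X Y f" using b f o by (auto simp: iso_mor_def Some_comp un_def)
qed

lemma iso_un: "X \<in> ob C \<Longrightarrow> iso (un X)"
  by (rule isoI[of _ X X "un X"]) (auto simp: H_iff)

lemma iso_comp:
  assumes "iso a" "iso b" "a \<in> H X Y" "b \<in> H Y Z"
  shows "iso (b \<star> a)"
proof -
  obtain a' where a': "a' \<in> H Y X" "a' \<star> a = un X" "a \<star> a' = un Y" using assms isoE by metis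
  obtain b' where b': "b' \<in> H Z Y" "b' \<star> b = un Y" "b \<star> b' = un Z" using assms isoE by metis
  show ?thesis
    by (rule isoI[of _ X Z "a' \<star> b'"])
      (use assms a' b' in \<open>auto simp: H_iff arrow_algebra a'(2,3)[THEN comp_eq_assoc] b'(2,3)[THEN comp_eq_assoc]\<close>)
qed

lemma iso_neg: "iso a \<Longrightarrow> iso (neg a)"
proof -
  assume a: "iso a"
  then have aH: "a \<in> H (src a) (tgt a)" by (auto simp: iso_def H_iff)
  with a obtain b where b: "b \<in> H (tgt a) (src a)" "b \<star> a = un (src a)" "a \<star> b = un (tgt a)"
    by (auto elim: isoE)
  show ?thesis
    by (rule isoI[of _ "src a" "tgt a" "neg b"]) (use aH b in \<open>auto simp: H_iff arrow_algebra src_ob tgt_ob\<close>)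
qed

lemma iso_neg_iff: "arr a \<Longrightarrow> iso (neg a) \<longleftrightarrow> iso a"
  using iso_neg[of a] iso_neg[of "neg a"] by auto

definition zob :: "'o \<Rightarrow> bool" where
  "zob X \<longleftrightarrow> X \<in> ob C \<and> un X = zr X X"

lemma is_zero_ob_iff: "is_zero_ob C X \<longleftrightarrow> zob X"
  by (auto simp: is_zero_ob_def zob_def un_def zr_def)

lemma zob_H: "zob X \<Longrightarrow> a \<in> H X Y \<Longrightarrow> a = zr X Y"
proof -
  assume z: "zob X" and a: "a \<in> H X Y"
  have "a = a \<star> un X" using a by (simp add: H_iff)
  also have "\<dots> = zr X Y" using a z by (simp add: zob_def H_iff)
  finally show ?thesis .
qed

text \<open>Retracts stand in for direct summands: the relation is transitive and needs no
  complement, which is available only under \<open>split_complement\<close>.\<close>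

definition retr :: "'o \<Rightarrow> 'o \<Rightarrow> bool" where
  "retr S X \<longleftrightarrow> S \<in> ob C \<and> X \<in> ob C \<and> (\<exists>a\<in>H S X. \<exists>b\<in>H X S. b \<star> a = un S)"

lemma retr_iso: "a \<in> H S X \<Longrightarrow> b \<in> H X S \<Longrightarrow> iso (b \<star> a) \<Longrightarrow> retr S X"
proof -
  assume a: "a \<in> H S X" "b \<in> H X S" "iso (b \<star> a)"
  then obtain c where c: "c \<in> H S S" "c \<star> b \<star> a = un S" by (metis comp_H isoE comp_assoc)
  then show ?thesis unfolding retr_def using a H_ob
    by (metis comp_H comp_assoc)
qed

lemma retr_refl: "X \<in> ob C \<Longrightarrow> retr X X"
  unfolding retr_def by (auto intro!: bexI[of _ "un X"] simp: H_iff)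

lemma retr_trans: "retr R S \<Longrightarrow> retr S X \<Longrightarrow> retr R X"
proof -
  assume "retr R S" "retr S X"
  then obtain a b c d where a: "a \<in> H R S" "b \<in> H S R" "b \<star> a = un R"
    "c \<in> H S X" "d \<in> H X S" "d \<star> c = un S" "R \<in> ob C" "X \<in> ob C" by (auto simp: retr_def)
  then have "(b \<star> d) \<star> c \<star> a = un R" by (simp add: comp_assoc a(6)[THEN comp_eq_assoc] H_iff)
  then show ?thesis unfolding retr_def using a by blast
qed

definition isom :: "'o \<Rightarrow> 'o \<Rightarrow> bool" where
  "isom X Y \<longleftrightarrow> (\<exists>a\<in>H X Y. iso a)"

lemma isomorphic_iff: "X \<in> ob C \<Longrightarrow> Y \<in> ob C \<Longrightarrow> isomorphic C X Y \<longleftrightarrow> isom X Y"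
  unfolding isomorphic_def isom_def by (auto simp: iso_mor_iff elim!: HE)

lemma isom_sym: "isom X Y \<Longrightarrow> isom Y X"
  unfolding isom_def by (metis isoE isoI)

lemma isom_trans: "isom X Y \<Longrightarrow> isom Y Z \<Longrightarrow> isom X Z"
  unfolding isom_def using iso_comp by blast

lemma isom_refl: "X \<in> ob C \<Longrightarrow> isom X X"
  unfolding isom_def using iso_un by blast

lemma isom_ob: "isom X Y \<Longrightarrow> X \<in> ob C \<and> Y \<in> ob C"
  unfolding isom_def using H_ob by blast

lemma isom_retr: "isom X Y \<Longrightarrow> retr X Y"
  unfolding isom_def retr_def by (metis isoE H_ob)

text \<open>Locality is put contrapositively: when a sum of endomorphisms is invertible, one of the
  terms is. This is the form in which decompositions of an identity are exploited.\<close>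

definition loc :: "'o \<Rightarrow> bool" where
  "loc X \<longleftrightarrow> X \<in> ob C \<and> un X \<noteq> zr X X \<and>
     (\<forall>f\<in>H X X. \<forall>g\<in>H X X. iso (f \<boxplus> g) \<longrightarrow> iso f \<or> iso g)"

lemma local_end_iff: "X \<in> ob C \<Longrightarrow> local_end C X \<longleftrightarrow> loc X"
proof -
  assume X: "X \<in> ob C"
  have B: "(\<forall>a\<in>H X X. P a) \<longleftrightarrow> (\<forall>f\<in>mor C X X. P (Some (X, f, X)))" for P
    using X by (auto elim!: HE)
  have u: "(un X \<noteq> zr X X) = (idm C X \<noteq> zerom C X X)" using X by (simp add: un_def zr_def)
  show ?thesis unfolding loc_def local_end_def B u using X
    by (simp add: iso_mor_iff Some_plus mor_add) blast
qed

lemma loc_ob: "loc X \<Longrightarrow> X \<in> ob C"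
  by (simp add: loc_def)

lemma loc_plus: "loc X \<Longrightarrow> f \<in> H X X \<Longrightarrow> g \<in> H X X \<Longrightarrow> iso (f \<boxplus> g) \<Longrightarrow> iso f \<or> iso g"
  by (simp add: loc_def)

lemma loc_zr: "loc X \<Longrightarrow> \<not> iso (zr X X)"
proof
  assume "loc X" "iso (zr X X)"
  then obtain b where "b \<in> H X X" "b \<star> zr X X = un X"
    by (metis isoE zr_H loc_ob)
  then show False using \<open>loc X\<close> by (auto simp: loc_def H_iff)
qed

lemma loc_not_zob: "loc X \<Longrightarrow> \<not> zob X"
  by (simp add: loc_def zob_def)

lemma loc_one_plus: "loc X \<Longrightarrow> a \<in> H X X \<Longrightarrow> \<not> iso a \<Longrightarrow> iso (un X \<boxplus> a)"
proof -
  assume X: "loc X" and a: "a \<in> H X X" "\<not> iso a"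
  have "(un X \<boxplus> a) \<boxplus> neg a = un X" using a loc_ob[OF X] by (simp add: H_iff arrow_algebra)
  then have "iso ((un X \<boxplus> a) \<boxplus> neg a)" using iso_un loc_ob[OF X] by simp
  then have "iso (un X \<boxplus> a) \<or> iso (neg a)"
    using loc_plus[OF X, of "un X \<boxplus> a" "neg a"] a loc_ob[OF X] by blast
  then show ?thesis using a iso_neg_iff by (auto simp: H_iff)
qed

lemma idem_iso:
  assumes e: "e \<in> H X X" "e \<star> e = e" "iso e" shows "e = un X"
proof -
  obtain b where b: "b \<in> H X X" "b \<star> e = un X" using e isoE by metis
  have "e = (b \<star> e) \<star> e" using e(1) by (simp add: b(2) H_iff)
  also have "\<dots> = b \<star> e" by (simp only: comp_assoc e(2))
  finally show ?thesis using b by simp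
qed

text \<open>With \<open>c\<close> inverse to \<open>b a\<close>, the endomorphism
  \<open>e = a c b\<close> of \<open>Y\<close> is idempotent and fixes \<open>a\<close>. Since
  \<open>Y\<close> is local, \<open>e\<close> or \<open>1 - e\<close> is invertible, and an
  invertible idempotent is the identity. In the second case \<open>e = 0\<close>, so
  \<open>a = e a = 0\<close>, which is impossible as \<open>X\<close> is nonzero.\<close>

lemma loc_retract_iso:
  assumes X: "loc X" and Y: "loc Y" and a: "a \<in> H X Y" and b: "b \<in> H Y X" and i: "iso (b \<star> a)"
  shows "iso a"
proof -
  obtain c where c: "c \<in> H X X" "c \<star> b \<star> a = un X"
    using isoE[OF i] a b by (metis comp_H comp_assoc)
  define e where "e = a \<star> c \<star> b"
  have e: "e \<in> H Y Y" "e \<star> e = e" "e \<star> a = a"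
    unfolding e_def using a b c by (auto simp: H_iff arrow_algebra c(2)[THEN comp_eq_assoc3])
  have "e \<boxplus> (un Y \<boxplus> neg e) = un Y" using e(1) loc_ob[OF Y] by (simp add: H_iff arrow_algebra)
  then have "iso e \<or> iso (un Y \<boxplus> neg e)"
    using loc_plus[OF Y e(1), of "un Y \<boxplus> neg e"] iso_un[OF loc_ob[OF Y]] e(1) loc_ob[OF Y]
    by (metis neg_H plus_H un_H)
  then show ?thesis
  proof
    assume "iso e"
    then have "e = un Y" using e idem_iso by blast
    then show ?thesis using isoI[OF a, of "c \<star> b"] a b c by (auto simp: e_def H_iff comp_assoc)
  next
    assume d: "iso (un Y \<boxplus> neg e)"
    have "un Y \<boxplus> neg e = un Y"
    proof (rule idem_iso[OF _ _ d])
      show "un Y \<boxplus> neg e \<in> H Y Y" using e(1) loc_ob[OF Y] by blast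
      show "(un Y \<boxplus> neg e) \<star> (un Y \<boxplus> neg e) = un Y \<boxplus> neg e"
        using e(1) loc_ob[OF Y] by (simp add: H_iff arrow_algebra e(2))
    qed
    then have "(un Y \<boxplus> neg e) \<star> a = un Y \<star> a" by simp
    then have "a \<boxplus> neg a = a" using e a by (simp add: H_iff plus_comp neg_comp)
    then have "a = zr X Y" using a by (simp add: H_iff plus_neg)
    then have "un X = zr X X" using b c a by (simp add: H_iff)
    then show ?thesis using X by (simp add: loc_def)
  qed
qed

lemma loc_retr_isom: "loc X \<Longrightarrow> loc Y \<Longrightarrow> retr X Y \<Longrightarrow> isom X Y"
  unfolding retr_def isom_def using loc_retract_iso iso_un by metis

lemma loc_isom:
  assumes X: "loc X" and i: "isom X Y" shows "loc Y"
proof -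
  obtain a b where ab: "a \<in> H X Y" "b \<in> H Y X" "b \<star> a = un X" "a \<star> b = un Y"
    using i by (auto simp: isom_def elim: isoE)
  have ob: "X \<in> ob C" "Y \<in> ob C" using H_ob[OF ab(1)] by auto
  have isos: "iso a" "iso b" using ab isoI by blast+
  have T: "iso (b \<star> f \<star> a) \<Longrightarrow> iso f" if f: "f \<in> H Y Y" for f
  proof -
    assume "iso (b \<star> f \<star> a)"
    moreover have m: "b \<star> f \<star> a \<in> H X X" using f ab by blast
    ultimately have "iso (a \<star> (b \<star> f \<star> a) \<star> b)" using isos ab iso_comp by (meson comp_H)
    moreover have "a \<star> (b \<star> f \<star> a) \<star> b = f"
      using f ab by (simp add: H_iff comp_assoc ab(4) ab(4)[THEN comp_eq_assoc])
    ultimately show ?thesis by simp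
  qed
  have nz: "un Y \<noteq> zr Y Y"
  proof
    assume "un Y = zr Y Y"
    then have "b \<star> un Y \<star> a = zr X X" using ab ob by (simp add: H_iff)
    then show False using X ab by (simp add: loc_def H_iff)
  qed
  show ?thesis unfolding loc_def
  proof (intro conjI ballI impI ob nz)
    fix f g assume fg: "f \<in> H Y Y" "g \<in> H Y Y" and s: "iso (f \<boxplus> g)"
    have "iso (b \<star> (f \<boxplus> g) \<star> a)" using s fg ab isos iso_comp by (meson comp_H plus_H)
    then have "iso (b \<star> f \<star> a \<boxplus> b \<star> g \<star> a)" by (simp add: comp_plus plus_comp)
    then have "iso (b \<star> f \<star> a) \<or> iso (b \<star> g \<star> a)"
      using loc_plus[OF X] fg ab by (meson comp_H)
    then show "iso f \<or> iso g" using T fg by blast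
  qed
qed

section \<open>Maps factoring through a class of objects\<close>

text \<open>Finite sums of maps through single objects replace maps through one direct sum, so no
  matrices are needed. The number of terms is kept because the construction of minimal
  approximations terminates by lowering it.\<close>

inductive thru_n :: "'o set \<Rightarrow> 'o \<Rightarrow> 'o \<Rightarrow> nat \<Rightarrow> ('o, 'm) arrow \<Rightarrow> bool"
  for \<U> X Y where
  zero: "X \<in> ob C \<Longrightarrow> Y \<in> ob C \<Longrightarrow> thru_n \<U> X Y 0 (zr X Y)"
| step: "thru_n \<U> X Y n f \<Longrightarrow> S \<in> \<U> \<Longrightarrow> a \<in> H X S \<Longrightarrow> b \<in> H S Y \<Longrightarrow> thru_n \<U> X Y (Suc n) (b \<star> a \<boxplus> f)"

definition thru :: "'o set \<Rightarrow> 'o \<Rightarrow> 'o \<Rightarrow> ('o, 'm) arrow set" where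
  "thru \<U> X Y = {f. \<exists>n. thru_n \<U> X Y n f}"

lemma thru_n_H: "thru_n \<U> X Y n f \<Longrightarrow> f \<in> H X Y"
  by (induction rule: thru_n.induct) auto

lemma thru_H: "f \<in> thru \<U> X Y \<Longrightarrow> f \<in> H X Y"
  using thru_n_H by (auto simp: thru_def)

lemma thru_zr: "X \<in> ob C \<Longrightarrow> Y \<in> ob C \<Longrightarrow> zr X Y \<in> thru \<U> X Y"
  by (auto simp: thru_def intro: thru_n.zero)

lemma thru_step: "f \<in> thru \<U> X Y \<Longrightarrow> S \<in> \<U> \<Longrightarrow> a \<in> H X S \<Longrightarrow> b \<in> H S Y \<Longrightarrow> b \<star> a \<boxplus> f \<in> thru \<U> X Y"
  by (auto simp: thru_def intro: thru_n.step)

lemma thru_induct [consumes 1, case_names zero step]: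
  assumes "f \<in> thru \<U> X Y"
    and "X \<in> ob C \<Longrightarrow> Y \<in> ob C \<Longrightarrow> P (zr X Y)"
    and "\<And>f S a b. f \<in> thru \<U> X Y \<Longrightarrow> P f \<Longrightarrow> S \<in> \<U> \<Longrightarrow> a \<in> H X S \<Longrightarrow> b \<in> H S Y \<Longrightarrow> P (b \<star> a \<boxplus> f)"
  shows "P f"
proof -
  obtain n where "thru_n \<U> X Y n f" using assms(1) by (auto simp: thru_def)
  then show ?thesis
  proof (induction rule: thru_n.induct)
    case zero
    then show ?case by (rule assms(2))
  next
    case (step n f S a b)
    then show ?case by (intro assms(3)) (auto simp: thru_def)
  qed
qed

lemma thru_n_comp_left: "thru_n \<U> X Y n f \<Longrightarrow> c \<in> H Y Z \<Longrightarrow> thru_n \<U> X Z n (c \<star> f)"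
proof (induction rule: thru_n.induct)
  case zero
  then show ?case using thru_n.zero[of X Z] H_ob[of c Y Z] by (simp add: H_iff)
next
  case (step n f S a b)
  then have "thru_n \<U> X Z (Suc n) ((c \<star> b) \<star> a \<boxplus> c \<star> f)" by (blast intro: thru_n.step)
  then show ?case by (simp add: arrow_algebra)
qed

lemma thru_n_comp_right: "thru_n \<U> X Y n f \<Longrightarrow> c \<in> H W X \<Longrightarrow> thru_n \<U> W Y n (f \<star> c)"
proof (induction rule: thru_n.induct)
  case zero
  then show ?case using thru_n.zero[of W Y] H_ob[of c W X] by (simp add: H_iff)
next
  case (step n f S a b)
  then have "thru_n \<U> W Y (Suc n) (b \<star> (a \<star> c) \<boxplus> f \<star> c)" by (blast intro: thru_n.step)
  then show ?case by (simp add: arrow_algebra)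
qed

lemma thru_comp_left: "f \<in> thru \<U> X Y \<Longrightarrow> c \<in> H Y Z \<Longrightarrow> c \<star> f \<in> thru \<U> X Z"
  and thru_comp_right: "f \<in> thru \<U> X Y \<Longrightarrow> c \<in> H W X \<Longrightarrow> f \<star> c \<in> thru \<U> W Y"
  unfolding thru_def using thru_n_comp_left thru_n_comp_right by blast+

lemma thru_plus: "f \<in> thru \<U> X Y \<Longrightarrow> g \<in> thru \<U> X Y \<Longrightarrow> f \<boxplus> g \<in> thru \<U> X Y"
proof (induction rule: thru_induct)
  case zero
  then show ?case using thru_H[of g] by (simp add: H_iff)
next
  case (step f S a b)
  then show ?case by (simp add: plus_assoc thru_step)
qed

lemma thru_one: "S \<in> \<U> \<Longrightarrow> a \<in> H X S \<Longrightarrow> b \<in> H S Y \<Longrightarrow> b \<star> a \<in> thru \<U> X Y"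
  using thru_step[OF thru_zr, of X Y S \<U> a b] H_ob by (auto simp: H_iff)

lemma thru_trans:
  assumes f: "f \<in> thru \<U> X Y" and s: "\<And>S. S \<in> \<U> \<Longrightarrow> S \<in> ob C \<Longrightarrow> un S \<in> thru \<V> S S"
  shows "f \<in> thru \<V> X Y"
  using f
proof (induction rule: thru_induct)
  case zero
  then show ?case by (simp add: thru_zr)
next
  case (step f S a b)
  then have "b \<star> (un S \<star> a) \<in> thru \<V> X Y"
    using s H_ob by (meson thru_comp_left thru_comp_right)
  then show ?case using step by (simp add: H_iff thru_plus)
qed

lemma thru_mono: "f \<in> thru \<U> X Y \<Longrightarrow> \<U> \<subseteq> \<V> \<Longrightarrow> f \<in> thru \<V> X Y"
  by (induction rule: thru_induct) (auto intro: thru_zr thru_step)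

lemma retr_thru: "retr S X \<Longrightarrow> X \<in> \<U> \<Longrightarrow> un S \<in> thru \<U> S S"
  unfolding retr_def by (metis thru_one)

text \<open>Over a local ring one of the terms \<open>b a\<close> of an invertible sum is itself
  invertible, and this makes \<open>X\<close> a retract of the object in the middle.\<close>

lemma loc_thru: "loc X \<Longrightarrow> f \<in> thru \<U> X X \<Longrightarrow> iso f \<Longrightarrow> \<exists>S\<in>\<U>. retr X S"
proof (rotate_tac 1, induction rule: thru_induct)
  case zero
  then show ?case using loc_zr by blast
next
  case (step f S a b)
  then have "iso (b \<star> a) \<or> iso f" using loc_plus[of X "b \<star> a" f] thru_H by blast
  then show ?case using step retr_iso by blast
qed

text \<open>This describes add of a class by an ideal containing the identity. It makes sense
  without direct sums or complements; agreement with \<open>add_of\<close> is proved once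
  complements exist.\<close>

definition Add :: "'o set \<Rightarrow> 'o set" where
  "Add \<U> = {X \<in> ob C. un X \<in> thru \<U> X X}"

lemma Add_ob: "X \<in> Add \<U> \<Longrightarrow> X \<in> ob C"
  by (simp add: Add_def)

lemma Add_base: "X \<in> \<U> \<Longrightarrow> X \<in> ob C \<Longrightarrow> X \<in> Add \<U>"
  using retr_thru[OF retr_refl] by (simp add: Add_def)

lemma Add_retr: "retr S X \<Longrightarrow> X \<in> Add \<U> \<Longrightarrow> S \<in> Add \<U>"
proof -
  assume r: "retr S X" and X: "X \<in> Add \<U>"
  then obtain a b where a: "a \<in> H S X" "b \<in> H X S" "b \<star> a = un S" "S \<in> ob C" by (auto simp: retr_def)
  have "b \<star> un X \<star> a \<in> thru \<U> S S"
    using X by (intro thru_comp_left[OF _ a(2)] thru_comp_right[OF _ a(1)]) (simp add: Add_def)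
  then show ?thesis using a by (simp add: Add_def H_iff)
qed

lemma Add_trans: "X \<in> Add \<U> \<Longrightarrow> (\<And>S. S \<in> \<U> \<Longrightarrow> S \<in> ob C \<Longrightarrow> S \<in> Add \<V>) \<Longrightarrow> X \<in> Add \<V>"
  unfolding Add_def using thru_trans by blast

lemma Add_mono: "\<U> \<subseteq> \<V> \<Longrightarrow> X \<in> Add \<U> \<Longrightarrow> X \<in> Add \<V>"
  unfolding Add_def using thru_mono by blast

lemma thru_Add: "f \<in> thru (Add \<U>) X Y \<Longrightarrow> f \<in> thru \<U> X Y"
  using thru_trans unfolding Add_def by blast

lemma thru_via: "V \<in> Add \<U> \<Longrightarrow> a \<in> H X V \<Longrightarrow> b \<in> H V Y \<Longrightarrow> b \<star> a \<in> thru \<U> X Y"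
  using thru_Add thru_one by blast

lemma loc_Add: "loc X \<Longrightarrow> X \<in> Add \<U> \<Longrightarrow> \<exists>S\<in>\<U>. retr X S"
  unfolding Add_def using loc_thru iso_un by blast

lemma Add_via: "a \<in> H X V \<Longrightarrow> b \<in> H V X \<Longrightarrow> V \<in> Add \<U> \<Longrightarrow> loc X \<Longrightarrow> iso (b \<star> a) \<Longrightarrow> X \<in> Add \<U>"
  using Add_retr retr_iso by blast

section \<open>Direct sums\<close>

definition bip :: "'o \<Rightarrow> 'o \<Rightarrow> 'o \<Rightarrow> ('o, 'm) arrow \<Rightarrow> ('o, 'm) arrow \<Rightarrow> ('o, 'm) arrow \<Rightarrow> ('o, 'm) arrow \<Rightarrow> bool" where
  "bip V X Y i p j q \<longleftrightarrow> i \<in> H X V \<and> p \<in> H V X \<and> j \<in> H Y V \<and> q \<in> H V Y \<and>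
     p \<star> i = un X \<and> q \<star> j = un Y \<and> p \<star> j = zr Y X \<and> q \<star> i = zr X Y \<and> i \<star> p \<boxplus> j \<star> q = un V"

lemma bip_sym: "bip V X Y i p j q \<Longrightarrow> bip V Y X j q i p"
  by (auto simp: bip_def plus_commute)

lemma bip_retr: "bip V X Y i p j q \<Longrightarrow> retr X V" "bip V X Y i p j q \<Longrightarrow> retr Y V"
proof -
  assume b: "bip V X Y i p j q"
  then have "X \<in> ob C" "Y \<in> ob C" "V \<in> ob C" using H_ob unfolding bip_def by blast+
  then show "retr X V" "retr Y V" using b unfolding bip_def retr_def by blast+
qed

lemma bip_thru: "bip V X Y i p j q \<Longrightarrow> un V \<in> thru {X, Y} V V"
proof -
  assume b: "bip V X Y i p j q"
  then have "i \<star> p \<boxplus> j \<star> q \<in> thru {X, Y} V V"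
    using thru_one[of X "{X, Y}" p V i V] thru_one[of Y "{X, Y}" q V j V]
    by (intro thru_plus) (auto simp: bip_def)
  then show ?thesis using b by (simp add: bip_def)
qed

lemma bip_Add: "bip V X Y i p j q \<Longrightarrow> X \<in> Add \<U> \<Longrightarrow> Y \<in> Add \<U> \<Longrightarrow> V \<in> Add \<U>"
proof -
  assume b: "bip V X Y i p j q" and XY: "X \<in> Add \<U>" "Y \<in> Add \<U>"
  have "V \<in> ob C" using b H_ob unfolding bip_def by blast
  then have "V \<in> Add {X, Y}" using bip_thru[OF b] by (simp add: Add_def)
  then show ?thesis using Add_trans XY by blast
qed

lemma is_dsumE:
  assumes "is_dsum C Xs S"
  obtains i p where "\<And>j. j < length Xs \<Longrightarrow> i j \<in> mor C (Xs ! j) S \<and> p j \<in> mor C S (Xs ! j)"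
    and "\<And>j l. j < length Xs \<Longrightarrow> l < length Xs \<Longrightarrow> cmp C (Xs ! j) S (Xs ! l) (p l) (i j) =
           (if j = l then idm C (Xs ! j) else zerom C (Xs ! j) (Xs ! l))"
    and "(\<Oplus>\<^bsub>Hom C S S\<^esub>j\<in>{..<length Xs}. cmp C S (Xs ! j) S (i j) (p j)) = idm C S"
  using assms unfolding is_dsum_def
proof (elim conjE exE)
  fix i p
  assume A: "\<forall>j<length Xs. i j \<in> mor C (Xs ! j) S \<and> p j \<in> mor C S (Xs ! j)"
    and B: "\<forall>j<length Xs. \<forall>l<length Xs. cmp C (Xs ! j) S (Xs ! l) (p l) (i j) =
           (if j = l then idm C (Xs ! j) else zerom C (Xs ! j) (Xs ! l))"
    and D: "(\<Oplus>\<^bsub>Hom C S S\<^esub>j\<in>{..<length Xs}. cmp C S (Xs ! j) S (i j) (p j)) = idm C S"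
  show thesis by (rule that[OF A[rule_format] B[rule_format] D])
qed

lemma finsum_thru:
  assumes "finite A" "X \<in> ob C" "Y \<in> ob C"
    and "\<And>j. j \<in> A \<Longrightarrow> F j \<in> mor C X Y" "\<And>j. j \<in> A \<Longrightarrow> Some (X, F j, Y) \<in> thru \<U> X Y"
  shows "Some (X, finsum (Hom C X Y) F A, Y) \<in> thru \<U> X Y"
proof -
  interpret A: abelian_group "Hom C X Y" using assms Hom_group by blast
  from assms(1,4,5) show ?thesis
  proof (induction A rule: finite_induct)
    case empty
    then show ?case using thru_zr[of X Y \<U>] assms by (simp add: zr_def)
  next
    case (insert j A)
    then have F: "F \<in> A \<rightarrow> mor C X Y" "F j \<in> mor C X Y" by auto
    then have "Some (X, finsum (Hom C X Y) F (insert j A), Y) =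
        Some (X, F j, Y) \<boxplus> Some (X, finsum (Hom C X Y) F A, Y)"
      using insert assms by (simp add: Some_plus A.finsum_insert)
    then show ?case using insert thru_plus by force
  qed
qed

lemma is_dsumD:
  assumes "is_dsum C Xs S"
  shows "S \<in> ob C" "set Xs \<subseteq> ob C" "un S \<in> thru (set Xs) S S" "\<And>X. X \<in> set Xs \<Longrightarrow> retr X S"
proof -
  show S: "S \<in> ob C" and Xs: "set Xs \<subseteq> ob C" using assms by (auto simp: is_dsum_def)
  obtain i p where m: "\<And>j. j < length Xs \<Longrightarrow> i j \<in> mor C (Xs ! j) S \<and> p j \<in> mor C S (Xs ! j)"
    and e: "\<And>j l. j < length Xs \<Longrightarrow> l < length Xs \<Longrightarrow> cmp C (Xs ! j) S (Xs ! l) (p l) (i j) =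
           (if j = l then idm C (Xs ! j) else zerom C (Xs ! j) (Xs ! l))"
    and s: "(\<Oplus>\<^bsub>Hom C S S\<^esub>j\<in>{..<length Xs}. cmp C S (Xs ! j) S (i j) (p j)) = idm C S"
    using is_dsumE[OF assms] by blast
  have Xo: "Xs ! j \<in> ob C" if "j < length Xs" for j using that Xs nth_mem by blast
  have "Some (S, cmp C S (Xs ! j) S (i j) (p j), S) \<in> thru (set Xs) S S" if "j < length Xs" for j
    using thru_one[of "Xs ! j" "set Xs" "Some (S, p j, Xs ! j)" S "Some (Xs ! j, i j, S)" S]
      that m Xo S by (simp add: Some_comp)
  then have "Some (S, idm C S, S) \<in> thru (set Xs) S S"
    unfolding s[symmetric] using m Xo S by (intro finsum_thru) (auto intro: cmp_mor)
  then show "un S \<in> thru (set Xs) S S" using S by (simp add: un_def)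
  fix X assume "X \<in> set Xs"
  then obtain j where j: "j < length Xs" "X = Xs ! j" by (auto simp: in_set_conv_nth)
  show "retr X S" unfolding retr_def
  proof (intro conjI bexI)
    show "X \<in> ob C" "S \<in> ob C" using Xo j S by auto
    show "Some (X, i j, S) \<in> H X S" "Some (S, p j, X) \<in> H S X" using m j S Xo by auto
    show "Some (S, p j, X) \<star> Some (X, i j, S) = un X" using m j S Xo e by (simp add: Some_comp un_def)
  qed
qed

lemma dsum_Add_iff: "is_dsum C Xs S \<Longrightarrow> S \<in> Add \<U> \<longleftrightarrow> set Xs \<subseteq> Add \<U>"
proof
  assume d: "is_dsum C Xs S"
  show "S \<in> Add \<U> \<Longrightarrow> set Xs \<subseteq> Add \<U>" using Add_retr is_dsumD[OF d] by blast
  show "set Xs \<subseteq> Add \<U> \<Longrightarrow> S \<in> Add \<U>"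
    using Add_trans[of S "set Xs" \<U>] is_dsumD[OF d] by (auto simp: Add_def)
qed

lemma finsum_comp:
  assumes "finite A" "X \<in> ob C" "Y \<in> ob C" "W \<in> ob C" "Z \<in> ob C" "\<And>j. j \<in> A \<Longrightarrow> F j \<in> mor C X Y"
    "c \<in> mor C Y Z" "d \<in> mor C W X"
  shows "cmp C W X Z (cmp C X Y Z c (finsum (Hom C X Y) F A)) d =
    finsum (Hom C W Z) (\<lambda>j. cmp C W X Z (cmp C X Y Z c (F j)) d) A"
proof -
  interpret A: abelian_group "Hom C X Y" using assms Hom_group by blast
  interpret B: abelian_group "Hom C W Z" using assms Hom_group by blast
  from assms(1,6) show ?thesis
  proof (induction A rule: finite_induct)
    case empty
    then show ?case using assms by (simp add: cmp_zero_right cmp_zero_left)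
  next
    case (insert j A)
    then have F: "F \<in> A \<rightarrow> mor C X Y" "F j \<in> mor C X Y" by auto
    then have "finsum (Hom C X Y) F A \<in> mor C X Y" by simp
    moreover have "(\<lambda>j. cmp C W X Z (cmp C X Y Z c (F j)) d) \<in> A \<rightarrow> mor C W Z"
      using F assms by (auto intro!: cmp_mor)
    ultimately show ?case using insert F assms
      by (simp add: A.finsum_insert B.finsum_insert cmp_add_right cmp_add_left cmp_mor)
  qed
qed

lemma is_dsum_Nil: "is_dsum C [] N \<longleftrightarrow> zob N"
proof -
  have "finsum (Hom C N N) F {} = zerom C N N" if N: "N \<in> ob C" for F :: "nat \<Rightarrow> 'm"
  proof -
    interpret A: abelian_group "Hom C N N" using N Hom_group by blast
    show ?thesis by simp
  qed
  then show ?thesis by (auto simp: is_dsum_def zob_def un_def zr_def)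
qed

lemma is_dsum_Cons:
  assumes b: "bip V X S i p j q" and d: "is_dsum C Xs S"
  shows "is_dsum C (X # Xs) V"
proof -
  obtain i0 p0 j0 q0 where e0: "i = Some (X, i0, V)" "p = Some (V, p0, X)" "j = Some (S, j0, V)"
      "q = Some (V, q0, S)" and m0: "i0 \<in> mor C X V" "p0 \<in> mor C V X" "j0 \<in> mor C S V" "q0 \<in> mor C V S"
    and ob: "X \<in> ob C" "S \<in> ob C" "V \<in> ob C"
    using b by (auto simp: bip_def elim!: HE)
  have eqs: "cmp C X V X p0 i0 = idm C X" "cmp C S V S q0 j0 = idm C S" "cmp C S V X p0 j0 = zerom C S X"
    "cmp C X V S q0 i0 = zerom C X S"
    "cmp C V X V i0 p0 \<oplus>\<^bsub>Hom C V V\<^esub> cmp C V S V j0 q0 = idm C V"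
    using b m0 ob unfolding bip_def e0 by (simp_all add: Some_comp un_def zr_def Some_plus cmp_mor)
  have Xs: "set Xs \<subseteq> ob C" using is_dsumD[OF d] by blast
  obtain i' p' where m: "\<And>j. j < length Xs \<Longrightarrow> i' j \<in> mor C (Xs ! j) S \<and> p' j \<in> mor C S (Xs ! j)"
    and e: "\<And>j l. j < length Xs \<Longrightarrow> l < length Xs \<Longrightarrow> cmp C (Xs ! j) S (Xs ! l) (p' l) (i' j) =
           (if j = l then idm C (Xs ! j) else zerom C (Xs ! j) (Xs ! l))"
    and s: "(\<Oplus>\<^bsub>Hom C S S\<^esub>j\<in>{..<length Xs}. cmp C S (Xs ! j) S (i' j) (p' j)) = idm C S"
    using is_dsumE[OF d] by blast
  have Xo: "Xs ! j \<in> ob C" if "j < length Xs" for j using that Xs nth_mem by blast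
  \<comment> \<open>Index 0 carries the new summand; index \<open>k + 1\<close> carries the old
    structure maps of index \<open>k\<close>, transported along \<open>S\<close>.\<close>
  define I where "I n = (case n of 0 \<Rightarrow> i0 | Suc k \<Rightarrow> cmp C (Xs ! k) S V j0 (i' k))" for n
  define P where "P n = (case n of 0 \<Rightarrow> p0 | Suc k \<Rightarrow> cmp C V S (Xs ! k) (p' k) q0)" for n
  have mm: "I n \<in> mor C ((X # Xs) ! n) V \<and> P n \<in> mor C V ((X # Xs) ! n)" if "n < length (X # Xs)" for n
    using that m m0 ob Xo by (cases n) (auto simp: I_def P_def intro!: cmp_mor)
  have ee: "cmp C ((X # Xs) ! n) V ((X # Xs) ! l) (P l) (I n) =
      (if n = l then idm C ((X # Xs) ! n) else zerom C ((X # Xs) ! n) ((X # Xs) ! l))"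
    if "n < length (X # Xs)" "l < length (X # Xs)" for n l
  proof (cases n)
    case 0
    show ?thesis
    proof (cases l)
      case 0 then show ?thesis using \<open>n = 0\<close> eqs by (simp add: I_def P_def)
    next
      case (Suc k)
      then have k: "k < length Xs" using that by simp
      have "cmp C X V (Xs ! k) (cmp C V S (Xs ! k) (p' k) q0) i0 =
          cmp C X S (Xs ! k) (p' k) (cmp C X V S q0 i0)"
        using m[OF k] m0 ob Xo[OF k] by (simp add: cmp_assoc)
      then show ?thesis using Suc 0 eqs m[OF k] ob Xo[OF k] by (simp add: I_def P_def cmp_zero_right)
    qed
  next
    case (Suc n')
    then have n: "n' < length Xs" using that by simp
    show ?thesis
    proof (cases l)
      case 0
      have "cmp C (Xs ! n') V X p0 (cmp C (Xs ! n') S V j0 (i' n')) =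
          cmp C (Xs ! n') S X (cmp C S V X p0 j0) (i' n')"
        using m[OF n] m0 ob Xo[OF n] by (simp add: cmp_assoc)
      then show ?thesis using Suc 0 eqs m[OF n] ob Xo[OF n] by (simp add: I_def P_def cmp_zero_left)
    next
      case l: (Suc k)
      then have k: "k < length Xs" using that by simp
      have "cmp C (Xs ! n') V (Xs ! k) (cmp C V S (Xs ! k) (p' k) q0) (cmp C (Xs ! n') S V j0 (i' n')) =
          cmp C (Xs ! n') S (Xs ! k) (cmp C S S (Xs ! k) (p' k) (cmp C S V S q0 j0)) (i' n')"
        using m[OF n] m[OF k] m0 ob Xo[OF n] Xo[OF k] by (simp add: cmp_assoc cmp_mor)
      also have "\<dots> = cmp C (Xs ! n') S (Xs ! k) (p' k) (i' n')"
        using m[OF n] m[OF k] ob Xo[OF n] Xo[OF k] by (simp add: eqs cmp_idm_right)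
      finally show ?thesis using Suc l e[OF n k] by (simp add: I_def P_def)
    qed
  qed
  interpret A: abelian_group "Hom C V V" using Hom_group ob by blast
  let ?F = "\<lambda>n. cmp C V ((X # Xs) ! n) V (I n) (P n)"
  have Fm: "?F n \<in> mor C V V" if "n < length (X # Xs)" for n
    using mm[OF that] ob Xo that by (cases n) (auto intro!: cmp_mor)
  have r: "(\<Oplus>\<^bsub>Hom C V V\<^esub>n\<in>{..<length (X # Xs)}. ?F n) =
      ?F 0 \<oplus>\<^bsub>Hom C V V\<^esub> (\<Oplus>\<^bsub>Hom C V V\<^esub>n\<in>Suc ` {..<length Xs}. ?F n)"
    unfolding list.size(4) add_0_right One_nat_def add_Suc_right lessThan_Suc_eq_insert_0
    using Fm Fm[of 0] by (intro A.finsum_insert) auto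
  have "(\<Oplus>\<^bsub>Hom C V V\<^esub>n\<in>Suc ` {..<length Xs}. ?F n) = (\<Oplus>\<^bsub>Hom C V V\<^esub>n\<in>{..<length Xs}. ?F (Suc n))"
    using Fm by (intro A.finsum_reindex) auto
  also have "\<dots> = (\<Oplus>\<^bsub>Hom C V V\<^esub>n\<in>{..<length Xs}.
      cmp C V S V (cmp C S S V j0 (cmp C S (Xs ! n) S (i' n) (p' n))) q0)"
    using m m0 ob Xo by (intro A.finsum_cong') (auto simp: I_def P_def cmp_assoc cmp_mor intro!: cmp_mor)
  also have "\<dots> = cmp C V S V (cmp C S S V j0
      (\<Oplus>\<^bsub>Hom C S S\<^esub>n\<in>{..<length Xs}. cmp C S (Xs ! n) S (i' n) (p' n))) q0"
    using m m0 ob Xo by (intro finsum_comp[symmetric]) (auto intro!: cmp_mor)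
  also have "\<dots> = cmp C V S V j0 q0" unfolding s using m0 ob by (simp add: cmp_idm_right)
  finally have "(\<Oplus>\<^bsub>Hom C V V\<^esub>n\<in>{..<length (X # Xs)}. ?F n) = idm C V"
    unfolding r using eqs by (simp add: I_def P_def)
  then show ?thesis unfolding is_dsum_def using ob Xs mm ee
    by (intro conjI exI[of _ I] exI[of _ P]) auto
qed

lemma is_dsum_single: "Y \<in> ob C \<Longrightarrow> zob N \<Longrightarrow> is_dsum C [Y] Y"
proof (rule is_dsum_Cons)
  assume Y: "Y \<in> ob C" "zob N"
  show "bip Y Y N (un Y) (un Y) (zr N Y) (zr Y N)"
    using Y by (auto simp: bip_def H_iff zob_def)
  show "is_dsum C [] N" using Y by (simp add: is_dsum_Nil)
qed

lemma is_dsum2: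
  assumes "is_dsum C [X, Y] V"
  obtains i p j q where "bip V X Y i p j q"
proof -
  have ob: "V \<in> ob C" "X \<in> ob C" "Y \<in> ob C" using assms by (auto simp: is_dsum_def)
  have l: "length [X, Y] = 2" by simp
  obtain i p where m: "\<And>j. j < 2 \<Longrightarrow> i j \<in> mor C ([X, Y] ! j) V \<and> p j \<in> mor C V ([X, Y] ! j)"
    and e: "\<And>j l. j < 2 \<Longrightarrow> l < 2 \<Longrightarrow> cmp C ([X, Y] ! j) V ([X, Y] ! l) (p l) (i j) =
           (if j = l then idm C ([X, Y] ! j) else zerom C ([X, Y] ! j) ([X, Y] ! l))"
    and s: "(\<Oplus>\<^bsub>Hom C V V\<^esub>j\<in>{..<2}. cmp C V ([X, Y] ! j) V (i j) (p j)) = idm C V"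
    using is_dsumE[OF assms] unfolding l by blast
  have m': "i 0 \<in> mor C X V" "p 0 \<in> mor C V X" "i 1 \<in> mor C Y V" "p 1 \<in> mor C V Y"
    using m[of 0] m[of 1] by auto
  interpret A: abelian_group "Hom C V V" using Hom_group ob by blast
  have "{..<2::nat} = {0, 1}" by auto
  then have s': "cmp C V X V (i 0) (p 0) \<oplus>\<^bsub>Hom C V V\<^esub> cmp C V Y V (i 1) (p 1) = idm C V"
    using s m' ob by (simp add: A.finsum_insert cmp_mor)
  have "bip V X Y (Some (X, i 0, V)) (Some (V, p 0, X)) (Some (Y, i 1, V)) (Some (V, p 1, Y))"
    unfolding bip_def using m' ob e[of 0 0] e[of 1 1] e[of 0 1] e[of 1 0] s'
    by (simp add: Some_comp Some_plus un_def zr_def cmp_mor)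
  then show ?thesis using that by blast
qed

end

context additive_category
begin

lemma zob_ex: "\<exists>N. zob N"
  using dsum_exists[of "[]"] is_dsum_Nil by auto

lemma bip_ex: "X \<in> ob C \<Longrightarrow> Y \<in> ob C \<Longrightarrow> \<exists>V i p j q. bip V X Y i p j q"
  using dsum_exists[of "[X, Y]"] is_dsum2 by (metis empty_set insert_subset list.simps(15) empty_subsetI)

lemma bip_is_dsum: "bip V X Y i p j q \<Longrightarrow> is_dsum C [X, Y] V"
proof -
  assume b: "bip V X Y i p j q"
  then have "Y \<in> ob C" using H_ob unfolding bip_def by blast
  then have "is_dsum C [Y] Y" using is_dsum_single zob_ex by blast
  then show ?thesis using b is_dsum_Cons by blast
qed

text \<open>The objects through which the terms pass are added to a direct sum one at a time,
  starting from a zero object for the empty sum.\<close>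

lemma thru_dsum:
  assumes "f \<in> thru \<U> X Y"
  shows "\<exists>Xs S. set Xs \<subseteq> \<U> \<and> is_dsum C Xs S \<and> (\<exists>a\<in>H X S. \<exists>b\<in>H S Y. f = b \<star> a)"
  using assms
proof (induction rule: thru_induct)
  case zero
  obtain N where N: "zob N" using zob_ex by blast
  then have "N \<in> ob C" by (simp add: zob_def)
  then have "zr X N \<in> H X N" "zr N Y \<in> H N Y" "zr X Y = zr N Y \<star> zr X N" using zero by (auto simp: H_iff)
  then show ?case using N is_dsum_Nil by (intro exI[of _ "[]"] exI[of _ N]) auto
next
  case (step f R c d)
  then obtain Xs S a b where S: "set Xs \<subseteq> \<U>" "is_dsum C Xs S" "a \<in> H X S" "b \<in> H S Y" "f = b \<star> a"
    by blast
  have "R \<in> ob C" "S \<in> ob C" using step S H_ob by blast+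
  then obtain V i p j q where V: "bip V R S i p j q" using bip_ex by blast
  have "(d \<star> p \<boxplus> b \<star> q) \<star> (i \<star> c \<boxplus> j \<star> a) = d \<star> c \<boxplus> b \<star> a"
  proof -
    have e: "p \<star> i = un R" "q \<star> j = un S" "p \<star> j = zr S R" "q \<star> i = zr R S" using V by (auto simp: bip_def)
    show ?thesis using V step S
      by (simp add: bip_def H_iff arrow_algebra e e[THEN comp_eq_assoc])
  qed
  moreover have "i \<star> c \<boxplus> j \<star> a \<in> H X V" "d \<star> p \<boxplus> b \<star> q \<in> H V Y"
    using V step S by (auto simp: bip_def)
  ultimately show ?case using S step is_dsum_Cons[OF V S(2)]
    by (intro exI[of _ "R # Xs"] exI[of _ V] conjI bexI[of _ "i \<star> c \<boxplus> j \<star> a"] bexI[of _ "d \<star> p \<boxplus> b \<star> q"]) simp_all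
qed

end

section \<open>Minimal approximations\<close>

text \<open>The last assumption holds in triangulated categories. It is stated in a self-dual form, so that
  results on right approximations can be transferred to left approximations.\<close>

locale ks_split_category = krull_schmidt_category K C
  for K :: "('k, 'r) ring_scheme" (structure) and C :: "('o, 'k, 'm, 'c) lin_cat_scheme" +
  assumes split_complement: "\<lbrakk>S \<in> ob C; V \<in> ob C; y \<in> mor C S V; x \<in> mor C V S; cmp C S V S x y = idm C S\<rbrakk> \<Longrightarrow>
    \<exists>V'\<in>ob C. \<exists>j\<in>mor C V' V. \<exists>q\<in>mor C V V'. cmp C V' V V' q j = idm C V' \<and>
      cmp C V' V S x j = zerom C V' S \<and> cmp C S V V' q y = zerom C S V' \<and>
      cmp C V S V y x \<oplus>\<^bsub>Hom C V V\<^esub> cmp C V V' V j q = idm C V"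
begin

lemma complement:
  assumes "y \<in> H S V" "x \<in> H V S" "x \<star> y = un S"
  shows "\<exists>V' j q. bip V S V' y x j q"
proof -
  obtain y0 x0 where e: "y = Some (S, y0, V)" "x = Some (V, x0, S)"
    and m: "S \<in> ob C" "V \<in> ob C" "y0 \<in> mor C S V" "x0 \<in> mor C V S"
    using assms by (auto elim!: HE)
  have "cmp C S V S x0 y0 = idm C S" using assms m by (simp add: e Some_comp un_def)
  from split_complement[OF m this] obtain V' j q where V: "V' \<in> ob C" "j \<in> mor C V' V" "q \<in> mor C V V'"
    "cmp C V' V V' q j = idm C V'" "cmp C V' V S x0 j = zerom C V' S" "cmp C S V V' q y0 = zerom C S V'"
    "cmp C V S V y0 x0 \<oplus>\<^bsub>Hom C V V\<^esub> cmp C V V' V j q = idm C V" by blast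
  have "bip V S V' y x (Some (V', j, V)) (Some (V, q, V'))"
    unfolding bip_def using assms V m by (simp add: e Some_comp un_def zr_def Some_plus cmp_mor)
  then show ?thesis by blast
qed

lemma krull_schmidt_thru: "X \<in> ob C \<Longrightarrow> un X \<in> thru {S. loc S \<and> retr S X} X X"
proof -
  assume "X \<in> ob C"
  then obtain Xs where Xs: "is_dsum C Xs X" "\<forall>Y\<in>set Xs. local_end C Y" using krull_schmidt by blast
  then have "set Xs \<subseteq> {S. loc S \<and> retr S X}"
    using is_dsumD[OF Xs(1)] local_end_iff by blast
  then show ?thesis using is_dsumD(3)[OF Xs(1)] thru_mono by blast
qed

text \<open>By Krull-Schmidt the identity of \<open>X\<close> is a sum of maps through local
  retracts of \<open>X\<close>. Most memberships in \<open>Add\<close> below are therefore tested on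
  local objects, where an alternative between two classes can be decided.\<close>

lemma AddI_loc: "X \<in> ob C \<Longrightarrow> (\<And>S. loc S \<Longrightarrow> retr S X \<Longrightarrow> S \<in> Add \<U>) \<Longrightarrow> X \<in> Add \<U>"
  using Add_trans[of X "{S. loc S \<and> retr S X}" \<U>] krull_schmidt_thru[of X] by (auto simp: Add_def)

lemma loc_indecomposable: "loc X \<Longrightarrow> indecomposable C X"
  unfolding indecomposable_def is_zero_ob_iff
proof (intro conjI allI impI)
  assume X: "loc X"
  then show "X \<in> ob C" "\<not> zob X" by (auto simp: loc_ob loc_not_zob)
  fix Y Z assume "is_dsum C [Y, Z] X"
  then obtain i p j q where b: "bip X Y Z i p j q" using is_dsum2 by blast
  \<comment> \<open>An invertible idempotent \<open>i p\<close> is the identity; then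
    \<open>j = i p j = 0\<close>, and the other summand vanishes.\<close>
  have z: "zob Z" if b: "bip X Y Z i p j q" and "iso (i \<star> p)" for Y Z i p j q
  proof -
    have m: "i \<in> H Y X" "p \<in> H X Y" "j \<in> H Z X" "q \<in> H X Z" "p \<star> i = un Y" "q \<star> j = un Z"
      "p \<star> j = zr Z Y" using b by (auto simp: bip_def)
    have "i \<star> p = un X"
      using m that(2) by (intro idem_iso[of _ X]) (auto simp: comp_assoc m(5)[THEN comp_eq_assoc] H_iff)
    then have "(i \<star> p) \<star> j = j" using m by (simp add: H_iff)
    moreover have "(i \<star> p) \<star> j = zr Z X" using m by (simp add: H_iff comp_assoc)
    ultimately have "j = zr Z X" by simp
    then have "q \<star> j = zr Z Z" using m by (simp add: H_iff)
    then show ?thesis using m H_ob[OF m(3)] by (simp add: zob_def)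
  qed
  have "iso (i \<star> p \<boxplus> j \<star> q)" "i \<star> p \<in> H X X" "j \<star> q \<in> H X X"
    using b iso_un loc_ob[OF X] by (auto simp: bip_def)
  then have "iso (i \<star> p) \<or> iso (j \<star> q)" using loc_plus[OF X] by blast
  then show "zob Y \<or> zob Z" using z[OF b] z[OF bip_sym[OF b]] by blast
qed

text \<open>A nonzero object has a local retract \<open>S\<close>, since otherwise its identity
  would be an empty sum. If the object is indecomposable, the complement of \<open>S\<close> is
  zero, so the object is isomorphic to \<open>S\<close>.\<close>

lemma indecomposable_iff: "indecomposable C X \<longleftrightarrow> loc X"
proof
  assume i: "indecomposable C X"
  then have X: "X \<in> ob C" "\<not> zob X" by (auto simp: indecomposable_def is_zero_ob_iff)
  have "\<exists>S. loc S \<and> retr S X"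
  proof (rule ccontr)
    assume "\<not> (\<exists>S. loc S \<and> retr S X)"
    then have e: "{S. loc S \<and> retr S X} = {}" by blast
    have "un X \<in> thru {} X X" using krull_schmidt_thru[OF X(1)] by (simp only: e)
    then have "un X = zr X X" by (induction rule: thru_induct) auto
    then show False using X by (simp add: zob_def)
  qed
  then obtain S a b where S: "loc S" "a \<in> H S X" "b \<in> H X S" "b \<star> a = un S" by (auto simp: retr_def)
  then obtain V j q where V: "bip X S V a b j q" using complement by blast
  then have "zob S \<or> zob V" using i bip_is_dsum unfolding indecomposable_def is_zero_ob_iff by blast
  then have "zob V" using S loc_not_zob by blast
  then have "j = zr V X" using V zob_H by (auto simp: bip_def)
  then have "j \<star> q = zr X X" using V by (simp add: bip_def H_iff)
  then have "a \<star> b \<boxplus> zr X X = un X" using V by (simp add: bip_def)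
  then have "a \<star> b = un X" using S(2,3) by (simp add: H_iff)
  then have "isom S X" using S isoI unfolding isom_def by blast
  then show "loc X" using S loc_isom by blast
qed (rule loc_indecomposable)

lemma add_of_eq: "\<U> \<subseteq> ob C \<Longrightarrow> add_of C \<U> = Add \<U>"
proof
  assume U: "\<U> \<subseteq> ob C"
  show "add_of C \<U> \<subseteq> Add \<U>"
  proof
    fix X assume "X \<in> add_of C \<U>"
    then obtain Xs Y S where S: "set Xs \<subseteq> \<U>" "is_dsum C Xs S" "is_dsum C [X, Y] S" by (auto simp: add_of_def)
    have "set Xs \<subseteq> Add \<U>" using S(1) U Add_base by blast
    then have "S \<in> Add \<U>" using dsum_Add_iff[OF S(2)] by blast
    then show "X \<in> Add \<U>" using dsum_Add_iff[OF S(3)] by simp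
  qed
  show "Add \<U> \<subseteq> add_of C \<U>"
  proof
    fix X assume "X \<in> Add \<U>"
    then obtain Xs S a b where S: "set Xs \<subseteq> \<U>" "is_dsum C Xs S" "a \<in> H X S" "b \<in> H S X" "un X = b \<star> a"
      using thru_dsum unfolding Add_def by blast
    then obtain Y j q where "bip S X Y a b j q" using complement[of a X S b] by auto
    then show "X \<in> add_of C \<U>" using S bip_is_dsum unfolding add_of_def by blast
  qed
qed

lemma ind_summands_eq: "T \<in> ob C \<Longrightarrow> ind_summands C T = {X. loc X \<and> X \<in> Add {T}}"
proof
  assume T: "T \<in> ob C"
  show "ind_summands C T \<subseteq> {X. loc X \<and> X \<in> Add {T}}"
  proof
    fix X assume "X \<in> ind_summands C T"
    then obtain Y where Y: "loc X" "is_dsum C [X, Y] T" by (auto simp: ind_summands_def indecomposable_iff)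
    then show "X \<in> {X. loc X \<and> X \<in> Add {T}}" using dsum_Add_iff[OF Y(2), of "{T}"] Add_base[of T "{T}"] T by simp
  qed
  show "{X. loc X \<and> X \<in> Add {T}} \<subseteq> ind_summands C T"
  proof clarify
    fix X assume X: "loc X" "X \<in> Add {T}"
    then have "retr X T" using loc_Add by blast
    then obtain a b where ab: "a \<in> H X T" "b \<in> H T X" "b \<star> a = un X" unfolding retr_def by blast
    then obtain Y j q where "bip T X Y a b j q" using complement by blast
    then show "X \<in> ind_summands C T" using X bip_is_dsum unfolding ind_summands_def indecomposable_iff by blast
  qed
qed

text \<open>If \<open>1 - \<phi>\<close> lies in the radical, then \<open>\<phi>\<close> is invertible. Modulo the right ideal \<open>\<phi> End V\<close>, each summand
  \<open>b a\<close> of the identity can be eliminated as in the proof of Nakayama's lemma.\<close>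

lemma radical_right_inverse:
  assumes V: "V \<in> ob C" and \<phi>: "\<phi> \<in> H V V"
    and r: "\<forall>S a b. loc S \<longrightarrow> b \<in> H S V \<longrightarrow> a \<in> H V S \<longrightarrow> \<not> iso (a \<star> (un V \<boxplus> neg \<phi>) \<star> b)"
    and f: "f \<in> thru {S. loc S} V V"
  shows "z \<in> H V V \<Longrightarrow> w \<in> H V V \<Longrightarrow> un V = f \<star> z \<boxplus> \<phi> \<star> w \<Longrightarrow> \<exists>w'\<in>H V V. \<phi> \<star> w' = un V"
  using f
proof (induction arbitrary: z w rule: thru_induct)
  case zero
  then have "\<phi> \<star> w = un V" using \<phi> by (simp add: H_iff)
  then show ?case using zero by blast
next
  case (step f S a b)
  define \<rho> where "\<rho> = un V \<boxplus> neg \<phi>"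
  have S: "loc S" "S \<in> ob C" using step loc_ob by blast+
  have \<rho>: "\<rho> \<in> H V V" unfolding \<rho>_def using V \<phi> by blast
  have f: "f \<in> H V V" using step thru_H by blast
  have m: "a \<star> z \<star> \<rho> \<star> b \<in> H S S" "a \<in> H V S" "b \<in> H S V" using step \<rho> by blast+
  have "(a \<star> z) \<in> H V S" using step by blast
  then have "\<not> iso ((a \<star> z) \<star> \<rho> \<star> b)" using r S(1) m(3) by (simp add: \<rho>_def)
  then have "\<not> iso (neg (a \<star> z \<star> \<rho> \<star> b))" using iso_neg_iff m by (simp add: comp_assoc H_iff)
  then have i: "iso (un S \<boxplus> neg (a \<star> z \<star> \<rho> \<star> b))" using loc_one_plus S m by blast
  have "un S \<boxplus> neg (a \<star> z \<star> \<rho> \<star> b) \<in> H S S" using S m by blast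
  then obtain x where x: "x \<in> H S S" "(un S \<boxplus> neg (a \<star> z \<star> \<rho> \<star> b)) \<star> x = un S" using isoE[OF i] by blast
  have "\<rho> \<star> b = un V \<star> \<rho> \<star> b" using \<rho> m(3) by (simp add: H_iff)
  also have "\<dots> = b \<star> a \<star> z \<star> \<rho> \<star> b \<boxplus> (f \<star> z \<star> \<rho> \<star> b \<boxplus> \<phi> \<star> w \<star> \<rho> \<star> b)"
    by (simp add: step.prems(3) plus_comp comp_assoc plus_assoc)
  finally have rb: "\<rho> \<star> b = b \<star> a \<star> z \<star> \<rho> \<star> b \<boxplus> (f \<star> z \<star> \<rho> \<star> b \<boxplus> \<phi> \<star> w \<star> \<rho> \<star> b)" .
  have "b = \<phi> \<star> b \<boxplus> \<rho> \<star> b" using V \<phi> m(3) by (simp add: \<rho>_def H_iff arrow_algebra)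
  also have "\<dots> = b \<star> a \<star> z \<star> \<rho> \<star> b \<boxplus> (f \<star> z \<star> \<rho> \<star> b \<boxplus> (\<phi> \<star> b \<boxplus> \<phi> \<star> w \<star> \<rho> \<star> b))"
    using rb by (simp add: plus_ac)
  finally have b: "b = b \<star> a \<star> z \<star> \<rho> \<star> b \<boxplus> (f \<star> z \<star> \<rho> \<star> b \<boxplus> \<phi> \<star> (b \<boxplus> w \<star> \<rho> \<star> b))"
    by (simp add: comp_plus)
  \<comment> \<open>The coefficient \<open>1 - a z \<rho> b\<close> has the right inverse
    \<open>x\<close>. So the equation can be solved for \<open>b\<close> modulo maps starting with
    \<open>f\<close> or \<open>\<phi>\<close>, and substituting the result removes the term
    \<open>b a\<close> from the expression of the identity.\<close>
  have "b \<star> (un S \<boxplus> neg (a \<star> z \<star> \<rho> \<star> b)) = b \<boxplus> neg (b \<star> a \<star> z \<star> \<rho> \<star> b)"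
    using m by (simp add: comp_plus comp_neg H_iff)
  also have "\<dots> = (b \<star> a \<star> z \<star> \<rho> \<star> b \<boxplus> (f \<star> z \<star> \<rho> \<star> b \<boxplus> \<phi> \<star> (b \<boxplus> w \<star> \<rho> \<star> b))) \<boxplus> neg (b \<star> a \<star> z \<star> \<rho> \<star> b)"
    using b by simp
  also have "\<dots> = f \<star> z \<star> \<rho> \<star> b \<boxplus> \<phi> \<star> (b \<boxplus> w \<star> \<rho> \<star> b)"
    using m step \<rho> \<phi> f by (simp add: plus_commute[of _ "neg (b \<star> a \<star> z \<star> \<rho> \<star> b)"] neg_plus2 H_iff)
  finally have "b \<star> (un S \<boxplus> neg (a \<star> z \<star> \<rho> \<star> b)) \<star> x = (f \<star> z \<star> \<rho> \<star> b \<boxplus> \<phi> \<star> (b \<boxplus> w \<star> \<rho> \<star> b)) \<star> x"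
    by (simp only: comp_assoc[symmetric])
  then have bx: "b = f \<star> (z \<star> \<rho> \<star> b \<star> x) \<boxplus> \<phi> \<star> ((b \<boxplus> w \<star> \<rho> \<star> b) \<star> x)"
    using m x(2) by (simp add: H_iff plus_comp comp_assoc)
  have "un V = b \<star> (a \<star> z) \<boxplus> f \<star> z \<boxplus> \<phi> \<star> w"
    by (simp add: step.prems(3) plus_comp comp_assoc)
  also have "b \<star> (a \<star> z) = (f \<star> (z \<star> \<rho> \<star> b \<star> x) \<boxplus> \<phi> \<star> ((b \<boxplus> w \<star> \<rho> \<star> b) \<star> x)) \<star> (a \<star> z)"
    using bx by simp
  finally have "un V = f \<star> (z \<star> \<rho> \<star> b \<star> x \<star> a \<star> z \<boxplus> z) \<boxplus> \<phi> \<star> ((b \<boxplus> w \<star> \<rho> \<star> b) \<star> x \<star> a \<star> z \<boxplus> w)"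
    by (simp add: comp_plus plus_comp comp_assoc plus_ac)
  moreover have "z \<star> \<rho> \<star> b \<star> x \<star> a \<star> z \<boxplus> z \<in> H V V" "(b \<boxplus> w \<star> \<rho> \<star> b) \<star> x \<star> a \<star> z \<boxplus> w \<in> H V V"
    using step m \<rho> x by (auto simp: H_iff)
  ultimately show ?case using step.IH by blast
qed

text \<open>The previous lemma gives a right inverse \<open>w\<close>. From
  \<open>(1 - \<phi>) w = -(1 - w)\<close> the difference \<open>1 - w\<close> satisfies the same
  hypothesis, so \<open>w\<close> has a right inverse too, and this must be
  \<open>\<phi>\<close>.\<close>

lemma radical_iso:
  assumes V: "V \<in> ob C" and \<phi>: "\<phi> \<in> H V V"
    and r: "\<And>S a b. loc S \<Longrightarrow> b \<in> H S V \<Longrightarrow> a \<in> H V S \<Longrightarrow> \<not> iso (a \<star> (un V \<boxplus> neg \<phi>) \<star> b)"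
  shows "iso \<phi>"
proof -
  have R: "\<exists>w\<in>H V V. \<phi> \<star> w = un V" if \<phi>: "\<phi> \<in> H V V"
    and r: "\<And>S a b. loc S \<Longrightarrow> b \<in> H S V \<Longrightarrow> a \<in> H V S \<Longrightarrow> \<not> iso (a \<star> (un V \<boxplus> neg \<phi>) \<star> b)" for \<phi>
  proof -
    have u: "un V \<in> thru {S. loc S} V V" using krull_schmidt_thru[OF V] by (rule thru_mono) auto
    have r': "\<forall>S a b. loc S \<longrightarrow> b \<in> H S V \<longrightarrow> a \<in> H V S \<longrightarrow> \<not> iso (a \<star> (un V \<boxplus> neg \<phi>) \<star> b)"
      using r by blast
    from radical_right_inverse[OF V \<phi> r' u, of "un V" "zr V V"] show ?thesis
      using V \<phi> by (simp add: H_iff)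
  qed
  have "\<exists>w\<in>H V V. \<phi> \<star> w = un V" by (rule R[OF \<phi>]) (rule r)
  then obtain w where w: "w \<in> H V V" "\<phi> \<star> w = un V" by blast
  have "\<exists>v\<in>H V V. w \<star> v = un V"
  proof (rule R[OF w(1)])
    fix S a b assume S: "loc S" "b \<in> H S V" "a \<in> H V S"
    have "(un V \<boxplus> neg \<phi>) \<star> w = neg (un V \<boxplus> neg w)"
      using w V \<phi> by (simp add: plus_comp neg_comp H_iff neg_distrib plus_commute)
    then have "a \<star> (un V \<boxplus> neg \<phi>) \<star> (w \<star> b) = neg (a \<star> (un V \<boxplus> neg w) \<star> b)"
      by (metis comp_assoc comp_neg neg_comp)
    moreover have "\<not> iso (a \<star> (un V \<boxplus> neg \<phi>) \<star> (w \<star> b))" using r S w by blast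
    ultimately show "\<not> iso (a \<star> (un V \<boxplus> neg w) \<star> b)" using iso_neg by metis
  qed
  then obtain v where v: "v \<in> H V V" "w \<star> v = un V" by blast
  have "\<phi> \<star> w \<star> v = \<phi>" using v \<phi> by (simp add: H_iff)
  moreover have "\<phi> \<star> w \<star> v = v" using v(1) comp_eq_assoc[OF w(2)] by (simp add: H_iff)
  ultimately have "\<phi> = v" by simp
  then show ?thesis using isoI[OF \<phi> w(1)] w v by simp
qed

lemma plus_swap_cancel:
  assumes "f \<in> H X Y" "p \<in> H X Y" "x \<in> H X Y"
  shows "(f \<boxplus> neg x) \<boxplus> (p \<boxplus> x) = p \<boxplus> f"
proof -
  have "(f \<boxplus> neg x) \<boxplus> (p \<boxplus> x) = (p \<boxplus> f) \<boxplus> (x \<boxplus> neg x)" by (simp only: plus_ac)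
  then show ?thesis using assms by (simp add: plus_neg H_iff)
qed

text \<open>Some term \<open>b a\<close> of \<open>f\<close> restricts to an isomorphism on
  \<open>S\<close>, hence \<open>a y\<close> is invertible, say with inverse \<open>c\<close>.
  Composing with \<open>1 - y c a\<close> kills this term and changes \<open>f\<close> only by a map
  of the form \<open>f y d\<close>. Applied to the identity of \<open>V\<close>, it shows that
  splitting off \<open>S\<close> lowers the number of terms.\<close>

lemma thru_n_strip:
  assumes "thru_n {S. loc S} X V n f" and S: "loc S" and x: "x \<in> H V S" and y: "y \<in> H S X"
  shows "iso (x \<star> f \<star> y) \<Longrightarrow> \<exists>m d f'. m < n \<and> d \<in> H X S \<and> thru_n {S. loc S} X V m f' \<and> f = f' \<boxplus> f \<star> y \<star> d"
  using assms(1)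
proof induction
  case zero
  then have "x \<star> zr X V \<star> y = zr S S" using x y loc_ob[OF S] by (simp add: H_iff)
  then show ?case using zero loc_zr[OF S] by simp
next
  case (step n f R a b)
  have f: "f \<in> H X V" using step thru_n_H by blast
  have "iso (x \<star> b \<star> a \<star> y \<boxplus> x \<star> f \<star> y)" using step.prems by (simp add: comp_plus plus_comp comp_assoc)
  moreover have "x \<star> b \<star> a \<star> y \<in> H S S" "x \<star> f \<star> y \<in> H S S" using step x y f by blast+
  ultimately have "iso (x \<star> b \<star> a \<star> y) \<or> iso (x \<star> f \<star> y)" using loc_plus[OF S] by blast
  then show ?case
  proof
    assume "iso (x \<star> b \<star> a \<star> y)"
    then have "iso ((x \<star> b) \<star> (a \<star> y))" by (simp add: comp_assoc)
    moreover have R: "loc R" "a \<star> y \<in> H S R" "x \<star> b \<in> H R S" using step x y by blast+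
    ultimately have "iso (a \<star> y)" using loc_retract_iso[OF S] by blast
    then obtain c where c: "c \<in> H R S" "(a \<star> y) \<star> c = un R" using R isoE[of "a \<star> y" S R] by blast
    then have c: "c \<in> H R S" "a \<star> y \<star> c = un R" by (simp_all add: comp_assoc)
    have "(b \<star> a \<boxplus> f) \<star> y \<star> c \<star> a = b \<star> a \<boxplus> f \<star> y \<star> c \<star> a"
      using step by (simp add: plus_comp comp_assoc c(2)[THEN comp_eq_assoc3] H_iff)
    moreover have "f \<star> (un X \<boxplus> neg (y \<star> c \<star> a)) = f \<boxplus> neg (f \<star> y \<star> c \<star> a)"
      using f by (simp add: comp_plus comp_neg H_iff)
    moreover have "f \<star> y \<star> c \<star> a \<in> H X V" "b \<star> a \<in> H X V" using f step c y by blast+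
    ultimately have "b \<star> a \<boxplus> f = f \<star> (un X \<boxplus> neg (y \<star> c \<star> a)) \<boxplus> (b \<star> a \<boxplus> f) \<star> y \<star> c \<star> a"
      using plus_swap_cancel[OF f] by metis
    moreover have "thru_n {S. loc S} X V n (f \<star> (un X \<boxplus> neg (y \<star> c \<star> a)))"
      using step c y H_ob[OF f] by (blast intro: thru_n_comp_right)
    moreover have "n < Suc n" "c \<star> a \<in> H X S" using c step by auto
    ultimately show ?case by blast
  next
    assume "iso (x \<star> f \<star> y)"
    then obtain m d f' where d: "m < n" "d \<in> H X S" "thru_n {S. loc S} X V m f'" "f = f' \<boxplus> f \<star> y \<star> d"
      using step by blast
    have f': "f' \<in> H X V" using d thru_n_H by blast
    have "b \<star> a = b \<star> (a \<boxplus> neg (a \<star> y \<star> d)) \<boxplus> b \<star> a \<star> y \<star> d"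
      using step y d by (simp add: H_iff arrow_algebra)
    then have "b \<star> a \<boxplus> f = b \<star> (a \<boxplus> neg (a \<star> y \<star> d)) \<boxplus> b \<star> a \<star> y \<star> d \<boxplus> (f' \<boxplus> f \<star> y \<star> d)"
      using d by simp
    also have "\<dots> = (b \<star> (a \<boxplus> neg (a \<star> y \<star> d)) \<boxplus> f') \<boxplus> (b \<star> a \<boxplus> f) \<star> y \<star> d"
      by (simp add: plus_comp comp_assoc plus_ac)
    finally have "b \<star> a \<boxplus> f = (b \<star> (a \<boxplus> neg (a \<star> y \<star> d)) \<boxplus> f') \<boxplus> (b \<star> a \<boxplus> f) \<star> y \<star> d" .
    moreover have "thru_n {S. loc S} X V (Suc m) (b \<star> (a \<boxplus> neg (a \<star> y \<star> d)) \<boxplus> f')"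
      using step y d by (intro thru_n.step) auto
    moreover have "Suc m < Suc n" using d by simp
    ultimately show ?case using d(2) by blast
  qed
qed

text \<open>If \<open>g\<close> is not minimal, some non-invertible \<open>h\<close> fixes it, and
  by \<open>radical_iso\<close> the map \<open>1 - h\<close> is invertible on some local piece. That
  piece splits off \<open>V\<close> and is killed by \<open>g\<close>, so the complement still
  approximates. The induction is on the number of local pieces in the identity of
  \<open>V\<close>.\<close>

lemma min_right_approx_arrow:
  assumes U: "U \<subseteq> ob C" "\<And>X Y S. is_dsum C [X, Y] S \<Longrightarrow> S \<in> U \<Longrightarrow> Y \<in> U"
  shows "thru_n {S. loc S} V V n (un V) \<Longrightarrow> V \<in> U \<Longrightarrow> g \<in> H V M \<Longrightarrow> (\<And>X h. X \<in> U \<Longrightarrow> h \<in> H X M \<Longrightarrow> \<exists>k\<in>H X V. g \<star> k = h) \<Longrightarrow>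
    \<exists>V g. V \<in> U \<and> g \<in> H V M \<and> (\<forall>X\<in>U. \<forall>h\<in>H X M. \<exists>k\<in>H X V. g \<star> k = h) \<and> (\<forall>h\<in>H V V. g \<star> h = g \<longrightarrow> iso h)"
proof (induction n arbitrary: V g rule: less_induct)
  case (less n)
  show ?case
  proof (cases "\<forall>h\<in>H V V. g \<star> h = g \<longrightarrow> iso h")
    case True
    then show ?thesis using less.prems by blast
  next
    case False
    then obtain h where h: "h \<in> H V V" "g \<star> h = g" "\<not> iso h" by blast
    have V: "V \<in> ob C" using less.prems U by blast
    obtain S a b where S: "loc S" "b \<in> H S V" "a \<in> H V S" "iso (a \<star> (un V \<boxplus> neg h) \<star> b)"
      using radical_iso[OF V h(1)] h(3) by blast
    \<comment> \<open>The chosen copy of \<open>S\<close> has to lie in the image of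
      \<open>1 - h\<close>, because there \<open>g\<close> vanishes.\<close>
    define y where "y = (un V \<boxplus> neg h) \<star> b"
    have y: "y \<in> H S V" unfolding y_def using S V h by blast
    have gy: "g \<star> y = zr S M"
      unfolding y_def using h S V less.prems(3) by (simp add: arrow_algebra H_iff h(2)[THEN comp_eq_assoc])
    obtain c where c: "c \<in> H S S" "c \<star> a \<star> y = un S" using S y isoE[OF S(4)] unfolding y_def by (metis comp_H)
    define x where "x = c \<star> a"
    have x: "x \<in> H V S" "x \<star> y = un S" unfolding x_def using c S by (auto simp: comp_assoc)
    obtain V' j q where b': "bip V S V' y x j q" using complement[OF y x] by blast
    then have m: "j \<in> H V' V" "q \<in> H V V'" "q \<star> j = un V'" "q \<star> y = zr S V'" "y \<star> x \<boxplus> j \<star> q = un V"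
      by (auto simp: bip_def)
    have V': "V' \<in> U" using U(2)[OF bip_is_dsum[OF b']] less.prems by blast
    have "iso (x \<star> un V \<star> y)" using x y iso_un[OF loc_ob[OF S(1)]] by (simp add: H_iff)
    from thru_n_strip[OF less.prems(1) S(1) x(1) y this] obtain k d f where
      f: "k < n" "d \<in> H V S" "thru_n {S. loc S} V V k f" "un V = f \<boxplus> un V \<star> y \<star> d" by blast
    have fH: "f \<in> H V V" using f thru_n_H by blast
    \<comment> \<open>On the complement the correction \<open>y d\<close> disappears because
      \<open>q y = 0\<close>, so the identity of \<open>V'\<close> needs only \<open>k < n\<close>
      terms.\<close>
    have "un V' = q \<star> un V \<star> j" using m V by (simp add: H_iff)
    also have "\<dots> = q \<star> f \<star> j \<boxplus> (q \<star> y) \<star> d \<star> j"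
    proof -
      have "q \<star> un V \<star> j = q \<star> (f \<boxplus> un V \<star> y \<star> d) \<star> j" using f(4) by simp
      also have "un V \<star> y \<star> d = y \<star> d" using y f(2) by (simp add: H_iff)
      finally show ?thesis by (simp add: arrow_algebra)
    qed
    also have "\<dots> = q \<star> f \<star> j" using m fH f H_ob[OF m(1)] by (simp add: H_iff)
    finally have k: "thru_n {S. loc S} V' V' k (un V')" using f(3) m thru_n_comp_left thru_n_comp_right by metis
    have g: "(g \<star> j) \<star> q = g"
    proof -
      have "g = g \<star> (y \<star> x \<boxplus> j \<star> q)" using m(5) less.prems(3) by (simp add: H_iff)
      also have "\<dots> = (g \<star> y) \<star> x \<boxplus> (g \<star> j) \<star> q" by (simp add: arrow_algebra)
      also have "\<dots> = (g \<star> j) \<star> q" unfolding gy using x m less.prems(3) H_ob[OF less.prems(3)] by (simp add: H_iff)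
      finally show ?thesis by simp
    qed
    show ?thesis
    proof (rule less.IH[OF f(1) k V'])
      show "g \<star> j \<in> H V' M" using m less.prems by blast
      fix X h assume "X \<in> U" "h \<in> H X M"
      then obtain l where l: "l \<in> H X V" "g \<star> l = h" using less.prems(4) by blast
      then have "(g \<star> j) \<star> (q \<star> l) = h" using g by (simp add: comp_assoc[symmetric])
      then show "\<exists>k\<in>H X V'. (g \<star> j) \<star> k = h" using l m by blast
    qed
  qed
qed

lemma right_approx_iff: "M \<in> ob C \<Longrightarrow> U \<subseteq> ob C \<Longrightarrow> V \<in> ob C \<Longrightarrow> right_approx C U V M g \<longleftrightarrow>
    V \<in> U \<and> Some (V, g, M) \<in> H V M \<and> (\<forall>X\<in>U. \<forall>h\<in>H X M. \<exists>k\<in>H X V. Some (V, g, M) \<star> k = h)"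
proof
  assume o: "M \<in> ob C" "U \<subseteq> ob C" "V \<in> ob C" and r: "right_approx C U V M g"
  then have V: "V \<in> U" "g \<in> mor C V M" by (auto simp: right_approx_def)
  have "\<exists>k\<in>H X V. Some (V, g, M) \<star> k = h" if X: "X \<in> U" "h \<in> H X M" for X h
  proof -
    obtain h0 where h0: "h = Some (X, h0, M)" "h0 \<in> mor C X M" "X \<in> ob C" using X by (auto elim: HE)
    then obtain k where "k \<in> mor C X V" "cmp C X V M g k = h0" using r X by (auto simp: right_approx_def)
    then show ?thesis using h0 V o by (intro bexI[of _ "Some (X, k, V)"]) (auto simp: Some_comp)
  qed
  then show "V \<in> U \<and> Some (V, g, M) \<in> H V M \<and> (\<forall>X\<in>U. \<forall>h\<in>H X M. \<exists>k\<in>H X V. Some (V, g, M) \<star> k = h)"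
    using V o by auto
next
  assume o: "M \<in> ob C" "U \<subseteq> ob C" "V \<in> ob C"
    and r: "V \<in> U \<and> Some (V, g, M) \<in> H V M \<and> (\<forall>X\<in>U. \<forall>h\<in>H X M. \<exists>k\<in>H X V. Some (V, g, M) \<star> k = h)"
  have "\<exists>k\<in>mor C X V. cmp C X V M g k = h" if X: "X \<in> U" "h \<in> mor C X M" for X h
  proof -
    have "Some (X, h, M) \<in> H X M" using X o by auto
    then obtain k where k: "k \<in> H X V" "Some (V, g, M) \<star> k = Some (X, h, M)" using r X by blast
    then obtain k0 where "k = Some (X, k0, V)" "k0 \<in> mor C X V" "X \<in> ob C" by (auto elim: HE)
    then show ?thesis using k r o by (auto simp: Some_comp)
  qed
  then show "right_approx C U V M g" using r by (auto simp: right_approx_def)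
qed

lemma left_approx_iff: "M \<in> ob C \<Longrightarrow> U \<subseteq> ob C \<Longrightarrow> V \<in> ob C \<Longrightarrow> left_approx C U M V f \<longleftrightarrow>
    V \<in> U \<and> Some (M, f, V) \<in> H M V \<and> (\<forall>X\<in>U. \<forall>h\<in>H M X. \<exists>k\<in>H V X. k \<star> Some (M, f, V) = h)"
proof
  assume o: "M \<in> ob C" "U \<subseteq> ob C" "V \<in> ob C" and r: "left_approx C U M V f"
  then have V: "V \<in> U" "f \<in> mor C M V" by (auto simp: left_approx_def)
  have "\<exists>k\<in>H V X. k \<star> Some (M, f, V) = h" if X: "X \<in> U" "h \<in> H M X" for X h
  proof -
    obtain h0 where h0: "h = Some (M, h0, X)" "h0 \<in> mor C M X" "X \<in> ob C" using X by (auto elim: HE)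
    then obtain k where "k \<in> mor C V X" "cmp C M V X k f = h0" using r X by (auto simp: left_approx_def)
    then show ?thesis using h0 V o by (intro bexI[of _ "Some (V, k, X)"]) (auto simp: Some_comp)
  qed
  then show "V \<in> U \<and> Some (M, f, V) \<in> H M V \<and> (\<forall>X\<in>U. \<forall>h\<in>H M X. \<exists>k\<in>H V X. k \<star> Some (M, f, V) = h)"
    using V o by auto
next
  assume o: "M \<in> ob C" "U \<subseteq> ob C" "V \<in> ob C"
    and r: "V \<in> U \<and> Some (M, f, V) \<in> H M V \<and> (\<forall>X\<in>U. \<forall>h\<in>H M X. \<exists>k\<in>H V X. k \<star> Some (M, f, V) = h)"
  have "\<exists>k\<in>mor C V X. cmp C M V X k f = h" if X: "X \<in> U" "h \<in> mor C M X" for X h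
  proof -
    have "Some (M, h, X) \<in> H M X" using X o by auto
    then obtain k where k: "k \<in> H V X" "k \<star> Some (M, f, V) = Some (M, h, X)" using r X by blast
    then obtain k0 where "k = Some (V, k0, X)" "k0 \<in> mor C V X" "X \<in> ob C" by (auto elim: HE)
    then show ?thesis using k r o by (auto simp: Some_comp)
  qed
  then show "left_approx C U M V f" using r by (auto simp: left_approx_def)
qed

lemma min_right_approx_iff: "M \<in> ob C \<Longrightarrow> U \<subseteq> ob C \<Longrightarrow> V \<in> ob C \<Longrightarrow> min_right_approx C U V M g \<longleftrightarrow>
    right_approx C U V M g \<and> (\<forall>h\<in>H V V. Some (V, g, M) \<star> h = Some (V, g, M) \<longrightarrow> iso h)"
  unfolding min_right_approx_def
  by (intro conj_cong refl)
    (auto simp: right_approx_def iso_mor_iff Some_comp elim!: HE)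

lemma min_left_approx_iff: "M \<in> ob C \<Longrightarrow> U \<subseteq> ob C \<Longrightarrow> V \<in> ob C \<Longrightarrow> min_left_approx C U M V f \<longleftrightarrow>
    left_approx C U M V f \<and> (\<forall>h\<in>H V V. h \<star> Some (M, f, V) = Some (M, f, V) \<longrightarrow> iso h)"
  unfolding min_left_approx_def
  by (intro conj_cong refl)
    (auto simp: left_approx_def iso_mor_iff Some_comp elim!: HE)

lemma min_right_approx_ex:
  assumes M: "M \<in> ob C" and U: "U \<subseteq> ob C" "\<And>X Y S. is_dsum C [X, Y] S \<Longrightarrow> S \<in> U \<Longrightarrow> Y \<in> U"
    and g: "right_approx C U V M g"
  shows "\<exists>V g. min_right_approx C U V M g"
proof -
  have V: "V \<in> U" "V \<in> ob C" using g U by (auto simp: right_approx_def)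
  have g': "Some (V, g, M) \<in> H V M" "\<And>X h. X \<in> U \<Longrightarrow> h \<in> H X M \<Longrightarrow> \<exists>k\<in>H X V. Some (V, g, M) \<star> k = h"
    using g right_approx_iff[OF M U(1) V(2)] by auto
  have "un V \<in> thru {S. loc S} V V" using krull_schmidt_thru[OF V(2)] by (rule thru_mono) auto
  then obtain n where n: "thru_n {S. loc S} V V n (un V)" by (auto simp: thru_def)
  have "\<exists>V g. V \<in> U \<and> g \<in> H V M \<and> (\<forall>X\<in>U. \<forall>h\<in>H X M. \<exists>k\<in>H X V. g \<star> k = h) \<and>
      (\<forall>h\<in>H V V. g \<star> h = g \<longrightarrow> iso h)"
    by (rule min_right_approx_arrow[OF U(1) _ n V(1) g'(1)]) (use U(2) g'(2) in blast)+
  then obtain V g where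
    a: "V \<in> U" "g \<in> H V M" "\<forall>X\<in>U. \<forall>h\<in>H X M. \<exists>k\<in>H X V. g \<star> k = h" "\<forall>h\<in>H V V. g \<star> h = g \<longrightarrow> iso h" by blast
  then have "min_right_approx C U V M (val g)"
    using M U H_ob[OF a(2)] by (simp add: min_right_approx_iff right_approx_iff H_val)
  then show ?thesis by blast
qed

end

subsection \<open>The opposite category\<close>

definition op_cat :: "('o, 'k, 'm, 'c) lin_cat_scheme \<Rightarrow> ('o, 'k, 'm) lin_cat" where
  "op_cat C = \<lparr>ob = ob C, Hom = (\<lambda>X Y. Hom C Y X), idm = idm C, cmp = (\<lambda>X Y Z g f. cmp C Z Y X f g)\<rparr>"

lemma op_cat_simps [simp]: "ob (op_cat C) = ob C" "Hom (op_cat C) X Y = Hom C Y X" "idm (op_cat C) = idm C"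
  "cmp (op_cat C) X Y Z g f = cmp C Z Y X f g"
  by (simp_all add: op_cat_def)

lemma is_dsum_op: "is_dsum (op_cat C) Xs S \<longleftrightarrow> is_dsum C Xs S"
proof
  assume "is_dsum (op_cat C) Xs S"
  then show "is_dsum C Xs S" unfolding is_dsum_def op_cat_simps
  proof (elim conjE exE)
    fix i p
    assume "S \<in> ob C" "set Xs \<subseteq> ob C"
      and "\<forall>j<length Xs. i j \<in> mor C S (Xs ! j) \<and> p j \<in> mor C (Xs ! j) S"
      and "\<forall>j<length Xs. \<forall>l<length Xs. cmp C (Xs ! l) S (Xs ! j) (i j) (p l) =
        (if j = l then idm C (Xs ! j) else zerom C (Xs ! l) (Xs ! j))"
      and "(\<Oplus>\<^bsub>Hom C S S\<^esub>j\<in>{..<length Xs}. cmp C S (Xs ! j) S (p j) (i j)) = idm C S"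
    then show "S \<in> ob C \<and> set Xs \<subseteq> ob C \<and>
     (\<exists>i p. (\<forall>j<length Xs. i j \<in> mor C (Xs ! j) S \<and> p j \<in> mor C S (Xs ! j)) \<and>
        (\<forall>j<length Xs. \<forall>l<length Xs. cmp C (Xs ! j) S (Xs ! l) (p l) (i j) =
           (if j = l then idm C (Xs ! j) else zerom C (Xs ! j) (Xs ! l))) \<and>
        (\<Oplus>\<^bsub>Hom C S S\<^esub>j\<in>{..<length Xs}. cmp C S (Xs ! j) S (i j) (p j)) = idm C S)"
      by (intro conjI exI[of _ p] exI[of _ i]) auto
  qed
next
  assume "is_dsum C Xs S"
  then show "is_dsum (op_cat C) Xs S" unfolding is_dsum_def op_cat_simps
  proof (elim conjE exE)
    fix i p
    assume "S \<in> ob C" "set Xs \<subseteq> ob C"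
      and "\<forall>j<length Xs. i j \<in> mor C (Xs ! j) S \<and> p j \<in> mor C S (Xs ! j)"
      and "\<forall>j<length Xs. \<forall>l<length Xs. cmp C (Xs ! j) S (Xs ! l) (p l) (i j) =
        (if j = l then idm C (Xs ! j) else zerom C (Xs ! j) (Xs ! l))"
      and "(\<Oplus>\<^bsub>Hom C S S\<^esub>j\<in>{..<length Xs}. cmp C S (Xs ! j) S (i j) (p j)) = idm C S"
    then show "S \<in> ob C \<and> set Xs \<subseteq> ob C \<and>
     (\<exists>i p. (\<forall>j<length Xs. i j \<in> mor C S (Xs ! j) \<and> p j \<in> mor C (Xs ! j) S) \<and>
        (\<forall>j<length Xs. \<forall>l<length Xs. cmp C (Xs ! l) S (Xs ! j) (i j) (p l) =
           (if j = l then idm C (Xs ! j) else zerom C (Xs ! l) (Xs ! j))) \<and>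
        (\<Oplus>\<^bsub>Hom C S S\<^esub>j\<in>{..<length Xs}. cmp C S (Xs ! j) S (p j) (i j)) = idm C S)"
      by (intro conjI exI[of _ p] exI[of _ i]) auto
  qed
qed

lemma iso_mor_op: "iso_mor (op_cat C) X X f \<longleftrightarrow> iso_mor C X X f"
  by (auto simp: iso_mor_def)

lemma local_end_op: "local_end (op_cat C) X \<longleftrightarrow> local_end C X"
  by (simp add: local_end_def iso_mor_op)

lemma add_of_op: "add_of (op_cat C) U = add_of C U"
  by (simp add: add_of_def is_dsum_op)

lemma approx_op:
  "right_approx (op_cat C) U V M g \<longleftrightarrow> left_approx C U M V g"
  "min_right_approx (op_cat C) U V M g \<longleftrightarrow> min_left_approx C U M V g"
  by (simp_all add: right_approx_def left_approx_def min_right_approx_def min_left_approx_def iso_mor_op)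

lemma (in k_category) op_k_category: "k_category K (op_cat C)"
proof (intro k_category.intro k_category_axioms.intro)
  show "field K" by unfold_locales
  show "\<And>W X Y Z f g h. W \<in> ob (op_cat C) \<Longrightarrow> X \<in> ob (op_cat C) \<Longrightarrow> Y \<in> ob (op_cat C) \<Longrightarrow> Z \<in> ob (op_cat C) \<Longrightarrow>
      f \<in> mor (op_cat C) W X \<Longrightarrow> g \<in> mor (op_cat C) X Y \<Longrightarrow> h \<in> mor (op_cat C) Y Z \<Longrightarrow>
      cmp (op_cat C) W Y Z h (cmp (op_cat C) W X Y g f) = cmp (op_cat C) W X Z (cmp (op_cat C) X Y Z h g) f"
    unfolding op_cat_simps by (rule cmp_assoc[symmetric])
qed (simp_all add: Hom_module idm_mor cmp_linear_left cmp_linear_right cmp_idm_left cmp_idm_right)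

lemma (in ks_split_category) op_ks_split: "ks_split_category K (op_cat C)"
proof -
  interpret op: k_category K "op_cat C" by (rule op_k_category)
  show ?thesis
  proof
    show "set Xs \<subseteq> ob (op_cat C) \<Longrightarrow> \<exists>S. is_dsum (op_cat C) Xs S" for Xs
      using dsum_exists by (simp add: is_dsum_op)
    show "X \<in> ob (op_cat C) \<Longrightarrow> \<exists>Xs. is_dsum (op_cat C) Xs X \<and> (\<forall>Y\<in>set Xs. local_end (op_cat C) Y)" for X
      using krull_schmidt by (simp add: is_dsum_op local_end_op)
    fix S V y x assume "S \<in> ob (op_cat C)" "V \<in> ob (op_cat C)" "y \<in> mor (op_cat C) S V"
      "x \<in> mor (op_cat C) V S" "cmp (op_cat C) S V S x y = idm (op_cat C) S"
    then have "S \<in> ob C" "V \<in> ob C" "x \<in> mor C S V" "y \<in> mor C V S" "cmp C S V S y x = idm C S" by auto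
    from split_complement[OF this] obtain V' j q where "V' \<in> ob C" "j \<in> mor C V' V" "q \<in> mor C V V'"
      "cmp C V' V V' q j = idm C V'" "cmp C V' V S y j = zerom C V' S" "cmp C S V V' q x = zerom C S V'"
      "cmp C V S V x y \<oplus>\<^bsub>Hom C V V\<^esub> cmp C V V' V j q = idm C V" by blast
    then show "\<exists>V'\<in>ob (op_cat C). \<exists>j\<in>mor (op_cat C) V' V. \<exists>q\<in>mor (op_cat C) V V'.
      cmp (op_cat C) V' V V' q j = idm (op_cat C) V' \<and> cmp (op_cat C) V' V S x j = zerom (op_cat C) V' S \<and>
      cmp (op_cat C) S V V' q y = zerom (op_cat C) S V' \<and>
      cmp (op_cat C) V S V y x \<oplus>\<^bsub>Hom (op_cat C) V V\<^esub> cmp (op_cat C) V V' V j q = idm (op_cat C) V"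
      by (intro bexI[of _ V'] bexI[of _ q] bexI[of _ j]) auto
  qed
qed

lemma (in ks_split_category) min_left_approx_ex:
  assumes "M \<in> ob C" "U \<subseteq> ob C" "\<And>X Y S. is_dsum C [X, Y] S \<Longrightarrow> S \<in> U \<Longrightarrow> Y \<in> U" "left_approx C U M V f"
  shows "\<exists>V f. min_left_approx C U M V f"
  using ks_split_category.min_right_approx_ex[OF op_ks_split, of M U V f] assms
  by (simp add: approx_op is_dsum_op)

section \<open>Approximations by add T from finite-dimensional Hom-spaces\<close>

locale ks_split_hom_finite = ks_split_category K C + hom_finite_category K C
  for K :: "('k, 'r) ring_scheme" (structure) and C :: "('o, 'k, 'm, 'c) lin_cat_scheme"
begin

text \<open>One copy of \<open>T\<close> is added for each element of a finite spanning set of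
  \<open>Hom(T, M)\<close>. Linear combinations then show that all maps from \<open>T\<close>
  factor, and maps from objects of add T follow.\<close>

lemma right_approx_add_ex:
  assumes T: "T \<in> ob C" and M: "M \<in> ob C"
  shows "\<exists>V g. right_approx C (add_of C {T}) V M g"
proof -
  obtain F where F: "finite F" "F \<subseteq> mor C T M"
    and s: "\<forall>x\<in>mor C T M. \<exists>c\<in>F \<rightarrow> carrier K. x = (\<Oplus>\<^bsub>Hom C T M\<^esub>b\<in>F. c b \<odot>\<^bsub>Hom C T M\<^esub> b)"
    using hom_finite[OF T M] unfolding fin_dim_def by blast
  interpret M: module K "Hom C T M" using Hom_module T M by blast
  have "\<exists>V g. V \<in> Add {T} \<and> g \<in> H V M \<and> (\<forall>b\<in>F. \<exists>l\<in>H T V. g \<star> l = Some (T, b, M))"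
    using F
  proof (induction F rule: finite_induct)
    case empty
    have "T \<in> Add {T}" "zr T M \<in> H T M" using T M Add_base by auto
    then show ?case by blast
  next
    case (insert b F)
    then obtain V g where V: "V \<in> Add {T}" "g \<in> H V M" "\<forall>b\<in>F. \<exists>l\<in>H T V. g \<star> l = Some (T, b, M)" by auto
    then obtain W i p j q where W: "bip W V T i p j q" using bip_ex[OF _ T] Add_ob by blast
    then have m: "i \<in> H V W" "p \<in> H W V" "j \<in> H T W" "q \<in> H W T" "p \<star> i = un V" "q \<star> j = un T"
      "p \<star> j = zr T V" "q \<star> i = zr V T" by (auto simp: bip_def)
    have b: "Some (T, b, M) \<in> H T M" using insert T M by auto
    define g' where "g' = g \<star> p \<boxplus> Some (T, b, M) \<star> q"
    have g': "g' \<in> H W M" unfolding g'_def using V m b by blast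
    have "g' \<star> j = Some (T, b, M)" unfolding g'_def using V m b T M H_ob[OF m(1)]
      by (simp add: plus_comp comp_assoc H_iff)
    moreover have "\<exists>l\<in>H T W. g' \<star> l = Some (T, b', M)" if "b' \<in> F" for b'
    proof -
      obtain l where l: "l \<in> H T V" "g \<star> l = Some (T, b', M)" using V(3) \<open>b' \<in> F\<close> by blast
      have "g' \<star> (i \<star> l) = g \<star> l \<boxplus> zr T M" unfolding g'_def using V(2) m b T M l(1) H_ob[OF m(1)]
        by (simp add: plus_comp comp_assoc m(5)[THEN comp_eq_assoc] m(8)[THEN comp_eq_assoc] H_iff)
      then have "g' \<star> (i \<star> l) = Some (T, b', M)" using V(2) l(1) by (simp add: H_iff l(2)[symmetric])
      then show ?thesis using l m by blast
    qed
    moreover have "W \<in> Add {T}" using bip_Add[OF W] V(1) Add_base[of T "{T}"] T by blast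
    ultimately show ?case using g' m by blast
  qed
  then obtain V g where V: "V \<in> Add {T}" "g \<in> H V M" "\<And>b. b \<in> F \<Longrightarrow> \<exists>l\<in>H T V. g \<star> l = Some (T, b, M)" by blast
  then obtain g0 where g0: "g = Some (V, g0, M)" "g0 \<in> mor C V M" "V \<in> ob C" by (auto elim: HE)
  interpret V: module K "Hom C T V" using Hom_module T g0 by blast
  have cl: "\<exists>l\<in>mor C T V. cmp C T V M g0 l = b" if "b \<in> F" for b
    using V(3)[OF that] g0 M T by (auto simp: Some_comp elim!: HE)
  have span: "\<exists>l\<in>mor C T V. cmp C T V M g0 l = (\<Oplus>\<^bsub>Hom C T M\<^esub>b\<in>G. c b \<odot>\<^bsub>Hom C T M\<^esub> b)"
    if "G \<subseteq> F" "c \<in> F \<rightarrow> carrier K" for G c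
    using finite_subset[OF that(1) F(1)] that(1)
  proof (induction G rule: finite_induct)
    case empty
    then show ?case using g0 T M by (intro bexI[of _ "zerom C T V"]) (auto simp: cmp_zero_right)
  next
    case (insert b G)
    then obtain l where l: "l \<in> mor C T V" "cmp C T V M g0 l = (\<Oplus>\<^bsub>Hom C T M\<^esub>b\<in>G. c b \<odot>\<^bsub>Hom C T M\<^esub> b)" by auto
    obtain k where k: "k \<in> mor C T V" "cmp C T V M g0 k = b" using cl insert by auto
    have c: "c b \<in> carrier K" "(\<lambda>b. c b \<odot>\<^bsub>Hom C T M\<^esub> b) \<in> G \<rightarrow> mor C T M" "c b \<odot>\<^bsub>Hom C T M\<^esub> b \<in> mor C T M"
      using insert that(2) F(2) by (auto intro!: M.smult_closed)
    have "cmp C T V M g0 (c b \<odot>\<^bsub>Hom C T V\<^esub> k \<oplus>\<^bsub>Hom C T V\<^esub> l) =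
        (\<Oplus>\<^bsub>Hom C T M\<^esub>b\<in>insert b G. c b \<odot>\<^bsub>Hom C T M\<^esub> b)"
      using insert c k l g0 T M by (simp add: cmp_add_right cmp_smult_right)
    moreover have "c b \<odot>\<^bsub>Hom C T V\<^esub> k \<oplus>\<^bsub>Hom C T V\<^esub> l \<in> mor C T V" using c k l by simp
    ultimately show ?case by blast
  qed
  have TM: "\<exists>l\<in>H T V. g \<star> l = h" if "h \<in> H T M" for h
  proof -
    obtain h0 where h0: "h = Some (T, h0, M)" "h0 \<in> mor C T M" using \<open>h \<in> H T M\<close> by (auto elim: HE)
    then obtain c where "c \<in> F \<rightarrow> carrier K" "h0 = (\<Oplus>\<^bsub>Hom C T M\<^esub>b\<in>F. c b \<odot>\<^bsub>Hom C T M\<^esub> b)" using s by blast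
    then obtain l where "l \<in> mor C T V" "cmp C T V M g0 l = h0" using span[of F] by auto
    then show ?thesis using h0 g0 T M by (intro bexI[of _ "Some (T, l, V)"]) (auto simp: Some_comp)
  qed
  \<comment> \<open>Lifts are built along a sum \<open>e\<close> of maps through \<open>T\<close>;
    the case of interest is \<open>e = 1\<close>, which is such a sum for \<open>X\<close> in add
    T.\<close>
  have "\<exists>k\<in>H X V. g \<star> k = h \<star> e" if h: "h \<in> H X M" and "e \<in> thru {T} X X" for X h e
    using that(2)
  proof (induction rule: thru_induct)
    case zero
    then show ?case using h V g0 by (intro bexI[of _ "zr X V"]) (auto simp: H_iff)
  next
    case (step f S a b)
    then obtain k where k: "k \<in> H X V" "g \<star> k = h \<star> f" by blast
    have "h \<star> b \<in> H T M" using step h by blast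
    then obtain l where l: "l \<in> H T V" "g \<star> l = h \<star> b" using TM by blast
    have "g \<star> (l \<star> a \<boxplus> k) = h \<star> (b \<star> a \<boxplus> f)" using k l(2)[THEN comp_eq_assoc] by (simp add: comp_plus comp_assoc)
    moreover have "l \<star> a \<boxplus> k \<in> H X V" using k l step by blast
    ultimately show ?case by blast
  qed
  then have "\<exists>k\<in>H X V. g \<star> k = h" if "X \<in> Add {T}" "h \<in> H X M" for X h
    using that unfolding Add_def H_iff by (metis (no_types, lifting) comp_un mem_Collect_eq)
  then have "right_approx C (Add {T}) V M g0"
    using V(1,2) g0 M Add_ob by (subst right_approx_iff) auto
  then show ?thesis using add_of_eq[of "{T}"] T by auto
qed

end

lemma (in ks_split_hom_finite) left_approx_add_ex:
  assumes T: "T \<in> ob C" and M: "M \<in> ob C"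
  shows "\<exists>V f. left_approx C (add_of C {T}) M V f"
proof -
  have "ks_split_hom_finite K (op_cat C)"
    using op_ks_split hom_finite by (simp add: ks_split_hom_finite_def hom_finite_category_def
        hom_finite_category_axioms_def op_k_category)
  from ks_split_hom_finite.right_approx_add_ex[OF this, of T M] show ?thesis
    using assms by (simp add: approx_op add_of_op)
qed

section \<open>Triangles\<close>

context triangulated_category
begin

definition shf :: "('o, 'm) arrow \<Rightarrow> ('o, 'm) arrow" where
  "shf a = (if arr a then Some (sh C (src a), shm C (src a) (tgt a) (val a), sh C (tgt a)) else None)"

lemma sh_ob [simp]: "X \<in> ob C \<Longrightarrow> sh C X \<in> ob C"
  using shift_equivalence by (auto simp: equivalence_def linear_functor_def)

lemma shm_lin: "X \<in> ob C \<Longrightarrow> Y \<in> ob C \<Longrightarrow> shm C X Y \<in> lin_map K (Hom C X Y) (Hom C (sh C X) (sh C Y))"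
  using shift_equivalence by (auto simp: equivalence_def linear_functor_def)

lemma shm_mor: "X \<in> ob C \<Longrightarrow> Y \<in> ob C \<Longrightarrow> f \<in> mor C X Y \<Longrightarrow> shm C X Y f \<in> mor C (sh C X) (sh C Y)"
  using shm_lin[of X Y] by (auto simp: lin_map_def)

lemma arr_shf [simp]: "arr (shf a) \<longleftrightarrow> arr a"
  by (auto simp: shf_def shm_mor elim!: arrE)

lemma src_shf [simp]: "arr a \<Longrightarrow> src (shf a) = sh C (src a)" and tgt_shf [simp]: "arr a \<Longrightarrow> tgt (shf a) = sh C (tgt a)"
  by (simp_all add: shf_def)

lemma shf_H [intro]: "a \<in> H X Y \<Longrightarrow> shf a \<in> H (sh C X) (sh C Y)"
  by (simp add: H_iff)

lemma shf_comp: "arr a \<Longrightarrow> arr b \<Longrightarrow> tgt a = src b \<Longrightarrow> shf (b \<star> a) = shf b \<star> shf a"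
proof (elim arrE)
  fix X Y Z W f g assume "tgt a = src b" "a = Some (X, f, Y)" "X \<in> ob C" "Y \<in> ob C" "f \<in> mor C X Y"
    "b = Some (Z, g, W)" "Z \<in> ob C" "W \<in> ob C" "g \<in> mor C Z W"
  moreover from this have "shm C X W (cmp C X Y W g f) = cmp C (sh C X) (sh C Y) (sh C W) (shm C Y W g) (shm C X Y f)"
    using shift_equivalence by (auto simp: equivalence_def linear_functor_def)
  ultimately show ?thesis by (simp add: Some_comp shf_def shm_mor cmp_mor)
qed

lemma shf_plus: "arr a \<Longrightarrow> arr b \<Longrightarrow> src a = src b \<Longrightarrow> tgt a = tgt b \<Longrightarrow> shf (a \<boxplus> b) = shf a \<boxplus> shf b"
proof (elim arrE)
  fix X Y Z W f g assume "src a = src b" "tgt a = tgt b" "a = Some (X, f, Y)" "X \<in> ob C" "Y \<in> ob C" "f \<in> mor C X Y"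
    "b = Some (Z, g, W)" "Z \<in> ob C" "W \<in> ob C" "g \<in> mor C Z W"
  moreover from this have "shm C X W (f \<oplus>\<^bsub>Hom C X Y\<^esub> g) = shm C X Y f \<oplus>\<^bsub>Hom C (sh C X) (sh C Y)\<^esub> shm C X Y g"
    using shm_lin[of X Y] by (auto simp: lin_map_def)
  ultimately show ?thesis by (simp add: Some_plus shf_def shm_mor mor_add)
qed

lemma shf_zr [simp]: "X \<in> ob C \<Longrightarrow> Y \<in> ob C \<Longrightarrow> shf (zr X Y) = zr (sh C X) (sh C Y)"
  and shf_neg: "arr a \<Longrightarrow> shf (neg a) = neg (shf a)"
proof -
  have z: "shm C X Y (zerom C X Y) = zerom C (sh C X) (sh C Y)"
    and n: "f \<in> mor C X Y \<Longrightarrow> shm C X Y (\<ominus>\<^bsub>Hom C X Y\<^esub> f) = \<ominus>\<^bsub>Hom C (sh C X) (sh C Y)\<^esub> shm C X Y f"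
    if "X \<in> ob C" "Y \<in> ob C" for X Y f
    using group_hom_zero_neg[of "Hom C X Y" "Hom C (sh C X) (sh C Y)" "shm C X Y"] that shm_lin[of X Y]
    by (auto simp: Hom_group lin_map_def)
  show "X \<in> ob C \<Longrightarrow> Y \<in> ob C \<Longrightarrow> shf (zr X Y) = zr (sh C X) (sh C Y)"
    using z by (simp add: zr_def shf_def mor_zero)
  show "arr a \<Longrightarrow> shf (neg a) = neg (shf a)"
    by (elim arrE) (simp add: Some_neg shf_def n mor_neg shm_mor)
qed

lemma shf_un [simp]: "X \<in> ob C \<Longrightarrow> shf (un X) = un (sh C X)"
  using shift_equivalence by (auto simp: un_def shf_def idm_mor equivalence_def linear_functor_def)

lemma shf_full: "k \<in> H (sh C X) (sh C Y) \<Longrightarrow> X \<in> ob C \<Longrightarrow> Y \<in> ob C \<Longrightarrow> \<exists>l\<in>H X Y. k = shf l"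
proof (elim HE)
  fix f assume k: "X \<in> ob C" "Y \<in> ob C" "k = Some (sh C X, f, sh C Y)" "f \<in> mor C (sh C X) (sh C Y)"
  then have "bij_betw (shm C X Y) (mor C X Y) (mor C (sh C X) (sh C Y))"
    using shift_equivalence by (auto simp: equivalence_def)
  then have "f \<in> shm C X Y ` mor C X Y" using k by (simp add: bij_betw_def)
  then obtain l where "l \<in> mor C X Y" "shm C X Y l = f" by blast
  then show ?thesis using k by (intro bexI[of _ "Some (X, l, Y)"]) (auto simp: shf_def)
qed

lemma shf_faithful: "a \<in> H X Y \<Longrightarrow> b \<in> H X Y \<Longrightarrow> shf a = shf b \<Longrightarrow> a = b"
proof (elim HE)
  fix f g assume k: "X \<in> ob C" "Y \<in> ob C" "a = Some (X, f, Y)" "f \<in> mor C X Y" "b = Some (X, g, Y)" "g \<in> mor C X Y"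
    "shf a = shf b"
  then have "bij_betw (shm C X Y) (mor C X Y) (mor C (sh C X) (sh C Y))"
    using shift_equivalence by (auto simp: equivalence_def)
  then show ?thesis using k by (auto simp: shf_def bij_betw_def inj_on_def)
qed

lemma sh_surj: "Z \<in> ob C \<Longrightarrow> \<exists>X\<in>ob C. isom (sh C X) Z"
  using shift_equivalence isomorphic_iff by (fastforce simp: equivalence_def)

lemma zob_sh: "zob N \<Longrightarrow> zob (sh C N)"
  unfolding zob_def by (metis sh_ob shf_un shf_zr)

definition tri3 :: "'o \<Rightarrow> 'o \<Rightarrow> 'o \<Rightarrow> ('o, 'm) arrow \<Rightarrow> ('o, 'm) arrow \<Rightarrow> ('o, 'm) arrow \<Rightarrow> bool" where
  "tri3 X Y Z f g h \<longleftrightarrow> f \<in> H X Y \<and> g \<in> H Y Z \<and> h \<in> H Z (sh C X) \<and> (X, Y, Z, val f, val g, val h) \<in> tri C"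

lemma tri3D: "tri3 X Y Z f g h \<Longrightarrow> f \<in> H X Y" "tri3 X Y Z f g h \<Longrightarrow> g \<in> H Y Z"
  "tri3 X Y Z f g h \<Longrightarrow> h \<in> H Z (sh C X)" "tri3 X Y Z f g h \<Longrightarrow> X \<in> ob C" "tri3 X Y Z f g h \<Longrightarrow> Y \<in> ob C"
  "tri3 X Y Z f g h \<Longrightarrow> Z \<in> ob C"
  by (auto simp: tri3_def dest: H_ob)

lemma tri_tri3: "(X, Y, Z, f, g, h) \<in> tri C \<Longrightarrow> tri3 X Y Z (Some (X, f, Y)) (Some (Y, g, Z)) (Some (Z, h, sh C X))"
  using tri_sextuple by (fastforce simp: tri3_def is_sextuple_def)

lemma rotate_iff: "f \<in> H X Y \<Longrightarrow> g \<in> H Y Z \<Longrightarrow> h \<in> H Z (sh C X) \<Longrightarrow>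
    tri3 X Y Z f g h \<longleftrightarrow> tri3 Y Z (sh C X) g h (neg (shf f))"
proof (elim HE)
  fix f0 g0 h0 assume a: "f = Some (X, f0, Y)" "g = Some (Y, g0, Z)" "h = Some (Z, h0, sh C X)"
    "X \<in> ob C" "Y \<in> ob C" "Z \<in> ob C" "f0 \<in> mor C X Y" "g0 \<in> mor C Y Z" "h0 \<in> mor C Z (sh C X)"
  then have "is_sextuple C (X, Y, Z, f0, g0, h0)" by (simp add: is_sextuple_def)
  from tri_rotate[OF this] show ?thesis using a
    by (auto simp: tri3_def shf_def Some_neg shm_mor mor_neg)
qed

lemma rotate: "tri3 X Y Z f g h \<Longrightarrow> tri3 Y Z (sh C X) g h (neg (shf f))"
proof -
  assume t: "tri3 X Y Z f g h"
  then show ?thesis using rotate_iff[OF tri3D(1)[OF t] tri3D(2)[OF t] tri3D(3)[OF t]] by simp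
qed

lemma tri3_identity: "X \<in> ob C \<Longrightarrow> zob N \<Longrightarrow> tri3 X X N (un X) (zr X N) (zr N (sh C X))"
  using tri_identity[of X N] by (auto simp: tri3_def zob_def is_zero_ob_iff un_def zr_def idm_mor mor_zero)

lemma tri3_identity': "X \<in> ob C \<Longrightarrow> zob N \<Longrightarrow> tri3 N X X (zr N X) (un X) (zr X (sh C N))"
proof -
  assume X: "X \<in> ob C" and N: "zob N"
  then have "N \<in> ob C" by (simp add: zob_def)
  then show ?thesis using tri3_identity[OF X zob_sh[OF N]] X
    by (subst rotate_iff) (auto simp: H_iff)
qed

lemma fill:
  assumes "tri3 X Y Z f g h" "tri3 X' Y' Z' f' g' h'" "a \<in> H X X'" "b \<in> H Y Y'" "b \<star> f = f' \<star> a"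
  shows "\<exists>c\<in>H Z Z'. c \<star> g = g' \<star> b \<and> shf a \<star> h = h' \<star> c"
proof -
  obtain f0 g0 h0 where f: "f = Some (X, f0, Y)" "g = Some (Y, g0, Z)" "h = Some (Z, h0, sh C X)"
    "X \<in> ob C" "Y \<in> ob C" "Z \<in> ob C" "f0 \<in> mor C X Y" "g0 \<in> mor C Y Z" "h0 \<in> mor C Z (sh C X)"
    using tri3D[OF assms(1)] by (auto elim!: HE)
  obtain f1 g1 h1 where f': "f' = Some (X', f1, Y')" "g' = Some (Y', g1, Z')" "h' = Some (Z', h1, sh C X')"
    "X' \<in> ob C" "Y' \<in> ob C" "Z' \<in> ob C" "f1 \<in> mor C X' Y'" "g1 \<in> mor C Y' Z'" "h1 \<in> mor C Z' (sh C X')"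
    using tri3D[OF assms(2)] by (auto elim!: HE)
  obtain a0 b0 where a: "a = Some (X, a0, X')" "b = Some (Y, b0, Y')" "a0 \<in> mor C X X'" "b0 \<in> mor C Y Y'"
    using assms by (auto elim!: HE)
  have t: "(X, Y, Z, f0, g0, h0) \<in> tri C" "(X', Y', Z', f1, g1, h1) \<in> tri C"
    using assms f f' by (auto simp: tri3_def)
  have "cmp C X Y Y' b0 f0 = cmp C X X' Y' f1 a0" using assms(5) f f' a by (simp add: Some_comp)
  from tri_extend[OF t a(3,4) this] obtain c where "tri_mor C (X, Y, Z, f0, g0, h0) (X', Y', Z', f1, g1, h1) a0 b0 c"
    by blast
  then show ?thesis using f f' a
    by (intro bexI[of _ "Some (Z, c, Z')"]) (auto simp: tri_mor_def Some_comp shf_def shm_mor)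
qed

lemma tri3_iso:
  assumes t: "tri3 X Y Z f g h" and m: "f' \<in> H X' Y'" "g' \<in> H Y' Z'" "h' \<in> H Z' (sh C X')"
    and i: "a \<in> H X X'" "b \<in> H Y Y'" "c \<in> H Z Z'" "iso a" "iso b" "iso c"
    and e: "b \<star> f = f' \<star> a" "c \<star> g = g' \<star> b" "shf a \<star> h = h' \<star> c"
  shows "tri3 X' Y' Z' f' g' h'"
proof -
  obtain f0 g0 h0 where f: "f = Some (X, f0, Y)" "g = Some (Y, g0, Z)" "h = Some (Z, h0, sh C X)"
    "X \<in> ob C" "Y \<in> ob C" "Z \<in> ob C" "f0 \<in> mor C X Y" "g0 \<in> mor C Y Z" "h0 \<in> mor C Z (sh C X)"
    using tri3D[OF t] by (auto elim!: HE)
  obtain f1 g1 h1 where f': "f' = Some (X', f1, Y')" "g' = Some (Y', g1, Z')" "h' = Some (Z', h1, sh C X')"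
    "X' \<in> ob C" "Y' \<in> ob C" "Z' \<in> ob C" "f1 \<in> mor C X' Y'" "g1 \<in> mor C Y' Z'" "h1 \<in> mor C Z' (sh C X')"
    using m by (auto elim!: HE)
  obtain a0 b0 c0 where a: "a = Some (X, a0, X')" "b = Some (Y, b0, Y')" "c = Some (Z, c0, Z')"
    "a0 \<in> mor C X X'" "b0 \<in> mor C Y Y'" "c0 \<in> mor C Z Z'" using i by (auto elim!: HE)
  have "tri_mor C (X, Y, Z, f0, g0, h0) (X', Y', Z', f1, g1, h1) a0 b0 c0"
    using e f f' a by (simp add: tri_mor_def Some_comp shf_def shm_mor)
  moreover have "iso_mor C X X' a0" "iso_mor C Y Y' b0" "iso_mor C Z Z' c0"
    using i a f f' by (auto simp: iso_mor_iff)
  ultimately have "tri_iso C (X, Y, Z, f0, g0, h0) (X', Y', Z', f1, g1, h1)"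
    using f f' by (auto simp: tri_iso_def is_sextuple_def)
  moreover have "(X, Y, Z, f0, g0, h0) \<in> tri C" using t f by (simp add: tri3_def)
  ultimately show ?thesis using tri_iso_closed m f' by (auto simp: tri3_def)
qed

lemma tri_first: "f \<in> H X Y \<Longrightarrow> \<exists>Z g h. tri3 X Y Z f g h"
proof (elim HE)
  fix f0 assume f: "f = Some (X, f0, Y)" "X \<in> ob C" "Y \<in> ob C" "f0 \<in> mor C X Y"
  then obtain Z g h where "(X, Y, Z, f0, g, h) \<in> tri C" using tri_complete by blast
  then show ?thesis using tri_tri3 f by blast
qed

text \<open>Rotating backwards requires the third term to be literally a shift. Essential
  surjectivity provides a shift isomorphic to the cone, and the triangle is transported.\<close>

lemma tri_shift_third:
  assumes f: "f \<in> H X Y"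
  shows "\<exists>Z g h. Z \<in> ob C \<and> tri3 X Y (sh C Z) f g h"
proof -
  obtain Q g h where t: "tri3 X Y Q f g h" using tri_first f by blast
  then obtain Z i where Z: "Z \<in> ob C" "i \<in> H Q (sh C Z)" "iso i"
    using sh_surj tri3D(6) isom_sym unfolding isom_def by metis
  then obtain j where j: "j \<in> H (sh C Z) Q" "j \<star> i = un Q" using isoE by metis
  have "tri3 X Y (sh C Z) f (i \<star> g) (h \<star> j)"
    by (rule tri3_iso[OF t, where a = "un X" and b = "un Y" and c = i])
      (use tri3D[OF t] Z j iso_un in \<open>auto simp: H_iff comp_assoc\<close>)
  then show ?thesis using Z by blast
qed

lemma shf_neg_full: "k \<in> H (sh C X) (sh C Y) \<Longrightarrow> X \<in> ob C \<Longrightarrow> Y \<in> ob C \<Longrightarrow> \<exists>l\<in>H X Y. k = neg (shf l)"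
proof -
  assume k: "k \<in> H (sh C X) (sh C Y)" "X \<in> ob C" "Y \<in> ob C"
  then obtain l where "l \<in> H X Y" "k = shf l" using shf_full by blast
  then show ?thesis by (intro bexI[of _ "neg l"]) (auto simp: shf_neg H_iff)
qed

text \<open>The map is placed first, its cone is written as a shift \<open>X[1]\<close>, and the
  last map is minus the shift of some \<open>f\<close> because the shift is full. Reading the
  rotation axiom backwards then gives the triangle.\<close>

lemma tri_second: "g \<in> H Y Z \<Longrightarrow> \<exists>X f h. tri3 X Y Z f g h"
proof -
  assume g: "g \<in> H Y Z"
  then obtain X a b where X: "X \<in> ob C" and t: "tri3 Y Z (sh C X) g a b" using tri_shift_third by blast
  then obtain f where f: "f \<in> H X Y" "b = neg (shf f)" using shf_neg_full[OF tri3D(3)[OF t] X tri3D(4)[OF t]] by blast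
  then have "tri3 X Y Z f g a" using rotate_iff[OF f(1) g tri3D(2)[OF t]] t by simp
  then show ?thesis by blast
qed

lemma tri_third: "k \<in> H Z (sh C X) \<Longrightarrow> X \<in> ob C \<Longrightarrow> \<exists>Y f g. tri3 X Y Z f g k"
proof -
  assume k: "k \<in> H Z (sh C X)" and X: "X \<in> ob C"
  obtain Y a b where Y: "Y \<in> ob C" and t: "tri3 Z (sh C X) (sh C Y) k a b" using tri_shift_third[OF k] by blast
  have Z: "Z \<in> ob C" using H_ob k by blast
  obtain g where g: "g \<in> H Y Z" "b = neg (shf g)" using shf_neg_full[OF tri3D(3)[OF t] Y Z] by blast
  obtain f where f: "f \<in> H X Y" "a = neg (shf f)" using shf_neg_full[OF tri3D(2)[OF t] X Y] by blast
  have m: "neg (shf f) \<in> H (sh C X) (sh C Y)" using f by blast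
  have "tri3 Y Z (sh C X) g k (neg (shf f))" using rotate_iff[OF g(1) k m] t g f by simp
  then have "tri3 X Y Z f g k" using rotate_iff[OF f(1) g(1) k] by simp
  then show ?thesis by blast
qed

section \<open>Exactness of the Hom functors on triangles\<close>

lemma tri_comp_gf:
  assumes t: "tri3 X Y Z f g h" shows "g \<star> f = zr X Z"
proof -
  obtain N where N: "zob N" using zob_ex by blast
  then have "N \<in> ob C" by (simp add: zob_def)
  then obtain c where "c \<in> H N Z" "c \<star> zr X N = g \<star> f"
    using fill[OF tri3_identity[OF tri3D(4)[OF t] N] t, of "un X" f] tri3D[OF t] by (auto simp: H_iff)
  then show ?thesis using tri3D[OF t] \<open>N \<in> ob C\<close> by (simp add: H_iff)
qed

lemma tri_comp_hg: "tri3 X Y Z f g h \<Longrightarrow> h \<star> g = zr Y (sh C X)"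
  by (rule tri_comp_gf[OF rotate])

lemma tri_comp_fh: "tri3 X Y Z f g h \<Longrightarrow> shf f \<star> h = zr Z (sh C Y)"
proof -
  assume t: "tri3 X Y Z f g h"
  have "neg (shf f) \<star> h = zr Z (sh C Y)" by (rule tri_comp_gf[OF rotate[OF rotate[OF t]]])
  then have "neg (shf f \<star> h) = zr Z (sh C Y)" by (simp add: neg_comp)
  then show ?thesis using tri3D[OF t] by (metis arr_comp arr_neg arr_shf arr_zr neg_neg neg_zr sh_ob)
qed

text \<open>Mapping the triangle on \<open>W\<close>, \<open>0\<close>, \<open>W[1]\<close> to the
  rotated triangle by \<open>k\<close> and zero yields a third component \<open>W[1]\<close> to
  \<open>X[1]\<close>. It is the shift of the required factorization, up to no sign since both
  rotations carry one.\<close>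

lemma factor_f:
  assumes t: "tri3 X Y Z f g h" and k: "k \<in> H W Y" "g \<star> k = zr W Z"
  shows "\<exists>l\<in>H W X. k = f \<star> l"
proof -
  have ob: "W \<in> ob C" using k H_ob by blast
  obtain N where N: "zob N" using zob_ex by blast
  then have No: "N \<in> ob C" by (simp add: zob_def)
  have "zr N Z \<star> zr W N = g \<star> k" using k tri3D[OF t] ob No by (simp add: H_iff)
  moreover have "tri3 W N (sh C W) (zr W N) (zr N (sh C W)) (neg (un (sh C W)))"
    using rotate[OF tri3_identity[OF ob N]] ob by simp
  ultimately obtain c where c: "c \<in> H (sh C W) (sh C X)" "shf k \<star> neg (un (sh C W)) = neg (shf f) \<star> c"
    using fill[OF _ rotate[OF t], of W N "sh C W" _ _ _ k "zr N Z"] k tri3D[OF t] No by blast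
  then obtain l where l: "l \<in> H W X" "c = shf l" using shf_full ob tri3D[OF t] by blast
  have "neg (shf k) = neg (shf (f \<star> l))"
    using c l k tri3D[OF t] ob by (simp add: shf_comp neg_comp comp_neg H_iff)
  then have "neg (neg (shf k)) = neg (neg (shf (f \<star> l)))" by simp
  then have "shf k = shf (f \<star> l)" using k(1) l(1) tri3D(1)[OF t] by (simp add: H_iff)
  then show ?thesis using shf_faithful k l tri3D[OF t] by blast
qed

lemma factor_g: "tri3 X Y Z f g h \<Longrightarrow> k \<in> H W Z \<Longrightarrow> h \<star> k = zr W (sh C X) \<Longrightarrow> \<exists>l\<in>H W Y. k = g \<star> l"
  by (rule factor_f[OF rotate])

lemma factor_h: "tri3 X Y Z f g h \<Longrightarrow> k \<in> H W (sh C X) \<Longrightarrow> shf f \<star> k = zr W (sh C Y) \<Longrightarrow> \<exists>l\<in>H W Z. k = h \<star> l"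
proof -
  assume t: "tri3 X Y Z f g h" and k: "k \<in> H W (sh C X)" "shf f \<star> k = zr W (sh C Y)"
  show ?thesis by (rule factor_f[OF rotate[OF rotate[OF t]] k(1)]) (simp add: neg_comp k(2))
qed

text \<open>The comparison is with the triangle on \<open>0\<close>, \<open>W\<close>,
  \<open>W\<close>: the third component of the resulting morphism is the extension.\<close>

lemma extend_g:
  assumes t: "tri3 X Y Z f g h" and k: "k \<in> H Y W" "k \<star> f = zr X W"
  shows "\<exists>l\<in>H Z W. k = l \<star> g"
proof -
  have ob: "W \<in> ob C" using k H_ob by blast
  obtain N where N: "zob N" using zob_ex by blast
  then have No: "N \<in> ob C" by (simp add: zob_def)
  have "k \<star> f = zr N W \<star> zr X N" using k tri3D[OF t] ob No by (simp add: H_iff)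
  then obtain c where "c \<in> H Z W" "c \<star> g = un W \<star> k"
    using fill[OF t tri3_identity'[OF ob N], of "zr X N" k] k tri3D[OF t] No by blast
  then show ?thesis using k by (auto simp: H_iff)
qed

lemma extend_h: "tri3 X Y Z f g h \<Longrightarrow> k \<in> H Z W \<Longrightarrow> k \<star> g = zr Y W \<Longrightarrow> \<exists>l\<in>H (sh C X) W. k = l \<star> h"
  by (rule extend_g[OF rotate])

lemma extend_f:
  assumes t: "tri3 X Y Z f g h" and k: "k \<in> H X W" "shf k \<star> h = zr Z (sh C W)"
  shows "\<exists>l\<in>H Y W. k = l \<star> f"
proof -
  have ob: "W \<in> ob C" using k H_ob by blast
  obtain l where l: "l \<in> H (sh C Y) (sh C W)" "shf k = l \<star> neg (shf f)"
    using extend_g[OF rotate[OF rotate[OF t]], of "shf k" "sh C W"] k by blast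
  then obtain m where m: "m \<in> H Y W" "l = shf m" using shf_full ob tri3D[OF t] by blast
  have "shf k = shf (neg m \<star> f)"
    using l m tri3D[OF t] by (simp add: shf_comp shf_neg comp_neg neg_comp H_iff)
  then have "k = neg m \<star> f" using shf_faithful[of k X W "neg m \<star> f"] k m tri3D[OF t] by blast
  then show ?thesis using m by blast
qed

lemma factor_f_diff:
  assumes t: "tri3 X Y Z f g h" and "a \<in> H W Y" "b \<in> H W Y" "g \<star> a = g \<star> b"
  shows "\<exists>l\<in>H W X. a = b \<boxplus> f \<star> l"
proof -
  have "g \<star> (a \<boxplus> neg b) = zr W Z" using assms tri3D[OF t] by (simp add: arrow_algebra H_iff)
  moreover have "a \<boxplus> neg b \<in> H W Y" using assms by blast
  ultimately obtain l where l: "l \<in> H W X" "a \<boxplus> neg b = f \<star> l" using factor_f[OF t] by blast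
  then show ?thesis using diff_H[OF assms(2,3) l(2)] by blast
qed

lemma factor_g_diff: "tri3 X Y Z f g h \<Longrightarrow> a \<in> H W Z \<Longrightarrow> b \<in> H W Z \<Longrightarrow> h \<star> a = h \<star> b \<Longrightarrow> \<exists>l\<in>H W Y. a = b \<boxplus> g \<star> l"
  by (rule factor_f_diff[OF rotate])

lemma extend_g_diff:
  assumes t: "tri3 X Y Z f g h" and "a \<in> H Y W" "b \<in> H Y W" "a \<star> f = b \<star> f"
  shows "\<exists>l\<in>H Z W. a = b \<boxplus> l \<star> g"
proof -
  have "(a \<boxplus> neg b) \<star> f = zr X W" using assms tri3D[OF t] by (simp add: arrow_algebra H_iff)
  moreover have "a \<boxplus> neg b \<in> H Y W" using assms by blast
  ultimately obtain l where l: "l \<in> H Z W" "a \<boxplus> neg b = l \<star> g" using extend_g[OF t] by blast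
  then show ?thesis using diff_H[OF assms(2,3) l(2)] by blast
qed

lemma extend_h_diff: "tri3 X Y Z f g h \<Longrightarrow> a \<in> H Z W \<Longrightarrow> b \<in> H Z W \<Longrightarrow> a \<star> g = b \<star> g \<Longrightarrow> \<exists>l\<in>H (sh C X) W. a = b \<boxplus> l \<star> h"
  by (rule extend_g_diff[OF rotate])

lemma extend_f_diff:
  assumes t: "tri3 X Y Z f g h" and "a \<in> H X W" "b \<in> H X W" "shf a \<star> h = shf b \<star> h"
  shows "\<exists>l\<in>H Y W. a = b \<boxplus> l \<star> f"
proof -
  have "shf (a \<boxplus> neg b) \<star> h = zr Z (sh C W)" using assms tri3D[OF t] by (simp add: arrow_algebra shf_plus shf_neg H_iff)
  moreover have "a \<boxplus> neg b \<in> H X W" using assms by blast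
  ultimately obtain l where l: "l \<in> H Y W" "a \<boxplus> neg b = l \<star> f" using extend_f[OF t] by blast
  then show ?thesis using diff_H[OF assms(2,3) l(2)] by blast
qed

text \<open>The connecting map \<open>h\<close> of the cone of \<open>y\<close> vanishes, since
  \<open>h = x[1] y[1] h\<close> and \<open>y[1] h = 0\<close>. The projector \<open>1 - y x\<close>
  kills \<open>y\<close>, so it factors as \<open>s q\<close> through the cone, and
  \<open>h = 0\<close> makes the factorizations unique enough to verify the biproduct
  equations.\<close>

lemma split_mono_bip:
  assumes y: "y \<in> H S V" and x: "x \<in> H V S" and xy: "x \<star> y = un S"
  shows "\<exists>V' j q. bip V S V' y x j q"
proof -
  obtain Y q h where t: "tri3 S V Y y q h" using tri_first[OF y] by blast
  note m = tri3D[OF t]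
  have "h = shf (x \<star> y) \<star> h" using m xy by (simp add: H_iff)
  also have "\<dots> = shf x \<star> shf y \<star> h" using x y by (simp add: shf_comp comp_assoc H_iff)
  also have "\<dots> = zr Y (sh C S)" using tri_comp_fh[OF t] x m by (simp add: H_iff)
  finally have h: "h = zr Y (sh C S)" .
  have "(un V \<boxplus> neg (y \<star> x)) \<star> y = zr S V" using x m xy by (simp add: arrow_algebra H_iff)
  moreover have "un V \<boxplus> neg (y \<star> x) \<in> H V V" using x m by blast
  ultimately obtain s where s: "s \<in> H Y V" "un V \<boxplus> neg (y \<star> x) = s \<star> q" using extend_g[OF t] by blast
  have qy: "q \<star> y = zr S Y" using tri_comp_gf[OF t] .
  have "(q \<star> s) \<star> q = q \<star> (un V \<boxplus> neg (y \<star> x))" using s by (simp add: comp_assoc)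
  also have "\<dots> = un Y \<star> q" using m x by (simp add: arrow_algebra qy[THEN comp_eq_assoc] H_iff)
  finally obtain l where "l \<in> H (sh C S) Y" "q \<star> s = un Y \<boxplus> l \<star> h"
    using extend_h_diff[OF t, of "q \<star> s" Y "un Y"] m s by blast
  then have qs: "q \<star> s = un Y" using m by (simp add: h H_iff)
  have "(x \<star> s) \<star> q = x \<star> (un V \<boxplus> neg (y \<star> x))" using s by (simp add: comp_assoc)
  also have "\<dots> = zr V S" using m x by (simp add: arrow_algebra xy[THEN comp_eq_assoc] H_iff)
  finally obtain l where "l \<in> H (sh C S) S" "x \<star> s = l \<star> h" using extend_h[OF t, of "x \<star> s"] m s x by blast
  then have xs: "x \<star> s = zr Y S" using m by (simp add: h H_iff)
  have "y \<star> x \<boxplus> (un V \<boxplus> neg (y \<star> x)) = un V" using x m by (simp add: arrow_algebra H_iff)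
  then have "bip V S Y y x s q" unfolding bip_def using m x s xy qy qs xs by simp
  then show ?thesis by blast
qed

end

locale krull_schmidt_triangulated = triangulated_category K C + krull_schmidt_category K C + hom_finite_category K C
  for K :: "('k, 'r) ring_scheme" (structure) and C :: "('o, 'k, 'm, 'c) tri_cat_scheme"

sublocale krull_schmidt_triangulated \<subseteq> ks_split_hom_finite K C
proof
  fix S V y x
  assume a: "S \<in> ob C" "V \<in> ob C" "y \<in> mor C S V" "x \<in> mor C V S" "cmp C S V S x y = idm C S"
  then have "Some (V, x, S) \<star> Some (S, y, V) = un S" by (simp add: Some_comp un_def)
  then obtain V' j q where b: "bip V S V' (Some (S, y, V)) (Some (V, x, S)) j q"
    using split_mono_bip[of "Some (S, y, V)" S V "Some (V, x, S)"] a by auto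
  then obtain j0 q0 where jq: "j = Some (V', j0, V)" "q = Some (V, q0, V')" "V' \<in> ob C" "j0 \<in> mor C V' V" "q0 \<in> mor C V V'"
    by (auto simp: bip_def elim!: HE)
  then show "\<exists>V'\<in>ob C. \<exists>j\<in>mor C V' V. \<exists>q\<in>mor C V V'. cmp C V' V V' q j = idm C V' \<and>
      cmp C V' V S x j = zerom C V' S \<and> cmp C S V V' q y = zerom C S V' \<and>
      cmp C V S V y x \<oplus>\<^bsub>Hom C V V\<^esub> cmp C V V' V j q = idm C V"
    using b a by (intro bexI[of _ V'] bexI[of _ j0] bexI[of _ q0])
      (auto simp: bip_def Some_comp Some_plus cmp_mor un_def zr_def)
qed

section \<open>Extension groups\<close>

context triangulated_category
begin

definition Ext0 :: "'o \<Rightarrow> 'o \<Rightarrow> bool" where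
  "Ext0 X Y \<longleftrightarrow> X \<in> ob C \<and> Y \<in> ob C \<and> (\<forall>f\<in>H X (sh C Y). f = zr X (sh C Y))"

lemma ext_vanishes_iff: "X \<in> ob C \<Longrightarrow> Y \<in> ob C \<Longrightarrow> ext_vanishes C X Y \<longleftrightarrow> Ext0 X Y"
proof -
  assume o: "X \<in> ob C" "Y \<in> ob C"
  have "(\<forall>f\<in>H X (sh C Y). f = zr X (sh C Y)) \<longleftrightarrow> (\<forall>f\<in>mor C X (sh C Y). f = zerom C X (sh C Y))"
  proof (intro iffI ballI)
    fix f assume "\<forall>f\<in>H X (sh C Y). f = zr X (sh C Y)" "f \<in> mor C X (sh C Y)"
    then have "Some (X, f, sh C Y) = zr X (sh C Y)" using o by simp
    then show "f = zerom C X (sh C Y)" using o by (simp add: zr_def)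
  qed (use o in \<open>auto simp: zr_def elim!: HE\<close>)
  moreover have "zerom C X (sh C Y) \<in> mor C X (sh C Y)" using o mor_zero by simp
  ultimately show ?thesis using o unfolding ext_vanishes_def Ext0_def by blast
qed

lemma Ext0D: "Ext0 X Y \<Longrightarrow> f \<in> H X (sh C Y) \<Longrightarrow> f = zr X (sh C Y)"
  and Ext0_ob: "Ext0 X Y \<Longrightarrow> X \<in> ob C" "Ext0 X Y \<Longrightarrow> Y \<in> ob C"
  by (auto simp: Ext0_def)

lemma Ext0_thru_left:
  assumes "un X \<in> thru \<U> X X" "\<And>S. S \<in> \<U> \<Longrightarrow> S \<in> ob C \<Longrightarrow> Ext0 S Y" "X \<in> ob C" "Y \<in> ob C"
  shows "Ext0 X Y"
proof -
  have "f \<star> e = zr X (sh C Y)" if "f \<in> H X (sh C Y)" "e \<in> thru \<U> X X" for f e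
    using that(2,1)
  proof (induction rule: thru_induct)
    case zero
    then show ?case by (simp add: H_iff)
  next
    case (step e S a b)
    then have "f \<star> b = zr S (sh C Y)" using assms(2) Ext0D H_ob by blast
    then show ?case using step assms by (simp add: comp_plus comp_assoc[symmetric] H_iff)
  qed
  then show ?thesis using assms unfolding Ext0_def by (metis H_iff comp_un)
qed

lemma Ext0_Add: "X \<in> Add \<U> \<Longrightarrow> Y \<in> ob C \<Longrightarrow> (\<And>S. S \<in> \<U> \<Longrightarrow> S \<in> ob C \<Longrightarrow> Ext0 S Y) \<Longrightarrow> Ext0 X Y"
  unfolding Add_def using Ext0_thru_left by blast

lemma Ext0_retr: "Ext0 X Y \<Longrightarrow> retr S X \<Longrightarrow> Ext0 S Y"
  by (rule Ext0_Add[of S "{X}"]) (auto intro: Add_retr[OF _ Add_base] dest: Ext0_ob)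

end

locale two_CY_category = krull_schmidt_triangulated K C
  for K :: "('k, 'r) ring_scheme" (structure) and C :: "('o, 'k, 'm, 'c) tri_cat_scheme" +
  assumes two_CY: "two_CY K C"
begin

text \<open>Let \<open>\<psi>\<close> be the functional on \<open>Ext(X, X[1])\<close> corresponding to the identity of \<open>X[1]\<close>. By naturality \<open>g\<close>
  corresponds to the functional \<open>f \<mapsto> \<psi>(g[1] f)\<close>.\<close>

lemma CY_nondegenerate:
  assumes X: "X \<in> ob C" and g: "g \<in> H Y (sh C X)"
    and z: "\<And>f. f \<in> H X (sh C Y) \<Longrightarrow> shf g \<star> f = zr X (sh C (sh C X))"
  shows "g = zr Y (sh C X)"
proof -
  obtain v where v: "g = Some (Y, v, sh C X)" "Y \<in> ob C" "v \<in> mor C Y (sh C X)" using g by (auto elim: HE)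
  obtain \<Phi> where P: "\<And>A B. A \<in> ob C \<Longrightarrow> B \<in> ob C \<Longrightarrow>
        \<Phi> A B \<in> lin_map K (dual_module K (Hom C A (sh C B))) (Hom C B (sh C A)) \<and>
        bij_betw (\<Phi> A B) (carrier (dual_module K (Hom C A (sh C B)))) (mor C B (sh C A))"
    and N: "\<And>A A' B B' u v \<psi>. A \<in> ob C \<Longrightarrow> A' \<in> ob C \<Longrightarrow> B \<in> ob C \<Longrightarrow> B' \<in> ob C \<Longrightarrow> u \<in> mor C A A' \<Longrightarrow>
        v \<in> mor C B' B \<Longrightarrow> \<psi> \<in> carrier (dual_module K (Hom C A (sh C B))) \<Longrightarrow>
          \<Phi> A' B' (\<lambda>e\<in>mor C A' (sh C B').
                    \<psi> (cmp C A (sh C B') (sh C B) (shm C B' B v) (cmp C A A' (sh C B') e u))) =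
          cmp C B' (sh C A) (sh C A') (shm C A A' u) (cmp C B' B (sh C A) (\<Phi> A B \<psi>) v)"
    using two_CY unfolding two_CY_def by blast
  have "idm C (sh C X) \<in> mor C (sh C X) (sh C X)" using X idm_mor by simp
  moreover have "\<Phi> X (sh C X) ` carrier (dual_module K (Hom C X (sh C (sh C X)))) = mor C (sh C X) (sh C X)"
    using P[of X "sh C X"] X by (simp add: bij_betw_def)
  ultimately have "idm C (sh C X) \<in> \<Phi> X (sh C X) ` carrier (dual_module K (Hom C X (sh C (sh C X))))" by simp
  then obtain \<psi> where \<psi>: "\<psi> \<in> carrier (dual_module K (Hom C X (sh C (sh C X))))" "\<Phi> X (sh C X) \<psi> = idm C (sh C X)"
    by (rule imageE) simp
  have si: "shm C X X (idm C X) = idm C (sh C X)" using shf_un[OF X] X by (simp add: un_def shf_def idm_mor)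
  let ?Z = "\<lambda>e\<in>mor C X (sh C Y). \<zero>"
  have \<psi>0: "\<psi> (zerom C X (sh C (sh C X))) = \<zero>"
  proof -
    interpret M: module K "Hom C X (sh C (sh C X))" using Hom_module X by simp
    have "\<psi> \<in> lin_map K (Hom C X (sh C (sh C X))) (self_module K)" using \<psi> by (simp add: dual_module_def)
    then have "\<forall>a\<in>carrier K. \<forall>x\<in>mor C X (sh C (sh C X)). \<psi> (a \<odot>\<^bsub>Hom C X (sh C (sh C X))\<^esub> x) = a \<otimes> \<psi> x"
      "\<psi> (zerom C X (sh C (sh C X))) \<in> carrier K"
      by (auto simp: lin_map_def self_module_def)
    then show ?thesis by (metis M.M.zero_closed M.smult_l_null l_null zero_closed)
  qed
  have c0: "cmp C X (sh C Y) (sh C (sh C X)) (shm C Y (sh C X) v) (cmp C X X (sh C Y) e (idm C X)) = zerom C X (sh C (sh C X))"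
    if "e \<in> mor C X (sh C Y)" for e
    using z[of "Some (X, e, sh C Y)"] that v X by (simp add: shf_def Some_comp shm_mor zr_def cmp_idm_right)
  have "(\<lambda>e\<in>mor C X (sh C Y). \<psi> (cmp C X (sh C Y) (sh C (sh C X)) (shm C Y (sh C X) v) (cmp C X X (sh C Y) e (idm C X)))) = ?Z"
    by (rule restrict_ext) (simp only: c0 \<psi>0)
  then have "\<Phi> X Y ?Z = cmp C Y (sh C X) (sh C X) (shm C X X (idm C X)) (cmp C Y (sh C X) (sh C X) (idm C (sh C X)) v)"
    using N[OF X X _ v(2) idm_mor[OF X] v(3) \<psi>(1)] X \<psi>(2) by simp
  then have Pv: "\<Phi> X Y ?Z = v" using X v by (simp add: si cmp_idm_left)
  interpret M: module K "Hom C Y (sh C X)" using Hom_module X v by simp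
  interpret Q: module K "Hom C X (sh C Y)" using Hom_module X v by simp
  have l: "\<Phi> X Y \<in> lin_map K (dual_module K (Hom C X (sh C Y))) (Hom C Y (sh C X))" using P X v by blast
  have Z: "?Z \<in> carrier (dual_module K (Hom C X (sh C Y)))"
    by (auto simp: dual_module_def lin_map_def self_module_def v X mor_add Q.smult_closed)
  \<comment> \<open>The zero functional is written as the scalar 0 times itself, so that homogeneity
    of \<open>\<Phi>\<close> forces its value, which is \<open>v\<close>, to vanish.\<close>
  have "\<Phi> X Y (\<zero> \<odot>\<^bsub>dual_module K (Hom C X (sh C Y))\<^esub> ?Z) = \<zero> \<odot>\<^bsub>Hom C Y (sh C X)\<^esub> \<Phi> X Y ?Z"
    using l Z by (auto simp: lin_map_def)
  moreover have "\<zero> \<odot>\<^bsub>dual_module K (Hom C X (sh C Y))\<^esub> ?Z = ?Z"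
    by (auto simp: dual_module_def restrict_def)
  ultimately have "v = zerom C Y (sh C X)" using Pv v by simp
  then show ?thesis using v X by (simp add: zr_def)
qed

text \<open>A nonzero \<open>g : Y -> X[1]\<close> would have a nonzero composite
  \<open>g[1] f\<close> with some \<open>f : X -> Y[1]\<close>, but every such \<open>f\<close> is
  zero.\<close>

lemma Ext0_sym: "Ext0 X Y \<Longrightarrow> Ext0 Y X"
proof -
  assume e: "Ext0 X Y"
  then have o: "X \<in> ob C" "Y \<in> ob C" by (auto simp: Ext0_def)
  have "g = zr Y (sh C X)" if g: "g \<in> H Y (sh C X)" for g
  proof (rule CY_nondegenerate[OF o(1) g])
    fix f assume "f \<in> H X (sh C Y)"
    then have "f = zr X (sh C Y)" using e Ext0D by blast
    then show "shf g \<star> f = zr X (sh C (sh C X))" using g o by (simp add: H_iff)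
  qed
  then show ?thesis using o by (simp add: Ext0_def)
qed

end

section \<open>Approximations and rigidity\<close>

context ks_split_hom_finite
begin

definition rapp :: "'o set \<Rightarrow> 'o \<Rightarrow> 'o \<Rightarrow> ('o, 'm) arrow \<Rightarrow> bool" where
  "rapp U V M g \<longleftrightarrow> V \<in> U \<and> g \<in> H V M \<and> (\<forall>X\<in>U. \<forall>h\<in>H X M. \<exists>k\<in>H X V. h = g \<star> k)"

definition lapp :: "'o set \<Rightarrow> 'o \<Rightarrow> 'o \<Rightarrow> ('o, 'm) arrow \<Rightarrow> bool" where
  "lapp U M V f \<longleftrightarrow> V \<in> U \<and> f \<in> H M V \<and> (\<forall>X\<in>U. \<forall>h\<in>H M X. \<exists>k\<in>H V X. h = k \<star> f)"

lemma rappD: "rapp U V M g \<Longrightarrow> V \<in> U" "rapp U V M g \<Longrightarrow> g \<in> H V M"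
  "rapp U V M g \<Longrightarrow> X \<in> U \<Longrightarrow> h \<in> H X M \<Longrightarrow> \<exists>k\<in>H X V. h = g \<star> k"
  by (auto simp: rapp_def)

lemma lappD: "lapp U M V f \<Longrightarrow> V \<in> U" "lapp U M V f \<Longrightarrow> f \<in> H M V"
  "lapp U M V f \<Longrightarrow> X \<in> U \<Longrightarrow> h \<in> H M X \<Longrightarrow> \<exists>k\<in>H V X. h = k \<star> f"
  by (auto simp: lapp_def)

lemma right_approx_rapp: "M \<in> ob C \<Longrightarrow> U \<subseteq> ob C \<Longrightarrow> V \<in> ob C \<Longrightarrow>
    right_approx C U V M g \<longleftrightarrow> rapp U V M (Some (V, g, M))"
  unfolding rapp_def by (auto simp: right_approx_iff; metis)

lemma left_approx_lapp: "M \<in> ob C \<Longrightarrow> U \<subseteq> ob C \<Longrightarrow> V \<in> ob C \<Longrightarrow>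
    left_approx C U M V f \<longleftrightarrow> lapp U M V (Some (M, f, V))"
  unfolding lapp_def by (auto simp: left_approx_iff; metis)

lemma min_right_approx_rapp: "M \<in> ob C \<Longrightarrow> U \<subseteq> ob C \<Longrightarrow> V \<in> ob C \<Longrightarrow> min_right_approx C U V M g \<longleftrightarrow>
    rapp U V M (Some (V, g, M)) \<and> (\<forall>h\<in>H V V. Some (V, g, M) \<star> h = Some (V, g, M) \<longrightarrow> iso h)"
  by (simp add: min_right_approx_iff right_approx_rapp)

lemma min_left_approx_lapp: "M \<in> ob C \<Longrightarrow> U \<subseteq> ob C \<Longrightarrow> V \<in> ob C \<Longrightarrow> min_left_approx C U M V f \<longleftrightarrow>
    lapp U M V (Some (M, f, V)) \<and> (\<forall>h\<in>H V V. h \<star> Some (M, f, V) = Some (M, f, V) \<longrightarrow> iso h)"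
  by (simp add: min_left_approx_iff left_approx_lapp)

lemma rapp_min_ex:
  assumes U: "U \<subseteq> ob C" "\<And>X S. retr S X \<Longrightarrow> X \<in> U \<Longrightarrow> S \<in> U" and M: "M \<in> ob C" "right_approx C U V M g"
  shows "\<exists>V g. rapp U V M g \<and> (\<forall>h\<in>H V V. g \<star> h = g \<longrightarrow> iso h)"
proof -
  have "\<exists>V g. min_right_approx C U V M g"
    by (rule min_right_approx_ex[OF M(1) U(1) _ M(2)]) (use U(2) is_dsumD(4) in fastforce)
  then obtain V g where g: "min_right_approx C U V M g" by blast
  then have "V \<in> ob C" using U by (auto simp: min_right_approx_def right_approx_def)
  then show ?thesis using g min_right_approx_rapp[OF M(1) U(1)] by blast
qed

lemma lapp_min_ex:
  assumes U: "U \<subseteq> ob C" "\<And>X S. retr S X \<Longrightarrow> X \<in> U \<Longrightarrow> S \<in> U" and M: "M \<in> ob C" "left_approx C U M V f"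
  shows "\<exists>V f. lapp U M V f \<and> (\<forall>h\<in>H V V. h \<star> f = f \<longrightarrow> iso h)"
proof -
  have "\<exists>V f. min_left_approx C U M V f"
    by (rule min_left_approx_ex[OF M(1) U(1) _ M(2)]) (use U(2) is_dsumD(4) in fastforce)
  then obtain V f where f: "min_left_approx C U M V f" by blast
  then have "V \<in> ob C" using U by (auto simp: min_left_approx_def left_approx_def)
  then show ?thesis using f min_left_approx_lapp[OF M(1) U(1)] by blast
qed

lemma Add_sub: "Add \<U> \<subseteq> ob C"
  using Add_ob by blast

lemma rapp_add_ex: "T \<in> ob C \<Longrightarrow> M \<in> ob C \<Longrightarrow> \<exists>V g. rapp (Add {T}) V M g \<and> (\<forall>h\<in>H V V. g \<star> h = g \<longrightarrow> iso h)"
proof -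
  assume o: "T \<in> ob C" "M \<in> ob C"
  then obtain V g where "right_approx C (Add {T}) V M g" using right_approx_add_ex[OF o] add_of_eq[of "{T}"] by auto
  then show ?thesis using rapp_min_ex[OF Add_sub _ o(2)] Add_retr by blast
qed

lemma lapp_add_ex: "T \<in> ob C \<Longrightarrow> M \<in> ob C \<Longrightarrow> \<exists>V f. lapp (Add {T}) M V f"
proof -
  assume o: "T \<in> ob C" "M \<in> ob C"
  then obtain V f where f: "left_approx C (Add {T}) M V f" using left_approx_add_ex[OF o] add_of_eq[of "{T}"] by auto
  then have "V \<in> ob C" using Add_ob by (auto simp: left_approx_def)
  then show ?thesis using f left_approx_lapp[OF o(2) Add_sub] by blast
qed

lemma iso_cancel_right: "iso e \<Longrightarrow> e \<in> H V V \<Longrightarrow> k \<in> H V Z \<Longrightarrow> k \<star> e = zr V Z \<Longrightarrow> k = zr V Z"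
proof -
  assume e: "iso e" "e \<in> H V V" and k: "k \<in> H V Z" "k \<star> e = zr V Z"
  then obtain x where x: "x \<in> H V V" "e \<star> x = un V" using isoE by metis
  have "k \<star> e \<star> x = k" using x k(1) by (simp add: H_iff)
  moreover have "k \<star> e \<star> x = zr V Z \<star> x" by (rule comp_eq_assoc[OF k(2)])
  moreover have "zr V Z \<star> x = zr V Z" using x by (simp add: H_iff)
  ultimately show ?thesis by simp
qed

lemma kill_thru:
  assumes "\<And>S b. S \<in> \<U> \<Longrightarrow> b \<in> H S X \<Longrightarrow> f \<star> b = zr S Z" and f: "f \<in> H X Z" and "t \<in> thru \<U> T X"
  shows "f \<star> t = zr T Z"
  using assms(3)
proof (induction rule: thru_induct)
  case zero
  then show ?case using f by (simp add: H_iff)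
next
  case (step t S a b)
  have "f \<star> (b \<star> a \<boxplus> t) = (f \<star> b) \<star> a \<boxplus> f \<star> t" by (simp add: arrow_algebra)
  also have "\<dots> = zr T Z" using step assms(1)[of S b] f H_ob[of a T S] H_ob[OF f] by (simp add: H_iff)
  finally show ?case .
qed

lemma kill_Add:
  assumes "\<And>S b. S \<in> \<U> \<Longrightarrow> b \<in> H S X \<Longrightarrow> f \<star> b = zr S Z" and f: "f \<in> H X Z" and p: "p \<in> H V X" "V \<in> Add \<U>"
  shows "f \<star> p = zr V Z"
proof (rule kill_thru[OF assms(1) f])
  have "p \<star> un V \<in> thru \<U> V X" using p(2) by (intro thru_comp_left[OF _ p(1)]) (simp add: Add_def)
  then show "p \<in> thru \<U> V X" using p by (simp add: H_iff)
qed

end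

context two_CY_category
begin

lemma Ext0_retr_right: "Ext0 X Y \<Longrightarrow> retr S Y \<Longrightarrow> Ext0 X S"
  using Ext0_sym Ext0_retr by blast

lemma Ext0_Add_right: "X \<in> Add \<U> \<Longrightarrow> Y \<in> ob C \<Longrightarrow> (\<And>S. S \<in> \<U> \<Longrightarrow> S \<in> ob C \<Longrightarrow> Ext0 Y S) \<Longrightarrow> Ext0 Y X"
  using Ext0_Add Ext0_sym by blast

lemma Ext0_Add_both: "X \<in> Add \<U> \<Longrightarrow> Y \<in> Add \<V> \<Longrightarrow> (\<And>S R. S \<in> \<U> \<Longrightarrow> R \<in> \<V> \<Longrightarrow> Ext0 S R) \<Longrightarrow> Ext0 X Y"
  by (meson Add_ob Ext0_Add Ext0_Add_right)

lemma lift_shf: "k \<in> H (sh C X) (sh C Y) \<Longrightarrow> X \<in> ob C \<Longrightarrow> Y \<in> ob C \<Longrightarrow> (\<And>l. l \<in> H X Y \<Longrightarrow> k = shf l \<Longrightarrow> P) \<Longrightarrow> P"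
  using shf_full by blast

text \<open>In the exact sequence \<open>Hom(A,V) -> Hom(A,X) -> Ext(A,N) -> Ext(A,V)\<close> the
  first map is onto by the approximation property and the last term is zero.\<close>

lemma rapp_kernel:
  assumes r: "rapp U V X p" and t: "tri3 N V X u p h" and A: "A \<in> U" "Ext0 A V"
  shows "Ext0 A N"
  unfolding Ext0_def
proof (intro conjI ballI)
  note m = tri3D[OF t]
  show "A \<in> ob C" "N \<in> ob C" using A m Ext0_ob by auto
  fix k assume k: "k \<in> H A (sh C N)"
  then have "shf u \<star> k \<in> H A (sh C V)" using m by blast
  then have "shf u \<star> k = zr A (sh C V)" using A Ext0D by blast
  then obtain l where l: "l \<in> H A X" "k = h \<star> l" using factor_h[OF t k] by blast
  then obtain n where n: "n \<in> H A V" "l = p \<star> n" using rappD(3)[OF r A(1)] by blast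
  have "k = (h \<star> p) \<star> n" using l n by (simp add: comp_assoc)
  also have "\<dots> = zr A (sh C N)" using tri_comp_hg[OF t] n by (simp add: H_iff)
  finally show "k = zr A (sh C N)" .
qed

lemma lapp_cokernel:
  assumes r: "lapp U X V f" and t: "tri3 X V N f g h" and A: "A \<in> U" "Ext0 V A"
  shows "Ext0 N A"
  unfolding Ext0_def
proof (intro conjI ballI)
  note m = tri3D[OF t]
  show Ao: "A \<in> ob C" and "N \<in> ob C" using A m Ext0_ob by auto
  fix k assume k: "k \<in> H N (sh C A)"
  then have "k \<star> g \<in> H V (sh C A)" using m by blast
  then have "k \<star> g = zr V (sh C A)" using A Ext0D by blast
  then obtain l where l: "l \<in> H (sh C X) (sh C A)" "k = l \<star> h" using extend_h[OF t k] by blast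
  then obtain l' where l': "l' \<in> H X A" "l = shf l'" using lift_shf m Ao by metis
  then obtain n where n: "n \<in> H V A" "l' = n \<star> f" using lappD(3)[OF r A(1)] by blast
  have "k = shf n \<star> shf f \<star> h" using l l' n m by (simp add: comp_assoc shf_comp H_iff)
  also have "\<dots> = zr N (sh C A)" using tri_comp_fh[OF t] n by (simp add: H_iff)
  finally show "k = zr N (sh C A)" .
qed

text \<open>An extension \<open>k : Y -> Y[1]\<close> vanishes on \<open>V\<close>, so it is
  \<open>l'[1] c\<close> with \<open>l' : T -> Y\<close>. Rigidity of \<open>T\<close> lifts
  \<open>l'\<close> to a map into \<open>V\<close>, which extends over \<open>a\<close>. Thus
  \<open>k\<close> ends up containing the factor \<open>a[1] c = 0\<close>.\<close>

lemma cone_rigid: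
  assumes t: "tri3 T V Y a b c" and T: "Ext0 T T" and V: "Ext0 V Y"
    and f: "\<And>m. m \<in> H T V \<Longrightarrow> \<exists>n\<in>H V V. m = n \<star> a"
  shows "Ext0 Y Y"
  unfolding Ext0_def
proof (intro conjI ballI)
  note m = tri3D[OF t]
  show "Y \<in> ob C" "Y \<in> ob C" using m by auto
  fix k assume k: "k \<in> H Y (sh C Y)"
  then have "k \<star> b = zr V (sh C Y)" using V m Ext0D by blast
  then obtain l where l: "l \<in> H (sh C T) (sh C Y)" "k = l \<star> c" using extend_h[OF t k] by blast
  then obtain l' where l': "l' \<in> H T Y" "l = shf l'" using lift_shf m by metis
  have "c \<star> l' = zr T (sh C T)" using T m l' Ext0D by blast
  then obtain n where n: "n \<in> H T V" "l' = b \<star> n" using factor_g[OF t l'(1)] by blast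
  then obtain n' where n': "n' \<in> H V V" "n = n' \<star> a" using f by blast
  have "k = shf b \<star> shf n' \<star> shf a \<star> c" using l l' n n' m by (simp add: comp_assoc shf_comp H_iff)
  also have "\<dots> = zr Y (sh C Y)" using tri_comp_fh[OF t] n' m by (simp add: H_iff)
  finally show "k = zr Y (sh C Y)" .
qed

text \<open>Dual chase: \<open>k = h u\<close> with \<open>u : N -> M\<close>, rigidity of
  \<open>M\<close> extends \<open>u\<close> over \<open>V\<close>, and lifting this through
  \<open>g\<close> produces the factor \<open>h g = 0\<close>.\<close>

lemma cocone_rigid:
  assumes t: "tri3 N V M f g h" and M: "Ext0 M M" and V: "Ext0 N V"
    and w: "\<And>v. v \<in> H V M \<Longrightarrow> \<exists>w\<in>H V V. v = g \<star> w"
  shows "Ext0 N N"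
  unfolding Ext0_def
proof (intro conjI ballI)
  note m = tri3D[OF t]
  show "N \<in> ob C" "N \<in> ob C" using m by auto
  fix k assume k: "k \<in> H N (sh C N)"
  have "shf f \<star> k = zr N (sh C V)" using V m k Ext0D by blast
  then obtain u where u: "u \<in> H N M" "k = h \<star> u" using factor_h[OF t k] by blast
  have "shf u \<star> h = zr M (sh C M)" using M m u Ext0D by blast
  then obtain v where v: "v \<in> H V M" "u = v \<star> f" using extend_f[OF t u(1)] by blast
  then obtain x where x: "x \<in> H V V" "v = g \<star> x" using w by blast
  have "k = (h \<star> g) \<star> x \<star> f" using u v x by (simp add: comp_assoc)
  also have "\<dots> = zr N (sh C N)" using tri_comp_hg[OF t] x m by (simp add: H_iff)
  finally show "k = zr N (sh C N)" .
qed

section \<open>Cluster tilting classes\<close>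

text \<open>Cluster tilting for a class instead of one object. Pairs such as \<open>{B0, W}\<close>
  and whole clusters can then be handled without choosing direct sums; for a singleton it is the
  notion of the statement.\<close>

definition ctc :: "'o set \<Rightarrow> 'o set \<Rightarrow> bool" where
  "ctc \<B> \<T> \<longleftrightarrow> \<T> \<subseteq> \<B> \<and> (\<forall>X\<in>\<T>. \<forall>Y\<in>\<T>. Ext0 X Y) \<and> (\<forall>X\<in>\<B>. (\<forall>Y\<in>\<T>. Ext0 Y X) \<longrightarrow> X \<in> Add \<T>)"

lemma cluster_tilting_iff: "\<B> \<subseteq> ob C \<Longrightarrow> cluster_tilting C \<B> T \<longleftrightarrow> ctc \<B> {T}"
proof -
  assume B: "\<B> \<subseteq> ob C"
  show ?thesis
  proof (cases "T \<in> \<B>")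
    case True
    then have T: "T \<in> ob C" using B by blast
    have "(ext_vanishes C T X \<longrightarrow> X \<in> add_of C {T}) = (Ext0 T X \<longrightarrow> X \<in> Add {T})" if "X \<in> \<B>" for X
      using that B T ext_vanishes_iff add_of_eq[of "{T}"] by auto
    then show ?thesis using True T ext_vanishes_iff
      by (simp add: cluster_tilting_def rigid_def ctc_def)
  next
    case False
    then show ?thesis by (simp add: cluster_tilting_def rigid_def ctc_def)
  qed
qed

lemma ctc_cong:
  assumes c: "ctc \<B> \<T>" and s: "\<T>' \<subseteq> \<B>" and B: "\<B> \<subseteq> ob C"
    and a: "\<And>X. X \<in> \<T> \<Longrightarrow> X \<in> Add \<T>'" "\<And>X. X \<in> \<T>' \<Longrightarrow> X \<in> Add \<T>"
  shows "ctc \<B> \<T>'"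
  unfolding ctc_def
proof (intro conjI ballI impI s)
  fix X Y assume "X \<in> \<T>'" "Y \<in> \<T>'"
  then show "Ext0 X Y" using Ext0_Add_both[of X \<T> Y \<T>] a c unfolding ctc_def by blast
next
  fix X assume X: "X \<in> \<B>" "\<forall>Y\<in>\<T>'. Ext0 Y X"
  have "Ext0 Y X" if "Y \<in> \<T>" for Y
    using Ext0_Add[OF a(1)[OF that], of X] X B by blast
  then have "X \<in> Add \<T>" using c X unfolding ctc_def by blast
  then show "X \<in> Add \<T>'" using Add_trans a by blast
qed

text \<open>Resolve \<open>X\<close> by a triangle \<open>T1 -> V -> X\<close> with \<open>V\<close>
  a right add T-approximation; then \<open>T1\<close> is in add T because \<open>T\<close> is
  cluster tilting. An extension \<open>f\<close> kills \<open>V\<close>, hence comes from a map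
  \<open>T1 -> Y\<close>, and \<open>g\<close> kills that map. So all composites
  \<open>g[1] f\<close> vanish and nondegeneracy gives \<open>g = 0\<close>.\<close>

lemma Ext_of_killed:
  assumes T: "ctc (ob C) {T}" and ob: "X \<in> ob C" "Y \<in> ob C"
    and X: "\<And>t f. t \<in> H T X \<Longrightarrow> f \<in> H X (sh C Y) \<Longrightarrow> f \<star> t = zr T (sh C Y)"
    and Y: "\<And>t f. t \<in> H T Y \<Longrightarrow> f \<in> H Y (sh C X) \<Longrightarrow> f \<star> t = zr T (sh C X)"
  shows "Ext0 Y X"
  unfolding Ext0_def
proof (intro conjI ballI ob)
  fix g assume g: "g \<in> H Y (sh C X)"
  have To: "T \<in> ob C" "Ext0 T T" using T by (auto simp: ctc_def)
  show "g = zr Y (sh C X)"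
  proof (rule CY_nondegenerate[OF ob(1) g])
    fix f assume f: "f \<in> H X (sh C Y)"
    obtain V p where p: "rapp (Add {T}) V X p" using rapp_add_ex[OF To(1) ob(1)] by blast
    then obtain T1 u h where t: "tri3 T1 V X u p h" using tri_second rappD(2) by blast
    note m = tri3D[OF t]
    have "Ext0 T V" using Ext0_Add_both[of T "{T}" V "{T}"] p To Add_base[of T] by (auto dest: rappD(1))
    then have "Ext0 T T1" using rapp_kernel[OF p t] Add_base To by blast
    then have T1: "T1 \<in> Add {T}" using T m by (auto simp: ctc_def)
    have "f \<star> p = zr V (sh C Y)" using kill_Add[OF _ f m(2) rappD(1)[OF p]] X f by blast
    then obtain a where a: "a \<in> H (sh C T1) (sh C Y)" "f = a \<star> h" using extend_h[OF t f] by blast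
    then obtain a' where a': "a' \<in> H T1 Y" "a = shf a'" using lift_shf m ob by metis
    have ga: "g \<star> a' = zr T1 (sh C X)" using kill_Add[OF _ g a'(1) T1] Y g by blast
    have "shf g \<star> f = shf (g \<star> a') \<star> h" using a a' g by (simp add: shf_comp comp_assoc H_iff)
    also have "\<dots> = zr X (sh C (sh C X))" unfolding ga using m ob by (simp add: H_iff)
    finally show "shf g \<star> f = zr X (sh C (sh C X))" .
  qed
qed

text \<open>If all maps from \<open>T\<close> to the right perpendicular class of \<open>R\<close> factor through \<open>add R\<close>, then extensions
  between objects of that class kill these maps, hence vanish; so right \<open>add R\<close>-approximations of its
  objects split.\<close>

lemma ct_criterion:
  assumes T: "ctc (ob C) {T}" and R: "Ext0 R R"
    and F: "\<And>X t. Ext0 R X \<Longrightarrow> t \<in> H T X \<Longrightarrow> t \<in> thru {R} T X"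
  shows "ctc (ob C) {R}"
proof -
  have Ro: "R \<in> ob C" using R Ext0_ob by blast
  have E: "Ext0 Y X" if "Ext0 R X" "Ext0 R Y" for X Y
  proof -
    have K: "f \<star> t = zr T (sh C Y)" if "Ext0 R X" "Ext0 R Y" "t \<in> H T X" "f \<in> H X (sh C Y)" for X Y f t
    proof (rule kill_thru[OF _ that(4) F[OF that(1,3)]])
      fix S b assume "S \<in> {R}" "b \<in> H S X"
      then show "f \<star> b = zr S (sh C Y)" using Ext0D[OF that(2)] that(4) by blast
    qed
    show ?thesis using Ext_of_killed[OF T, of X Y] K that Ext0_ob by blast
  qed
  have "X \<in> Add {R}" if X: "Ext0 R X" for X
  proof -
    have Xo: "X \<in> ob C" using X Ext0_ob by blast
    obtain V p where p: "rapp (Add {R}) V X p" using rapp_add_ex[OF Ro Xo] by blast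
    then obtain N u h where t: "tri3 N V X u p h" using tri_second rappD(2) by blast
    note m = tri3D[OF t]
    have "Ext0 R V" using Ext0_Add_both[of R "{R}" V "{R}"] p R Ro Add_base[of R] by (auto dest: rappD(1))
    then have "Ext0 R N" using rapp_kernel[OF p t] Add_base Ro by blast
    then have "Ext0 X N" using E X by blast
    then have "h = zr X (sh C N)" using m(3) Ext0D by blast
    then have "h \<star> un X = zr X (sh C N)" using m(4,6) by simp
    then obtain l where "l \<in> H X V" "un X = p \<star> l" using factor_g[OF t, of "un X"] m by blast
    then have "retr X V" using m unfolding retr_def by metis
    then show ?thesis using Add_retr rappD(1)[OF p] by blast
  qed
  then show ?thesis using R Ro by (auto simp: ctc_def)
qed

lemma ctc_pair:
  assumes Q: "bip Q R W i p j q"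
  shows "ctc (ob C) {Q} \<longleftrightarrow> ctc (ob C) {R, W}"
proof -
  have ob: "Q \<in> ob C" "R \<in> ob C" "W \<in> ob C" using bip_retr[OF Q] by (auto simp: retr_def)
  have a: "R \<in> Add {Q}" "W \<in> Add {Q}" "Q \<in> Add {R, W}"
    using bip_retr[OF Q] Add_retr Add_base ob bip_Add[OF Q, of "{R, W}"] by blast+
  show ?thesis using ctc_cong[of "ob C" "{Q}" "{R, W}"] ctc_cong[of "ob C" "{R, W}" "{Q}"] a ob by blast
qed

end

section \<open>Cluster tilting in an extension closed subcategory\<close>

locale extension_closed_subcategory = two_CY_category K C
  for K :: "('k, 'r) ring_scheme" (structure) and C :: "('o, 'k, 'm, 'c) tri_cat_scheme" +
  fixes B :: "'o set"
  assumes subcat: "subcategory C B" and fun_finite: "functorially_finite C B" and ext_closed: "extension_closed C B"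
begin

definition Bperp :: "'o set" where
  "Bperp = {X \<in> ob C. \<forall>Y\<in>B. Ext0 X Y}"

lemma B_ob: "B \<subseteq> ob C"
  using subcat by (simp add: subcategory_def)

lemma B_retr: "retr S X \<Longrightarrow> X \<in> B \<Longrightarrow> S \<in> B"
proof -
  assume "retr S X" and X: "X \<in> B"
  then obtain a b where "a \<in> H S X" "b \<in> H X S" "b \<star> a = un S" by (auto simp: retr_def)
  then obtain V j q where "bip X S V a b j q" using complement by blast
  then have "is_dsum C [S, V] X" by (rule bip_is_dsum)
  then show "S \<in> B" using subcat X unfolding subcategory_def by blast
qed

lemma B_Add: "X \<in> Add \<U> \<Longrightarrow> \<U> \<subseteq> B \<Longrightarrow> X \<in> B"
proof -
  assume X: "X \<in> Add \<U>" and U: "\<U> \<subseteq> B"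
  then have "X \<in> add_of C \<U>" using add_of_eq[of \<U>] B_ob by blast
  then show "X \<in> B" using subcat U unfolding subcategory_def add_of_def by blast
qed

lemma B_ext: "tri3 X Y Z f g h \<Longrightarrow> X \<in> B \<Longrightarrow> Z \<in> B \<Longrightarrow> Y \<in> B"
  using ext_closed unfolding extension_closed_def tri3_def by blast

lemma Bperp_Ext: "X \<in> Bperp \<Longrightarrow> Y \<in> B \<Longrightarrow> Ext0 X Y"
  and Bperp_Ext': "X \<in> Bperp \<Longrightarrow> Y \<in> B \<Longrightarrow> Ext0 Y X"
  using Ext0_sym by (auto simp: Bperp_def)

lemma Bperp_retr: "retr S X \<Longrightarrow> X \<in> Bperp \<Longrightarrow> S \<in> Bperp"
  using Ext0_retr[of X _ S] unfolding Bperp_def by (auto simp: retr_def[of S X])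

text \<open>The next two lemmas are Wakamatsu's lemma and its dual.\<close>

lemma cotorsion_right:
  assumes X: "X \<in> ob C"
  shows "\<exists>W V u p h. tri3 W V X u p h \<and> V \<in> B \<and> W \<in> Bperp"
proof -
  obtain V0 g0 where "right_approx C B V0 X g0" using fun_finite X unfolding functorially_finite_def by blast
  then have "\<exists>V p. rapp B V X p \<and> (\<forall>h\<in>H V V. p \<star> h = p \<longrightarrow> iso h)"
    using B_retr by (intro rapp_min_ex[OF B_ob _ X]) auto
  then obtain V p where p: "rapp B V X p" and min: "\<And>h. h \<in> H V V \<Longrightarrow> p \<star> h = p \<Longrightarrow> iso h"
    by blast
  then obtain W u h where t: "tri3 W V X u p h" using tri_second rappD(2) by blast
  note m = tri3D[OF t]
  have "Ext0 Y W" if Y: "Y \<in> B" for Y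
    unfolding Ext0_def
  proof (intro conjI ballI)
    show "Y \<in> ob C" "W \<in> ob C" using Y B_ob m by auto
    fix \<delta> assume d: "\<delta> \<in> H Y (sh C W)"
    \<comment> \<open>The extension is pushed out along \<open>u\<close>. Its middle term
      \<open>E\<close> is in \<open>B\<close>, the approximation \<open>p\<close> extends over
      \<open>E\<close> and lifts back to \<open>V\<close>, and minimality of \<open>p\<close> splits
      the pushed extension. So \<open>\<delta>\<close> comes from a map \<open>Y -> X\<close>, which
      lifts through \<open>p\<close>.\<close>
    have k: "shf u \<star> \<delta> \<in> H Y (sh C V)" using d m by blast
    then obtain E s e where tE: "tri3 V E Y s e (shf u \<star> \<delta>)" using tri_third m by blast
    note mE = tri3D[OF tE]
    have E: "E \<in> B" using B_ext[OF tE] rappD(1)[OF p] Y by blast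
    have "shf p \<star> shf u \<star> \<delta> = shf (p \<star> u) \<star> \<delta>" using m by (simp add: shf_comp comp_assoc H_iff)
    also have "\<dots> = zr Y (sh C X)" using tri_comp_gf[OF t] m d by (simp add: H_iff)
    finally obtain p' where p': "p' \<in> H E X" "p = p' \<star> s" using extend_f[OF tE m(2)] by blast
    then obtain w where w: "w \<in> H E V" "p' = p \<star> w" using rappD(3)[OF p E] by blast
    have ws: "w \<star> s \<in> H V V" using w mE by blast
    have "p \<star> w \<star> s = p" by (simp only: comp_eq_assoc[OF w(2)[symmetric]] p'(2)[symmetric])
    then have "iso (w \<star> s)" using min ws by blast
    then obtain x where x: "x \<in> H V V" "x \<star> w \<star> s = un V" using ws isoE by metis
    have "shf u \<star> \<delta> = shf (x \<star> w \<star> s) \<star> shf u \<star> \<delta>" using k x m by (simp add: H_iff)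
    also have "shf (x \<star> w \<star> s) = shf x \<star> shf w \<star> shf s"
      using x(1) w(1) mE(1) by (simp add: shf_comp H_iff)
    also have "(shf x \<star> shf w \<star> shf s) \<star> shf u \<star> \<delta> = shf x \<star> shf w \<star> shf s \<star> (shf u \<star> \<delta>)"
      by (simp only: comp_assoc)
    also have "\<dots> = zr Y (sh C V)" using tri_comp_fh[OF tE] x w by (simp add: H_iff)
    finally obtain l where l: "l \<in> H Y X" "\<delta> = h \<star> l" using factor_h[OF t d] by blast
    then obtain n where n: "n \<in> H Y V" "l = p \<star> n" using rappD(3)[OF p Y] by blast
    have "\<delta> = (h \<star> p) \<star> n" using l n by (simp add: comp_assoc)
    also have "\<dots> = zr Y (sh C W)" using tri_comp_hg[OF t] n by (simp add: H_iff)
    finally show "\<delta> = zr Y (sh C W)" .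
  qed
  then have "W \<in> Bperp" using m Ext0_sym by (auto simp: Bperp_def)
  then show ?thesis using t rappD(1)[OF p] by blast
qed

lemma cotorsion_left:
  assumes X: "X \<in> ob C"
  shows "\<exists>V W a b c. tri3 X V W a b c \<and> V \<in> B \<and> W \<in> Bperp \<and> lapp B X V a"
proof -
  obtain V0 g0 where "left_approx C B X V0 g0" using fun_finite X unfolding functorially_finite_def by blast
  then have "\<exists>V a. lapp B X V a \<and> (\<forall>h\<in>H V V. h \<star> a = a \<longrightarrow> iso h)"
    using B_retr by (intro lapp_min_ex[OF B_ob _ X]) auto
  then obtain V a where a: "lapp B X V a" and min: "\<And>h. h \<in> H V V \<Longrightarrow> h \<star> a = a \<Longrightarrow> iso h"
    by blast
  then obtain W b c where t: "tri3 X V W a b c" using tri_first lappD(2) by blast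
  note m = tri3D[OF t]
  have "Ext0 W Y" if Y: "Y \<in> B" for Y
    unfolding Ext0_def
  proof (intro conjI ballI)
    show Yo: "Y \<in> ob C" and "W \<in> ob C" using Y B_ob m by auto
    fix \<xi> assume x: "\<xi> \<in> H W (sh C Y)"
    \<comment> \<open>Dually the extension is pulled back along \<open>b\<close>; the left
      approximation \<open>a\<close> lifts to the middle term, and minimality splits
      \<open>e\<close>, so that \<open>\<xi> b\<close> vanishes.\<close>
    have k: "\<xi> \<star> b \<in> H V (sh C Y)" using x m by blast
    then obtain E s e where tE: "tri3 Y E V s e (\<xi> \<star> b)" using tri_third Yo by blast
    note mE = tri3D[OF tE]
    have E: "E \<in> B" using B_ext[OF tE] lappD(1)[OF a] Y by blast
    have "(\<xi> \<star> b) \<star> a = zr X (sh C Y)" using tri_comp_gf[OF t] x by (simp add: comp_assoc H_iff)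
    then obtain a' where a': "a' \<in> H X E" "a = e \<star> a'" using factor_g[OF tE m(1)] by blast
    then obtain w where w: "w \<in> H V E" "a' = w \<star> a" using lappD(3)[OF a E] by blast
    have ew: "e \<star> w \<in> H V V" using w mE by blast
    have "(e \<star> w) \<star> a = a" using w a' by (simp add: comp_assoc)
    then have i: "iso (e \<star> w)" using min ew by blast
    have "(\<xi> \<star> b) \<star> e \<star> w = zr V (sh C Y)"
      using tri_comp_hg[OF tE, THEN comp_eq_assoc] w mE by (simp add: comp_assoc H_iff)
    then have "\<xi> \<star> b = zr V (sh C Y)" using iso_cancel_right[OF i ew k] by blast
    then obtain z where z: "z \<in> H (sh C X) (sh C Y)" "\<xi> = z \<star> c" using extend_h[OF t x] by blast
    then obtain z' where z': "z' \<in> H X Y" "z = shf z'" using lift_shf m Yo by metis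
    then obtain y where y: "y \<in> H V Y" "z' = y \<star> a" using lappD(3)[OF a Y] by blast
    have "\<xi> = shf y \<star> shf a \<star> c" using z z' y m by (simp add: shf_comp comp_assoc H_iff)
    also have "\<dots> = zr W (sh C Y)" using tri_comp_fh[OF t] y by (simp add: H_iff)
    finally show "\<xi> = zr W (sh C Y)" .
  qed
  then have "W \<in> Bperp" using m by (auto simp: Bperp_def)
  then show ?thesis using t a lappD(1)[OF a] by blast
qed

text \<open>For \<open>W \<rightarrow> V \<rightarrow> X\<close> from the right and \<open>W \<rightarrow> J \<rightarrow> W'\<close> from the left approximation, the maps \<open>W \<rightarrow> V\<close> and
  \<open>W \<rightarrow> J\<close> factor through each other; comparing the triangles splits the identity of \<open>X\<close> into a map through
  \<open>W'\<close> and a map through \<open>V\<close>.\<close>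

lemma decomposition:
  assumes X: "loc X" and J: "\<And>J. J \<in> B \<Longrightarrow> J \<in> Bperp \<Longrightarrow> Ext0 X J"
  shows "X \<in> B \<or> X \<in> Bperp"
proof -
  obtain W V u p h where t: "tri3 W V X u p h" "V \<in> B" "W \<in> Bperp" using cotorsion_right loc_ob[OF X] by blast
  note m = tri3D[OF t(1)]
  obtain I W1 j q r where s: "tri3 W I W1 j q r" "I \<in> B" "W1 \<in> Bperp" "lapp B W I j" using cotorsion_left m(4) by blast
  note n = tri3D[OF s(1)]
  \<comment> \<open>The middle term \<open>I\<close> is an extension of \<open>W1\<close> by
    \<open>W\<close>, both perpendicular to \<open>B\<close>. As it also lies in \<open>B\<close> it
    is a projective of \<open>B\<close>, so the hypothesis on \<open>X\<close> applies to
    it.\<close>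
  have "Ext0 I Y" if Y: "Y \<in> B" for Y
    unfolding Ext0_def
  proof (intro conjI ballI)
    show "I \<in> ob C" "Y \<in> ob C" using n Y B_ob by auto
    fix k assume k: "k \<in> H I (sh C Y)"
    have "k \<star> j = zr W (sh C Y)" using Bperp_Ext[OF t(3) Y] k n Ext0D by blast
    then obtain l where l: "l \<in> H W1 (sh C Y)" "k = l \<star> q" using extend_g[OF s(1) k] by blast
    then have "l = zr W1 (sh C Y)" using Bperp_Ext[OF s(3) Y] Ext0D by blast
    then show "k = zr I (sh C Y)" using l n Y B_ob by (auto simp: H_iff)
  qed
  then have "I \<in> Bperp" using n by (simp add: Bperp_def)
  then have XI: "Ext0 X I" using J s by blast
  obtain v where v: "v \<in> H I V" "u = v \<star> j" using lappD(3)[OF s(4) t(2) m(1)] by blast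
  have "shf j \<star> h \<in> H X (sh C I)" using n m by blast
  then have "shf j \<star> h = zr X (sh C I)" using XI Ext0D by blast
  then obtain w where w: "w \<in> H V I" "j = w \<star> u" using extend_f[OF t(1) n(1)] by blast
  have oW: "un W \<in> H W W" using m by blast
  have "w \<star> u = j \<star> un W" "v \<star> j = u \<star> un W" using v w m n by (simp_all add: H_iff)
  then obtain c d where c: "c \<in> H X W1" "shf (un W) \<star> h = r \<star> c" and d: "d \<in> H W1 X" "shf (un W) \<star> r = h \<star> d"
    using fill[OF t(1) s(1) oW w(1)] fill[OF s(1) t(1) oW v(1)] by blast
  then have hc: "h = r \<star> c" "r = h \<star> d" using m n by (simp_all add: H_iff)
  have uX: "un X \<in> H X X" using m by blast
  have dc: "d \<star> c \<in> H X X" using c d by blast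
  have "h \<star> un X = h \<star> d \<star> c" using hc(1) m comp_eq_assoc[OF hc(2)[symmetric]] by (simp add: H_iff)
  then obtain e where e: "e \<in> H X V" "un X = d \<star> c \<boxplus> p \<star> e" using factor_g_diff[OF t(1) uX dc] by blast
  have "p \<star> e \<in> H X X" using e m by blast
  then have "iso (d \<star> c) \<or> iso (p \<star> e)" using loc_plus[OF X dc] e iso_un[OF m(6)] by metis
  then show ?thesis
    using retr_iso[OF c(1) d(1)] retr_iso[OF e(1) m(2)] Bperp_retr s(3) B_retr t(2) by blast
qed

lemma cluster_tilting_pair:
  assumes T: "ctc (ob C) {T}"
  shows "\<exists>B0 W. B0 \<in> B \<and> W \<in> Bperp \<and> ctc (ob C) {B0, W}"
proof -
  have To: "T \<in> ob C" "Ext0 T T" using T by (auto simp: ctc_def)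
  obtain V W a b c where t: "tri3 T V W a b c" "V \<in> B" "W \<in> Bperp" "lapp B T V a" using cotorsion_left[OF To(1)] by blast
  note m = tri3D[OF t(1)]
  have VW: "Ext0 V W" "Ext0 W V" using Bperp_Ext Bperp_Ext' t by blast+
  have WW: "Ext0 W W" using cone_rigid[OF t(1) To(2) VW(1)] lappD(3)[OF t(4) t(2)] by blast
  \<comment> \<open>Since \<open>Ext(V,W) = 0\<close>, \<open>f\<close> factors through
    \<open>T[1]\<close>. Rigidity of \<open>T\<close> makes the map \<open>V -> T[1]\<close> factor
    through \<open>W\<close>, and the remaining composite \<open>W -> V[1]\<close> vanishes by
    \<open>Ext(W,V) = 0\<close>.\<close>
  have VV: "Ext0 V V"
    unfolding Ext0_def
  proof (intro conjI ballI)
    show "V \<in> ob C" "V \<in> ob C" using m by auto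
    fix f assume f: "f \<in> H V (sh C V)"
    have "shf b \<star> f = zr V (sh C W)" using VW(1) f m Ext0D by blast
    then obtain k where k: "k \<in> H V (sh C T)" "f = neg (shf a) \<star> k" using factor_h[OF rotate[OF t(1)] f] by blast
    have "k \<star> a = zr T (sh C T)" using To(2) k m Ext0D by blast
    then obtain l where l: "l \<in> H W (sh C T)" "k = l \<star> b" using extend_g[OF t(1) k(1)] by blast
    have "neg (shf a) \<star> l = zr W (sh C V)" using VW(2) l m Ext0D by blast
    then show "f = zr V (sh C V)" using k l m by (simp add: comp_eq_assoc H_iff)
  qed
  obtain M i p j q where M: "bip M V W i p j q" using bip_ex m by blast
  have "M \<in> ob C" using bip_retr[OF M] by (simp add: retr_def)
  then have Mo: "M \<in> ob C" "V \<in> Add {M}" "W \<in> Add {M}"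
    using Add_retr[OF bip_retr(1)[OF M] Add_base] Add_retr[OF bip_retr(2)[OF M] Add_base] by auto
  have "V \<in> Add {V, W}" "W \<in> Add {V, W}" using m by (auto intro: Add_base)
  then have "M \<in> Add {V, W}" by (rule bip_Add[OF M])
  then have MM: "Ext0 M M" using Ext0_Add_both[of M "{V, W}" M "{V, W}"] VV VW WW by blast
  have "ctc (ob C) {M}"
  proof (rule ct_criterion[OF T MM])
    fix X x assume X: "Ext0 M X" and x: "x \<in> H T X"
    \<comment> \<open>The obstruction to extending \<open>x\<close> from \<open>T\<close> to
      \<open>V\<close> lies in \<open>Ext(W,X)\<close>.\<close>
    have "Ext0 W X" using Ext0_Add[OF Mo(3)] X Ext0_ob by blast
    then have "shf x \<star> c = zr W (sh C X)" using x m Ext0D by blast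
    then obtain l where "l \<in> H V X" "x = l \<star> a" using extend_f[OF t(1) x] by blast
    then show "x \<in> thru {M} T X" using thru_via Mo m by blast
  qed
  then show ?thesis using ctc_pair[OF M] t by blast
qed

end

text \<open>The object \<open>T\<close> remains available as test object for
  \<open>ct_criterion\<close>, while \<open>W\<close> is fixed once and serves as the common
  complement for every cluster tilting object of \<open>B\<close>.\<close>

locale cluster_tilting_pair = extension_closed_subcategory K C B
  for K :: "('k, 'r) ring_scheme" (structure) and C :: "('o, 'k, 'm, 'c) tri_cat_scheme" and B :: "'o set" +
  fixes T :: 'o and B0 :: 'o and W :: 'o
  assumes T: "ctc (ob C) {T}" and B0: "B0 \<in> B" and W: "W \<in> Bperp" and pair: "ctc (ob C) {B0, W}"
begin

lemma W_ob: "W \<in> ob C" and WW: "Ext0 W W" and B0B0: "Ext0 B0 B0"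
  using pair by (auto simp: ctc_def)

lemma pair_Add: "X \<in> ob C \<Longrightarrow> Ext0 B0 X \<Longrightarrow> Ext0 W X \<Longrightarrow> X \<in> Add {B0, W}"
  using pair by (auto simp: ctc_def)

text \<open>The witness consists of \<open>B0\<close> and those summands of \<open>W\<close> that
  lie in \<open>B\<close>; \<open>B0\<close> alone may miss projectives. An object of
  \<open>B\<close> without extensions with \<open>B0\<close> has none with \<open>W\<close> either,
  so it lies in add of the pair, and its summands coming from \<open>W\<close> are in
  \<open>B\<close>.\<close>

lemma cluster_tilting_ex: "\<exists>S. ctc B {S}"
proof -
  obtain Ws where Ws: "is_dsum C Ws W" "\<forall>Y\<in>set Ws. local_end C Y" using krull_schmidt W_ob by blast
  note w = is_dsumD[OF Ws(1)]
  define L where "L = B0 # filter (\<lambda>X. X \<in> B) Ws"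
  have L: "set L \<subseteq> B" "set L \<subseteq> ob C" using B0 B_ob by (auto simp: L_def)
  then obtain S where S: "is_dsum C L S" using dsum_exists by blast
  have So: "S \<in> ob C" using is_dsumD[OF S] by blast
  have LS: "X \<in> Add {S}" if "X \<in> set L" for X using is_dsumD(4)[OF S that] Add_retr Add_base So by blast
  have "set L \<subseteq> Add {B0, W}"
  proof
    fix X assume "X \<in> set L"
    then have "X = B0 \<or> X \<in> set Ws" by (auto simp: L_def)
    then show "X \<in> Add {B0, W}"
      using Add_base[of B0 "{B0, W}"] Add_base[of W "{B0, W}"] Add_retr w(4) W_ob B0 B_ob by blast
  qed
  then have SA: "S \<in> Add {B0, W}" using dsum_Add_iff[OF S] by blast
  have "S \<in> Add (set L)" using is_dsumD(3)[OF S] So by (simp add: Add_def)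
  then have "S \<in> B" using B_Add L by blast
  moreover have "Ext0 S S"
    using Ext0_Add_both[OF SA SA] WW B0B0 Bperp_Ext[OF W B0] Bperp_Ext'[OF W B0] by blast
  moreover have "X \<in> Add {S}" if X: "X \<in> B" "Ext0 S X" for X
  proof -
    have Xo: "X \<in> ob C" using X B_ob by blast
    have "Ext0 B0 X" using Ext0_Add[OF LS[of B0]] X Xo by (auto simp: L_def)
    moreover have "Ext0 W X" using Bperp_Ext W X by blast
    ultimately have XA: "X \<in> Add {B0, W}" using pair_Add Xo by blast
    show ?thesis
    proof (rule AddI_loc[OF Xo])
      fix R assume R: "loc R" "retr R X"
      then have RB: "R \<in> B" using B_retr X by blast
      have "R \<in> Add {B0, W}" using R XA Add_retr by blast
      then have "retr R B0 \<or> retr R W" using loc_Add R by blast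
      then show "R \<in> Add {S}"
      proof
        assume "retr R B0"
        then show ?thesis using LS[of B0] Add_retr by (auto simp: L_def)
      next
        assume "retr R W"
        moreover have "W \<in> Add (set Ws)" using w by (simp add: Add_def)
        ultimately obtain R' where R': "R' \<in> set Ws" "retr R R'" using Add_retr loc_Add R by blast
        then have "loc R'" using Ws w local_end_iff by blast
        then have i: "isom R R'" using loc_retr_isom R R' by blast
        then have "R' \<in> B" using isom_retr[OF isom_sym[OF i]] B_retr RB by blast
        then have "R' \<in> Add {S}" using LS R' by (simp add: L_def)
        then show ?thesis using R' Add_retr by blast
      qed
    qed
  qed
  ultimately show ?thesis by (auto simp: ctc_def)
qed

text \<open>The two closure hypotheses are what maximal rigid and cluster tilting objects share: all
  projectives are present, and no compatible rigid indecomposable of \<open>B\<close> is missing.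
  They put the cone \<open>Y\<close> of an approximation of \<open>T\<close> into add of
  \<open>Q\<close>, after which \<open>ct_criterion\<close> applies to \<open>Q\<close>.\<close>

lemma extend_rigid:
  assumes R: "R \<in> B" "Ext0 R R" and I: "\<And>J. J \<in> B \<Longrightarrow> J \<in> Bperp \<Longrightarrow> J \<in> Add {R}"
    and S: "\<And>S. loc S \<Longrightarrow> S \<in> B \<Longrightarrow> Ext0 S S \<Longrightarrow> Ext0 R S \<Longrightarrow> S \<in> Add {R}"
  shows "ctc (ob C) {R, W}" and "ctc B {R}"
proof -
  have To: "T \<in> ob C" "Ext0 T T" using T by (auto simp: ctc_def)
  have Ro: "R \<in> ob C" using R B_ob by blast
  obtain Q i p j q where Q: "bip Q R W i p j q" using bip_ex Ro W_ob by blast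
  have "Q \<in> ob C" using bip_retr[OF Q] by (simp add: retr_def)
  then have Qo: "Q \<in> ob C" "R \<in> Add {Q}" "W \<in> Add {Q}"
    using Add_retr[OF bip_retr(1)[OF Q] Add_base] Add_retr[OF bip_retr(2)[OF Q] Add_base] by auto
  have "R \<in> Add {R, W}" "W \<in> Add {R, W}" using Ro W_ob by (auto intro: Add_base)
  then have QA: "Q \<in> Add {R, W}" by (rule bip_Add[OF Q])
  have QQ: "Ext0 Q Q" using Ext0_Add_both[OF QA QA] R WW Bperp_Ext[OF W R(1)] Bperp_Ext'[OF W R(1)] by blast
  obtain V a where a: "lapp (Add {Q}) T V a" using lapp_add_ex Qo To by blast
  then obtain Y b c where t: "tri3 T V Y a b c" using tri_first lappD(2) by blast
  note m = tri3D[OF t]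
  have V: "V \<in> Add {Q}" using lappD(1)[OF a] .
  have VV: "Ext0 V V" "Ext0 V Q" using Ext0_Add_both[OF V V] Ext0_Add[OF V Qo(1)] QQ by blast+
  have YQ: "Ext0 Y Q" using lapp_cokernel[OF a t Add_base VV(2)] Qo by blast
  have YV: "Ext0 V Y" using lapp_cokernel[OF a t V VV(1)] Ext0_sym by blast
  have YY: "Ext0 Y Y" by (rule cone_rigid[OF t To(2) YV]) (use lappD(3)[OF a V] in blast)
  have YA: "Y \<in> Add {Q}"
  proof (rule AddI_loc[OF m(6)])
    fix X assume X: "loc X" "retr X Y"
    have XX: "Ext0 X X" using Ext0_retr_right[OF Ext0_retr[OF YY X(2)] X(2)] .
    have XQ: "Ext0 X Q" using Ext0_retr[OF YQ X(2)] .
    have XR: "Ext0 X R" "Ext0 X W"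
      using Ext0_Add_right[OF Qo(2) loc_ob[OF X(1)]] Ext0_Add_right[OF Qo(3) loc_ob[OF X(1)]] XQ by blast+
    have "Ext0 X J" if "J \<in> B" "J \<in> Bperp" for J
      using Ext0_Add_right[OF I[OF that] loc_ob[OF X(1)]] XR by blast
    then have "X \<in> B \<or> X \<in> Bperp" using decomposition X by blast
    then have "X \<in> Add {R} \<or> X \<in> Add {W}"
    proof
      assume "X \<in> B"
      then show ?thesis using S X XX Ext0_sym XR by blast
    next
      \<comment> \<open>Here the known pair decides: a summand of \<open>B0\<close> that is
        perpendicular to \<open>B\<close> is a projective of \<open>B\<close>, hence already in add
        of \<open>R\<close>.\<close>
      assume XB: "X \<in> Bperp"
      then have "X \<in> Add {B0, W}" using pair_Add loc_ob[OF X(1)] Ext0_sym[OF XR(2)] Bperp_Ext' B0 by blast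
      then have "retr X B0 \<or> retr X W" using loc_Add X by blast
      then show ?thesis using B_retr[OF _ B0] I[of X] XB Add_retr Add_base W_ob by blast
    qed
    then show "X \<in> Add {Q}" using Add_trans[of X _ "{Q}"] Qo by blast
  qed
  have "ctc (ob C) {Q}"
  proof (rule ct_criterion[OF T QQ])
    fix X x assume X: "Ext0 Q X" and x: "x \<in> H T X"
    have "Ext0 Y X" using Ext0_Add[OF YA] X Ext0_ob by blast
    then have "shf x \<star> c = zr Y (sh C X)" using x m Ext0D by blast
    then obtain l where "l \<in> H V X" "x = l \<star> a" using extend_f[OF t x] by blast
    then show "x \<in> thru {Q} T X" using thru_via V m by blast
  qed
  then show RW: "ctc (ob C) {R, W}" using ctc_pair[OF Q] by blast
  \<comment> \<open>Extensions with \<open>W\<close> are automatic for objects of \<open>B\<close>,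
    so the property in \<open>C\<close> applies; a summand of \<open>W\<close> inside
    \<open>B\<close> is a projective and is absorbed by \<open>R\<close>.\<close>
  have "X \<in> Add {R}" if X: "X \<in> B" "Ext0 R X" for X
  proof -
    have Xo: "X \<in> ob C" using X B_ob by blast
    have XA: "X \<in> Add {R, W}" using RW Xo X Bperp_Ext[OF W] by (auto simp: ctc_def)
    show ?thesis
    proof (rule AddI_loc[OF Xo])
      fix L assume L: "loc L" "retr L X"
      then have "retr L R \<or> retr L W" using loc_Add XA Add_retr by blast
      then show "L \<in> Add {R}" using Add_retr Add_base Ro I[of L] Bperp_retr[OF _ W] B_retr[OF L(2) X(1)] by blast
    qed
  qed
  then show "ctc B {R}" using R by (auto simp: ctc_def)
qed

lemma ctc_I: "ctc B \<R> \<Longrightarrow> J \<in> B \<Longrightarrow> J \<in> Bperp \<Longrightarrow> J \<in> Add \<R>"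
  using Bperp_Ext' unfolding ctc_def by blast

lemma ctc_extend: "ctc B {R} \<Longrightarrow> ctc (ob C) {R, W}"
  by (rule extend_rigid(1)) (auto simp: ctc_def intro: Bperp_Ext')

text \<open>Both closure hypotheses of \<open>extend_rigid\<close> come from one observation: for a
  compatible rigid \<open>S\<close> the class \<open>Add {R, S}\<close> is a rigid subcategory, so
  maximality makes it equal to \<open>Add {R}\<close>.\<close>

lemma maximal_rigid_ctc:
  assumes R: "maximal_rigid C B R"
  shows "ctc B {R}"
proof (rule extend_rigid(2))
  show RB: "R \<in> B" using R by (simp add: maximal_rigid_def)
  then have Ro: "R \<in> ob C" using B_ob by blast
  then have a: "add_of C {R} = Add {R}" by (simp add: add_of_eq)
  have "R \<in> Add {R}" using Add_base Ro by blast
  then show RR: "Ext0 R R"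
    using R ext_vanishes_iff Ro unfolding maximal_rigid_def rigid_subcategory_def a by blast
  have E: "S \<in> Add {R}" if S: "S \<in> B" "Ext0 S S" "Ext0 R S" for S
  proof -
    have So: "S \<in> ob C" using S B_ob by blast
    have "rigid_subcategory C B (Add {R, S})"
      unfolding rigid_subcategory_def
    proof (intro conjI ballI)
      show "Add {R, S} \<subseteq> B" using B_Add RB S by blast
      show "ext_vanishes C X Y" if "X \<in> Add {R, S}" "Y \<in> Add {R, S}" for X Y
        using Ext0_Add_both[OF that] RR S Ext0_sym ext_vanishes_iff Add_ob that by blast
      show "subcategory C (Add {R, S})"
        unfolding subcategory_def
      proof (intro conjI ballI allI impI)
        show "Add {R, S} \<subseteq> ob C" by (rule Add_sub)
        show "iso_class C X \<subseteq> Add {R, S}" if "X \<in> Add {R, S}" for X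
        proof
          fix Y assume "Y \<in> iso_class C X"
          then have "Y \<in> ob C" "isomorphic C X Y" by (auto simp: iso_class_def)
          then have "isom X Y" using isomorphic_iff Add_ob that by blast
          then show "Y \<in> Add {R, S}" using isom_retr[OF isom_sym] Add_retr that by blast
        qed
        show "V \<in> Add {R, S}" if "set Xs \<subseteq> Add {R, S}" "is_dsum C Xs V" for Xs V
          using that dsum_Add_iff by blast
        show "X \<in> Add {R, S}" "Y \<in> Add {R, S}" if "V \<in> Add {R, S}" "is_dsum C [X, Y] V" for X Y V
          using that dsum_Add_iff[OF that(2), of "{R, S}"] by auto
      qed
    qed
    moreover have "Add {R} \<subseteq> Add {R, S}" using Add_mono[of "{R}" "{R, S}"] by blast
    ultimately have "Add {R, S} = Add {R}" using R unfolding maximal_rigid_def a by blast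
    then show ?thesis using Add_base[of S "{R, S}"] So by blast
  qed
  show "J \<in> Add {R}" if "J \<in> B" "J \<in> Bperp" for J using E that RB Bperp_Ext Bperp_Ext' by blast
  show "S \<in> Add {R}" if "loc S" "S \<in> B" "Ext0 S S" "Ext0 R S" for S using E that by blast
qed

lemma dsum_ctc:
  assumes R: "ctc B {R}" and S: "is_dsum C [R, W] S"
  shows "ctc (ob C) {S}"
proof -
  obtain i p j q where "bip S R W i p j q" using is_dsum2 S by blast
  then show ?thesis using ctc_pair ctc_extend[OF R] by blast
qed

end

section \<open>Mutation\<close>

context k_category
begin

text \<open>If \<open>x\<close> inverts \<open>1 + b a\<close>, then \<open>1 - a x b\<close>
  inverts \<open>1 + a b\<close>. This carries minimality from one end of an exchange triangle to
  the other.\<close>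

lemma iso_swap:
  assumes a: "a \<in> H X Y" and b: "b \<in> H Y X" and i: "iso (un X \<boxplus> b \<star> a)"
  shows "iso (un Y \<boxplus> a \<star> b)"
proof -
  have ob: "X \<in> ob C" "Y \<in> ob C" using H_ob[OF a] by auto
  have m: "un X \<boxplus> b \<star> a \<in> H X X" using a b ob by blast
  obtain x where x: "x \<in> H X X" "x \<star> (un X \<boxplus> b \<star> a) = un X" "(un X \<boxplus> b \<star> a) \<star> x = un X"
    using isoE[OF i m] by blast
  have l: "x \<boxplus> x \<star> b \<star> a = un X" using x(1,2) by (simp add: comp_plus H_iff)
  have r: "x \<boxplus> b \<star> a \<star> x = un X" using x(1,3) by (simp add: plus_comp comp_assoc H_iff)
  have axb: "a \<star> x \<star> b \<in> H Y Y" "a \<star> b \<in> H Y Y" "a \<star> x \<star> b \<star> a \<star> b \<in> H Y Y" "a \<star> b \<star> a \<star> x \<star> b \<in> H Y Y"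
    using a b x by blast+
  have "a \<star> x \<star> b \<boxplus> a \<star> x \<star> b \<star> a \<star> b = a \<star> (x \<boxplus> x \<star> b \<star> a) \<star> b"
    by (simp add: arrow_algebra)
  also have "\<dots> = a \<star> b" unfolding l using b by (simp add: H_iff)
  finally have l': "a \<star> x \<star> b \<boxplus> a \<star> x \<star> b \<star> a \<star> b = a \<star> b" .
  have "a \<star> x \<star> b \<boxplus> a \<star> b \<star> a \<star> x \<star> b = a \<star> (x \<boxplus> b \<star> a \<star> x) \<star> b"
    by (simp add: arrow_algebra)
  also have "\<dots> = a \<star> b" unfolding r using b by (simp add: H_iff)
  finally have r': "a \<star> x \<star> b \<boxplus> a \<star> b \<star> a \<star> x \<star> b = a \<star> b" .
  define y where "y = un Y \<boxplus> neg (a \<star> x \<star> b)"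
  have y: "y \<in> H Y Y" unfolding y_def using axb ob by blast
  define z where "z = un Y \<boxplus> a \<star> b"
  have z: "z \<in> H Y Y" unfolding z_def using axb ob by blast
  have "(a \<star> x \<star> b) \<star> z = a \<star> x \<star> b \<boxplus> a \<star> x \<star> b \<star> a \<star> b"
    unfolding z_def using a b x(1) by (simp add: comp_plus comp_assoc H_iff)
  then have "(a \<star> x \<star> b) \<star> z = a \<star> b" by (simp only: l')
  then have "y \<star> z = z \<boxplus> neg (a \<star> b)" unfolding y_def using z by (simp only: plus_comp neg_comp un_comp H_iff)
  then have "y \<star> (un Y \<boxplus> a \<star> b) = (un Y \<boxplus> a \<star> b) \<boxplus> neg (a \<star> b)" by (simp only: z_def)
  also have "\<dots> = un Y \<boxplus> (a \<star> b \<boxplus> neg (a \<star> b))" by (simp add: plus_assoc)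
  finally have 1: "y \<star> (un Y \<boxplus> a \<star> b) = un Y" using axb(2) ob by (simp add: plus_neg H_iff)
  have "z \<star> a \<star> x \<star> b = a \<star> x \<star> b \<boxplus> a \<star> b \<star> a \<star> x \<star> b"
    unfolding z_def using a b x(1) by (simp add: plus_comp comp_assoc H_iff)
  then have "z \<star> a \<star> x \<star> b = a \<star> b" by (simp only: r')
  then have "z \<star> y = z \<boxplus> neg (a \<star> b)" unfolding y_def using z by (simp only: comp_plus comp_neg comp_un H_iff)
  then have "(un Y \<boxplus> a \<star> b) \<star> y = (un Y \<boxplus> a \<star> b) \<boxplus> neg (a \<star> b)" by (simp only: z_def)
  also have "\<dots> = un Y \<boxplus> (a \<star> b \<boxplus> neg (a \<star> b))" by (simp add: plus_assoc)
  finally have 2: "(un Y \<boxplus> a \<star> b) \<star> y = un Y" using axb(2) ob by (simp add: plus_neg H_iff)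
  show ?thesis using isoI[OF _ y 1 2] a b ob by blast
qed

end

context two_CY_category
begin

text \<open>Only one exchange triangle is recorded, the one ending in \<open>M\<close>; the second
  one is the same relation with the arguments swapped. Symmetry is not evident and is proved
  separately.\<close>

definition exch :: "'o set \<Rightarrow> 'o \<Rightarrow> 'o \<Rightarrow> bool" where
  "exch \<U> M N \<longleftrightarrow> (\<exists>V f g h. tri3 N V M f g h \<and>
     rapp (Add \<U>) V M g \<and> (\<forall>k\<in>H V V. g \<star> k = g \<longrightarrow> iso k) \<and>
     lapp (Add \<U>) N V f \<and> (\<forall>k\<in>H V V. k \<star> f = f \<longrightarrow> iso k))"

text \<open>In a minimal presentation \<open>T1 \<rightarrow> T0 \<rightarrow> X\<close> of a rigid object the terms have no common summand
  (Dehy and Keller): rigidity gives \<open>p c = p a u\<close> for the map \<open>c : T1 \<rightarrow> S \<rightarrow> T0\<close>, and minimality of \<open>p\<close>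
  makes \<open>a u\<close>, hence \<open>u\<close>, a split monomorphism on \<open>S\<close>, contradicting minimality again.\<close>

lemma no_common_summand:
  assumes X: "Ext0 X X" and p: "rapp U T0 X p" and min: "\<And>h. h \<in> H T0 T0 \<Longrightarrow> p \<star> h = p \<Longrightarrow> iso h"
    and t: "tri3 T1 T0 X u p d" and S: "loc S" "retr S T0" "retr S T1"
  shows False
proof -
  note m = tri3D[OF t]
  obtain i q where i: "i \<in> H S T0" "q \<in> H T0 S" "q \<star> i = un S" using S(2) by (auto simp: retr_def)
  obtain j r where j: "j \<in> H S T1" "r \<in> H T1 S" "r \<star> j = un S" using S(3) by (auto simp: retr_def)
  have pir: "p \<star> i \<star> r \<in> H T1 X" using m i j by blast
  then have "shf (p \<star> i \<star> r) \<star> d = zr X (sh C X)" using X m Ext0D by blast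
  then obtain x where x: "x \<in> H T0 X" "p \<star> i \<star> r = x \<star> u" using extend_f[OF t pir] by blast
  then obtain a where a: "a \<in> H T0 T0" "x = p \<star> a" using rappD(3)[OF p rappD(1)[OF p]] by blast
  have pu: "p \<star> u = zr T1 X" using tri_comp_gf[OF t] .
  have "p \<star> i = (p \<star> i \<star> r) \<star> j" using i j m by (simp add: comp_assoc H_iff)
  also have "\<dots> = p \<star> a \<star> u \<star> j" using x a by (simp add: comp_assoc)
  finally have pi: "p \<star> i = p \<star> a \<star> u \<star> j" .
  define e where "e = a \<star> u \<star> j"
  have e: "e \<in> H S T0" "p \<star> e = p \<star> i" unfolding e_def using a j m pi by auto
  \<comment> \<open>On the summand \<open>S\<close> the inclusion \<open>i\<close> is replaced by
    \<open>e\<close>, which has the same image under \<open>p\<close>. So \<open>p h = p\<close>,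
    minimality inverts \<open>h\<close>, and \<open>e\<close> becomes a split monomorphism.\<close>
  define h where "h = un T0 \<boxplus> neg (i \<star> q) \<boxplus> e \<star> q"
  have h: "h \<in> H T0 T0" unfolding h_def using i e m by blast
  have piq: "p \<star> i \<star> q \<in> H T0 X" using i m by blast
  have "p \<star> h = p \<boxplus> neg (p \<star> i \<star> q) \<boxplus> p \<star> i \<star> q"
    unfolding h_def using m by (simp add: comp_plus comp_neg comp_eq_assoc[OF e(2)] comp_assoc H_iff)
  also have "\<dots> = p" using piq m by (simp add: plus_assoc neg_plus H_iff)
  finally have "iso h" using min h by blast
  then obtain y where y: "y \<in> H T0 T0" "y \<star> h = un T0" using isoE h by metis
  have "h \<star> i = i \<boxplus> neg i \<boxplus> e"
    unfolding h_def using i e m by (simp add: plus_comp neg_comp comp_assoc H_iff)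
  also have "\<dots> = e" using i e m by (simp add: plus_neg H_iff)
  finally have hi: "h \<star> i = e" .
  have "y \<star> e = (y \<star> h) \<star> i" using hi by (simp add: comp_assoc)
  also have "\<dots> = i" using y i by (simp add: H_iff)
  finally have ye: "y \<star> e = i" .
  define w where "w = q \<star> y \<star> a"
  have w: "w \<in> H T0 S" "w \<star> u \<star> j = un S"
    unfolding w_def using i y a ye by (auto simp: comp_assoc e_def)
  \<comment> \<open>Now \<open>S\<close> splits off \<open>T0\<close> inside the image of
    \<open>u\<close>. Removing it does not affect \<open>p\<close> because \<open>p u = 0\<close>,
    yet \<open>k\<close> annihilates \<open>u j\<close> and is invertible by minimality.\<close>
  define k where "k = un T0 \<boxplus> neg (u \<star> j \<star> w)"
  have k: "k \<in> H T0 T0" unfolding k_def using w j m by blast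
  have "p \<star> k = p" unfolding k_def using m j w pu[THEN comp_eq_assoc] by (simp add: comp_plus comp_neg comp_assoc H_iff)
  then have "iso k" using min k by blast
  then obtain z where z: "z \<in> H T0 T0" "z \<star> k = un T0" using isoE k by metis
  have uj: "u \<star> j \<in> H S T0" using m j by blast
  have "k \<star> u \<star> j = zr S T0" unfolding k_def using uj j m w(1)
    by (simp add: plus_comp neg_comp comp_assoc w(2) plus_neg H_iff)
  then have "z \<star> k \<star> u \<star> j = zr S T0" using z(1) by (simp add: H_iff)
  moreover have "z \<star> k \<star> u \<star> j = u \<star> j" using comp_eq_assoc[OF z(2)] uj by (simp add: H_iff)
  ultimately have "u \<star> j = zr S T0" by simp
  then have "w \<star> u \<star> j = zr S S" using w(1) by (simp add: H_iff)
  then show False using w S(1) by (simp add: loc_def)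
qed

lemma thru_all:
  assumes s: "\<And>S s. S \<in> \<S> \<Longrightarrow> s \<in> H S X \<Longrightarrow> s \<in> thru \<R> S X" and T: "T \<in> Add \<S>" and t: "t \<in> H T X"
  shows "t \<in> thru \<R> T X"
proof -
  have "t \<star> e \<in> thru \<R> T X" if "e \<in> thru \<S> T T" for e
    using that
  proof (induction rule: thru_induct)
    case zero
    then show ?case using t thru_zr[of T X \<R>] H_ob[OF t] by (simp add: H_iff)
  next
    case (step e S a b)
    have "t \<star> b \<in> H S X" using t step by blast
    then have "t \<star> b \<in> thru \<R> S X" using s step by blast
    then have "(t \<star> b) \<star> a \<in> thru \<R> T X" using thru_comp_right step by blast
    then show ?case using step.IH thru_plus by (simp add: comp_plus comp_assoc)
  qed
  then have "t \<star> un T \<in> thru \<R> T X" using T by (simp add: Add_def)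
  then show ?thesis using t by (simp add: H_iff)
qed

end

text \<open>The class plays the part of a cluster with one element removed. The object
  \<open>U0\<close> with the same additive closure is there to supply approximations, which are
  known for add of a single object.\<close>

locale almost_complete = two_CY_category K C
  for K :: "('k, 'r) ring_scheme" (structure) and C :: "('o, 'k, 'm, 'c) tri_cat_scheme" +
  fixes \<U> :: "'o set" and U0 :: 'o
  assumes U_ob: "\<U> \<subseteq> ob C" and U0: "U0 \<in> ob C" "\<And>X. X \<in> Add {U0} \<longleftrightarrow> X \<in> Add \<U>"
    and UU: "\<And>X Y. X \<in> \<U> \<Longrightarrow> Y \<in> \<U> \<Longrightarrow> Ext0 X Y"
begin

definition compl :: "'o \<Rightarrow> bool" where
  "compl M \<longleftrightarrow> loc M \<and> M \<notin> Add \<U> \<and> Ext0 M M \<and> (\<forall>S\<in>\<U>. Ext0 S M)"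

lemma Add_Ext: "X \<in> Add \<U> \<Longrightarrow> Y \<in> Add \<U> \<Longrightarrow> Ext0 X Y"
  using Ext0_Add_both UU by blast

lemma compl_Ext: "compl M \<Longrightarrow> X \<in> Add \<U> \<Longrightarrow> Ext0 X M"
  using Ext0_Add[of X \<U> M] loc_ob unfolding compl_def by blast

lemma compl_Ext': "compl M \<Longrightarrow> X \<in> Add \<U> \<Longrightarrow> Ext0 M X"
  using compl_Ext Ext0_sym by blast

lemma compl_not_iso: "compl M \<Longrightarrow> V \<in> Add \<U> \<Longrightarrow> a \<in> H M V \<Longrightarrow> b \<in> H V M \<Longrightarrow> \<not> iso (b \<star> a)"
  using Add_via unfolding compl_def by blast

text \<open>An idempotent of \<open>N\<close> acts on the triangle \<open>N \<rightarrow> V \<rightarrow> M\<close>; if it acts on the local object \<open>M\<close> by a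
  non-isomorphism \<open>e'\<close>, then \<open>e'\<close> factors through \<open>V\<close>, because \<open>e' (1 - e')\<close> does.\<close>

lemma idem_factors:
  assumes t: "tri3 N V M f g h" and M: "loc M"
    and e: "e \<in> H N N" "e \<star> e = e" and e': "e' \<in> H M M" "shf e \<star> h = h \<star> e'" "\<not> iso e'"
  shows "\<exists>l\<in>H V N. e = l \<star> f"
proof -
  note m = tri3D[OF t]
  define d where "d = un M \<boxplus> neg e'"
  have d: "d \<in> H M M" unfolding d_def using e' m by blast
  have "\<not> iso (neg e')" using e' iso_neg_iff by (simp add: H_iff)
  then have "iso d" unfolding d_def using loc_one_plus[OF M, of "neg e'"] e' by blast
  then obtain x where x: "x \<in> H M M" "d \<star> x = un M" using isoE d by metis
  have ee: "e' \<star> e' \<in> H M M" using e' by blast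
  have "h \<star> e' \<star> e' = shf e \<star> h \<star> e'" using e'(2)[symmetric, THEN comp_eq_assoc] by (simp add: comp_assoc)
  also have "\<dots> = shf e \<star> shf e \<star> h" using e'(2) by simp
  also have "\<dots> = shf (e \<star> e) \<star> h" using e(1) by (simp add: shf_comp comp_assoc H_iff)
  also have "\<dots> = h \<star> e'" using e e' by simp
  finally obtain k where k: "k \<in> H M V" "e' \<star> e' = e' \<boxplus> g \<star> k" using factor_g_diff[OF t ee e'(1)] by blast
  have gk: "g \<star> k \<in> H M M" using k m by blast
  have "e' \<star> d = e' \<boxplus> neg (e' \<boxplus> g \<star> k)" unfolding d_def using e' m by (simp add: comp_plus comp_neg k(2) H_iff)
  also have "\<dots> = neg (g \<star> k)" using e' gk by (simp add: neg_distrib plus_neg2 H_iff)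
  finally have ed: "e' \<star> d = neg (g \<star> k)" .
  have "e' = (e' \<star> d) \<star> x" using x e' by (simp add: comp_assoc H_iff)
  then have "h \<star> e' = h \<star> (neg (g \<star> k)) \<star> x" using ed by simp
  also have "\<dots> = neg ((h \<star> g) \<star> k \<star> x)" by (simp add: comp_neg neg_comp comp_assoc)
  also have "\<dots> = zr M (sh C N)" using tri_comp_hg[OF t] k x m by (simp add: H_iff)
  finally have "shf e \<star> h = zr M (sh C N)" using e' by simp
  then show ?thesis using extend_f[OF t e(1)] by blast
qed

text \<open>The new complement is the cocone of a minimal right approximation of \<open>M\<close>.
  Its orthogonality to the class and its rigidity are the kernel lemmas; what needs work is left
  minimality and indecomposability, both of which rest on \<open>M\<close> being local and outside
  add of the class.\<close>

lemma exchange_ex: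
  assumes M: "compl M"
  shows "\<exists>N. compl N \<and> exch \<U> M N \<and> \<not> Ext0 M N"
proof -
  have Mo: "loc M" "M \<in> ob C" "Ext0 M M" using M loc_ob by (auto simp: compl_def)
  have AU: "Add {U0} = Add \<U>" using U0 by blast
  obtain V g where g: "rapp (Add \<U>) V M g" and min: "\<And>k. k \<in> H V V \<Longrightarrow> g \<star> k = g \<Longrightarrow> iso k"
    using rapp_add_ex[OF U0(1) Mo(2)] unfolding AU by blast
  have V: "V \<in> Add \<U>" using rappD(1)[OF g] .
  obtain N f h where t: "tri3 N V M f g h" using tri_second rappD(2)[OF g] by blast
  note m = tri3D[OF t]
  have N: "Ext0 A N" if "A \<in> Add \<U>" for A using rapp_kernel[OF g t that Add_Ext[OF that V]] .
  have NN: "Ext0 N N"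
    by (rule cocone_rigid[OF t Mo(3)]) (use N[OF V] Ext0_sym rappD(3)[OF g V] in blast)+
  \<comment> \<open>If \<open>h\<close> vanished, \<open>M\<close> would be a retract of
    \<open>V\<close>. The resulting nonzero extension is part of the conclusion because it later
    forces the new object into \<open>B\<close>.\<close>
  have h0: "h \<noteq> zr M (sh C N)"
  proof
    assume "h = zr M (sh C N)"
    then have "h \<star> un M = zr M (sh C N)" using m by simp
    then obtain l where "l \<in> H M V" "un M = g \<star> l" using factor_g[OF t, of "un M"] m by blast
    then show False using compl_not_iso[OF M V] m iso_un by metis
  qed
  then have MN: "\<not> Ext0 M N" using Ext0D m by blast
  then have NU: "N \<notin> Add \<U>" using compl_Ext'[OF M] by blast
  have f: "lapp (Add \<U>) N V f"
    unfolding lapp_def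
  proof (intro conjI ballI V m)
    fix X k assume X: "X \<in> Add \<U>" "k \<in> H N X"
    have "shf k \<star> h = zr M (sh C X)" using compl_Ext'[OF M X(1)] X m Ext0D by blast
    then show "\<exists>l\<in>H V X. k = l \<star> f" using extend_f[OF t X(2)] by blast
  qed
  \<comment> \<open>Here \<open>k = 1 + l g\<close>. On the local object \<open>M\<close> the map
    \<open>g l\<close> is not invertible, so \<open>1 + g l\<close> is, and \<open>iso_swap\<close>
    transfers this to \<open>k\<close>.\<close>
  have lmin: "iso k" if k: "k \<in> H V V" "k \<star> f = f" for k
  proof -
    have "k \<star> f = un V \<star> f" using k m by (simp add: H_iff)
    then obtain l where l: "l \<in> H M V" "k = un V \<boxplus> l \<star> g" using extend_g_diff[OF t k(1), of "un V"] m by blast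
    have "g \<star> l \<in> H M M" using l m by blast
    then have "iso (un M \<boxplus> g \<star> l)" using loc_one_plus[OF Mo(1)] compl_not_iso[OF M V l(1) m(2)] by blast
    then show ?thesis using iso_swap[OF l(1) m(2)] l by simp
  qed
  have "indecomposable C N"
    unfolding indecomposable_def is_zero_ob_iff
  proof (intro conjI allI impI)
    show "N \<in> ob C" by (rule m)
    show "\<not> zob N"
    proof
      assume "zob N"
      then have "un N \<in> thru \<U> N N" using thru_zr[of N N \<U>] by (simp add: zob_def)
      then show False using NU m by (simp add: Add_def)
    qed
    fix N1 N2 assume "is_dsum C [N1, N2] N"
    then obtain i p j q where b: "bip N N1 N2 i p j q" using is_dsum2 by blast
    \<comment> \<open>Endomorphisms of \<open>N\<close> extend to \<open>V\<close> by the left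
      approximation property and so induce endomorphisms of \<open>M\<close>.\<close>
    have E: "\<exists>e'\<in>H M M. shf e \<star> h = h \<star> e'" if e: "e \<in> H N N" for e
    proof -
      obtain e1 where "e1 \<in> H V V" "f \<star> e = e1 \<star> f" using lappD(3)[OF f V, of "f \<star> e"] e m by blast
      then show ?thesis using fill[OF t t e] by metis
    qed
    \<comment> \<open>If the idempotent of \<open>N1\<close> induces a non-isomorphism, it factors
      through \<open>V\<close>, so \<open>N1\<close> is in add of the class and \<open>f i\<close>
      embeds it as a summand of \<open>V\<close> killed by \<open>g\<close>. Minimality of
      \<open>g\<close> leaves only \<open>N1 = 0\<close>.\<close>
    have Z: "zob N1" if b: "bip N N1 N2 i p j q" and e': "e' \<in> H M M" "shf (i \<star> p) \<star> h = h \<star> e'" "\<not> iso e'"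
      for N1 N2 i p j q e'
    proof -
      have i: "i \<in> H N1 N" "p \<in> H N N1" "p \<star> i = un N1" using b by (auto simp: bip_def)
      have N1: "N1 \<in> ob C" using i H_ob by blast
      have ip: "i \<star> p \<in> H N N" "(i \<star> p) \<star> i \<star> p = i \<star> p"
        using i by (auto simp: comp_assoc i(3)[THEN comp_eq_assoc] H_iff)
      obtain l where l: "l \<in> H V N" "i \<star> p = l \<star> f" using idem_factors[OF t Mo(1) ip e'] by blast
      have "un N1 = p \<star> (i \<star> p) \<star> i" using i by (simp add: comp_assoc i(3)[THEN comp_eq_assoc] H_iff)
      also have "\<dots> = (p \<star> l) \<star> f \<star> i" using l by (simp add: comp_assoc)
      finally have "un N1 \<in> thru \<U> N1 N1" using thru_via[OF V, of "f \<star> i" N1 "p \<star> l"] i l m by auto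
      then have "N1 \<in> Add \<U>" using N1 by (simp add: Add_def)
      then obtain x where x: "x \<in> H V N1" "p = x \<star> f" using lappD(3)[OF f _ i(2)] by blast
      have xfi: "x \<star> f \<star> i = un N1" using x i by (simp add: comp_assoc)
      define k where "k = un V \<boxplus> neg (f \<star> i \<star> x)"
      have k: "k \<in> H V V" unfolding k_def using x i m by blast
      have "g \<star> k = g" unfolding k_def using m i x tri_comp_gf[OF t, THEN comp_eq_assoc]
        by (simp add: comp_plus comp_neg comp_assoc H_iff)
      then obtain z where z: "z \<in> H V V" "z \<star> k = un V" using min k isoE by metis
      have fi: "f \<star> i \<in> H N1 V" using i m by blast
      have "k \<star> f \<star> i = zr N1 V" unfolding k_def using fi i m x(1)
        by (simp add: plus_comp neg_comp comp_assoc xfi plus_neg H_iff)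
      then have "z \<star> k \<star> f \<star> i = zr N1 V" using z(1) by (simp add: H_iff)
      moreover have "z \<star> k \<star> f \<star> i = f \<star> i" using comp_eq_assoc[OF z(2)] fi by (simp add: H_iff)
      ultimately have "x \<star> f \<star> i = zr N1 N1" using x(1) by (simp add: H_iff)
      then show ?thesis using xfi N1 by (simp add: zob_def)
    qed
    have ip: "i \<star> p \<in> H N N" "j \<star> q \<in> H N N" "p \<star> j = zr N2 N1" using b by (auto simp: bip_def)
    obtain e1 e2 where e: "e1 \<in> H M M" "shf (i \<star> p) \<star> h = h \<star> e1" "e2 \<in> H M M" "shf (j \<star> q) \<star> h = h \<star> e2"
      using E ip by blast
    \<comment> \<open>The two idempotents are orthogonal, so \<open>h e1 e2 = 0\<close> and
      \<open>e1 e2\<close> factors through \<open>V\<close>; it cannot be invertible.\<close>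
    have "\<not> (iso e1 \<and> iso e2)"
    proof
      assume "iso e1 \<and> iso e2"
      then have i: "iso (e1 \<star> e2)" using iso_comp e by blast
      have ee: "e1 \<star> e2 \<in> H M M" using e by blast
      have pq: "(i \<star> p) \<star> j \<star> q = zr N N" using b by (simp add: bip_def comp_assoc comp_eq_assoc[OF ip(3)] H_iff)
      have "h \<star> e1 \<star> e2 = (shf (i \<star> p) \<star> h) \<star> e2" using e(2) by (simp add: comp_assoc)
      also have "\<dots> = shf (i \<star> p) \<star> shf (j \<star> q) \<star> h" using e(4) by (simp add: comp_assoc)
      also have "\<dots> = shf ((i \<star> p) \<star> j \<star> q) \<star> h"
        using ip by (simp only: shf_comp H_iff comp_assoc[of "shf _" "shf _"])
      also have "\<dots> = zr M (sh C N)" unfolding pq using m by (simp add: H_iff)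
      finally obtain k where "k \<in> H M V" "e1 \<star> e2 = g \<star> k" using factor_g[OF t ee] by blast
      then show False using i compl_not_iso[OF M V _ m(2)] by simp
    qed
    then show "zob N1 \<or> zob N2" using Z[OF b e(1,2)] Z[OF bip_sym[OF b] e(3,4)] by blast
  qed
  then have "compl N" using NU NN N Add_base U_ob unfolding compl_def indecomposable_iff by blast
  moreover have "exch \<U> M N" unfolding exch_def using t g min f lmin by blast
  ultimately show ?thesis using MN by blast
qed

lemma exch_transport:
  assumes e: "exch \<U> X L" and i: "isom L M"
  shows "exch \<U> X M"
proof -
  obtain V f g h where t: "tri3 L V X f g h" and g: "rapp (Add \<U>) V X g" "\<forall>k\<in>H V V. g \<star> k = g \<longrightarrow> iso k"
    and f: "lapp (Add \<U>) L V f" "\<forall>k\<in>H V V. k \<star> f = f \<longrightarrow> iso k" using e unfolding exch_def by blast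
  note m = tri3D[OF t]
  obtain a b where a: "a \<in> H L M" "iso a" "b \<in> H M L" "b \<star> a = un L" "a \<star> b = un M"
    using i unfolding isom_def by (metis isoE)
  have fb: "f \<star> b \<in> H M V" "shf a \<star> h \<in> H X (sh C M)" using m a by blast+
  have "tri3 M V X (f \<star> b) g (shf a \<star> h)"
  proof (rule tri3_iso[OF t fb(1) m(2) fb(2) a(1)])
    show "un V \<in> H V V" "un X \<in> H X X" "iso a" "iso (un V)" "iso (un X)" using m iso_un a by auto
    show "un V \<star> f = (f \<star> b) \<star> a" "un X \<star> g = g \<star> un V" "shf a \<star> h = (shf a \<star> h) \<star> un X"
      using m a fb by (simp_all add: comp_assoc H_iff)
  qed
  moreover have "lapp (Add \<U>) M V (f \<star> b)"
    unfolding lapp_def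
  proof (intro conjI ballI lappD(1)[OF f(1)] fb)
    fix A k assume A: "A \<in> Add \<U>" "k \<in> H M A"
    then have "k \<star> a \<in> H L A" using a by blast
    then obtain l where l: "l \<in> H V A" "k \<star> a = l \<star> f" using lappD(3)[OF f(1) A(1)] by blast
    have "k = (k \<star> a) \<star> b" using a A by (simp add: comp_assoc H_iff)
    then show "\<exists>l\<in>H V A. k = l \<star> f \<star> b" using l by (metis comp_assoc)
  qed
  moreover have "iso k" if "k \<in> H V V" "k \<star> f \<star> b = f \<star> b" for k
  proof -
    have "(k \<star> f \<star> b) \<star> a = (f \<star> b) \<star> a" using that by simp
    then have "k \<star> f = f" using a m that(1) by (simp add: comp_assoc H_iff)
    then show ?thesis using f that by blast
  qed
  ultimately show ?thesis unfolding exch_def using g by blast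
qed

text \<open>Let \<open>L\<close> be the exchange of \<open>X\<close>, and
  \<open>T1 -> T0 -> X\<close> the minimal presentation over the cluster containing
  \<open>M\<close>. The connecting map is nonzero, so \<open>M\<close> is a summand of
  \<open>T1\<close>, and by \<open>no_common_summand\<close> not of \<open>T0\<close>. The
  presentation and the exchange triangle of \<open>X\<close> can then be compared, which makes
  \<open>L\<close> a summand of \<open>T1\<close>, that is, isomorphic to \<open>M\<close>.\<close>

lemma exch_back:
  assumes T: "ctc (ob C) (insert M \<U>)" and TT: "S \<in> ob C" "\<And>X. X \<in> Add {S} \<longleftrightarrow> X \<in> Add (insert M \<U>)"
    and M: "compl M" and X: "compl X" and MX: "\<not> isom M X"
  shows "exch \<U> X M"
proof -
  have AS: "Add {S} = Add (insert M \<U>)" using TT by blast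
  have Xo: "loc X" "X \<in> ob C" "Ext0 X X" and Mo: "loc M" "M \<in> ob C" "Ext0 M M"
    using X M loc_ob by (auto simp: compl_def)
  have loc_AddM: "Y \<in> Add \<U> \<or> isom M Y" if Y: "loc Y" "Y \<in> Add (insert M \<U>)" for Y
  proof -
    obtain R where R: "R \<in> insert M \<U>" "retr Y R" using loc_Add[OF Y] by blast
    show ?thesis
    proof (cases "R = M")
      case True
      then show ?thesis using loc_retr_isom[OF Y(1) Mo(1)] isom_sym R by blast
    next
      case False
      then have "R \<in> Add \<U>" using R U_ob by (auto intro: Add_base)
      then show ?thesis using Add_retr R by blast
    qed
  qed
  have AddI: "V \<in> Add \<U>" if V: "V \<in> Add (insert M \<U>)" "\<not> retr M V" for V
  proof (rule AddI_loc[OF Add_ob[OF V(1)]])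
    fix R assume R: "loc R" "retr R V"
    then have "R \<in> Add \<U> \<or> isom M R" using loc_AddM Add_retr V by blast
    then show "R \<in> Add \<U>" using isom_retr retr_trans V(2) R by blast
  qed
  obtain L where L: "compl L" "exch \<U> X L" using exchange_ex[OF X] by blast
  then obtain V2 f2 g2 h2 where t2: "tri3 L V2 X f2 g2 h2" "rapp (Add \<U>) V2 X g2" unfolding exch_def by blast
  note m2 = tri3D[OF t2(1)]
  obtain T0 p where p: "rapp (Add (insert M \<U>)) T0 X p" and min: "\<And>h. h \<in> H T0 T0 \<Longrightarrow> p \<star> h = p \<Longrightarrow> iso h"
    using rapp_add_ex[OF TT(1) Xo(2)] unfolding AS by blast
  obtain T1 u d where t: "tri3 T1 T0 X u p d" using tri_second rappD(2)[OF p] by blast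
  note m = tri3D[OF t]
  have MU: "insert M \<U> \<subseteq> ob C" using Mo U_ob by blast
  have EE: "Ext0 A B" if "A \<in> Add (insert M \<U>)" "B \<in> Add (insert M \<U>)" for A B
    by (rule Ext0_Add_both[OF that]) (use T in \<open>auto simp: ctc_def\<close>)
  have T0: "T0 \<in> Add (insert M \<U>)" using rappD(1)[OF p] .
  have "Ext0 A T1" if "A \<in> insert M \<U>" for A
  proof -
    have A: "A \<in> Add (insert M \<U>)" using that MU by (auto intro: Add_base)
    show ?thesis by (rule rapp_kernel[OF p t A EE[OF A T0]])
  qed
  then have T1: "T1 \<in> Add (insert M \<U>)" using T m by (auto simp: ctc_def)
  have d0: "d \<noteq> zr X (sh C T1)"
  proof
    assume "d = zr X (sh C T1)"
    then have "d \<star> un X = zr X (sh C T1)" using m by simp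
    then obtain l where "l \<in> H X T0" "un X = p \<star> l" using factor_g[OF t, of "un X"] m by blast
    then have "retr X T0" using m unfolding retr_def by metis
    then have "X \<in> Add (insert M \<U>)" using Add_retr T0 by blast
    then show False using loc_AddM Xo X MX by (auto simp: compl_def)
  qed
  have "T1 \<notin> Add \<U>" using d0 compl_Ext'[OF X] Ext0D m by blast
  then have "retr M T1" using AddI T1 by blast
  then have "\<not> retr M T0" using no_common_summand[OF Xo(3) p min t Mo(1)] by blast
  then have T0U: "T0 \<in> Add \<U>" using AddI T0 by blast
  \<comment> \<open>As \<open>T0\<close> lies in add of the smaller class, it has no extensions by
    \<open>L\<close>. Conversely \<open>V2\<close> has none by \<open>T1\<close>, so the two
    connecting maps of \<open>X\<close> factor through each other.\<close>
  have "h2 \<star> p = zr T0 (sh C L)" using compl_Ext[OF L(1) T0U] Ext0D m m2 by blast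
  then obtain c where c: "c \<in> H (sh C T1) (sh C L)" "h2 = c \<star> d" using extend_h[OF t m2(3)] by blast
  have V2: "V2 \<in> Add (insert M \<U>)" using rappD(1)[OF t2(2)] Add_mono[of \<U> "insert M \<U>"] by blast
  have "d \<star> g2 = zr V2 (sh C T1)" using EE[OF V2 T1] Ext0D m m2 by blast
  then obtain e where e: "e \<in> H (sh C L) (sh C T1)" "d = e \<star> h2" using extend_h[OF t2(1) m(3)] by blast
  obtain c' where c': "c' \<in> H T1 L" "c = shf c'" using lift_shf[OF c(1)] m m2 by blast
  obtain e' where e': "e' \<in> H L T1" "e = shf e'" using lift_shf[OF e(1)] m m2 by blast
  have ce: "c' \<star> e' \<in> H L L" using c' e' by blast
  have "shf (c' \<star> e') \<star> h2 = c \<star> e \<star> h2" using c' e' by (simp add: shf_comp comp_assoc H_iff)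
  also have "\<dots> = h2" using c e by simp
  also have "h2 = shf (un L) \<star> h2" using m2 by (simp add: H_iff)
  finally have "shf (un L) \<star> h2 = shf (c' \<star> e') \<star> h2" by simp
  then obtain l where l: "l \<in> H V2 L" "un L = c' \<star> e' \<boxplus> l \<star> f2"
    using extend_f_diff[OF t2(1) un_H[OF m2(4)] ce] by blast
  have lf: "l \<star> f2 \<in> H L L" using l m2 by blast
  have Lo: "loc L" using L by (simp add: compl_def)
  have "iso (c' \<star> e') \<or> iso (l \<star> f2)" using loc_plus[OF Lo ce lf] l iso_un[OF m2(4)] by simp
  then have "iso (c' \<star> e')" using compl_not_iso[OF L(1) rappD(1)[OF t2(2)] m2(1) l(1)] by blast
  then have "retr L T1" using retr_iso[OF e'(1) c'(1)] by blast
  then have "L \<in> Add (insert M \<U>)" using Add_retr T1 by blast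
  then have "isom M L" using loc_AddM Lo L(1) by (auto simp: compl_def)
  then show ?thesis using exch_transport L isom_sym by blast
qed

text \<open>Two left approximations of \<open>M\<close> factor through each other, giving maps
  \<open>c\<close>, \<open>c'\<close> between the cones with \<open>1 - c' c\<close> factoring
  through \<open>V\<close>. As \<open>X\<close> is not in add of the class, \<open>c' c\<close> must
  be the invertible term.\<close>

lemma exch_unique:
  assumes X: "exch \<U> X M" "compl X" and Y: "exch \<U> Y M" "compl Y"
  shows "isom X Y"
proof -
  obtain V f g h where t: "tri3 M V X f g h" and f: "lapp (Add \<U>) M V f" using X unfolding exch_def by blast
  obtain V' f' g' h' where t': "tri3 M V' Y f' g' h'" and f': "lapp (Add \<U>) M V' f'" using Y unfolding exch_def by blast
  note m = tri3D[OF t] and m' = tri3D[OF t']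
  have uM: "un M \<in> H M M" using m by blast
  obtain b where b: "b \<in> H V V'" "f' = b \<star> f" using lappD(3)[OF f lappD(1)[OF f'] lappD(2)[OF f']] by blast
  obtain b' where b': "b' \<in> H V' V" "f = b' \<star> f'" using lappD(3)[OF f' lappD(1)[OF f] lappD(2)[OF f]] by blast
  have "b \<star> f = f' \<star> un M" "b' \<star> f' = f \<star> un M" using b b' m m' by (simp_all add: H_iff)
  then obtain c c' where c: "c \<in> H X Y" "shf (un M) \<star> h = h' \<star> c" and c': "c' \<in> H Y X" "shf (un M) \<star> h' = h \<star> c'"
    using fill[OF t t' uM b(1)] fill[OF t' t uM b'(1)] by blast
  then have hc: "h = h' \<star> c" "h' = h \<star> c'" using m m' by (simp_all add: H_iff)
  have cc: "c' \<star> c \<in> H X X" using c c' by blast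
  have "h \<star> un X = h \<star> c' \<star> c" using hc(1) m comp_eq_assoc[OF hc(2)[symmetric]] by (simp add: H_iff)
  then obtain k where k: "k \<in> H X V" "un X = c' \<star> c \<boxplus> g \<star> k" using factor_g_diff[OF t un_H[OF m(6)] cc] by blast
  have XY: "loc X" "loc Y" using X Y by (auto simp: compl_def)
  have "g \<star> k \<in> H X X" using k m by blast
  then have "iso (c' \<star> c) \<or> iso (g \<star> k)" using loc_plus[OF XY(1) cc] k iso_un[OF m(6)] by simp
  then have "iso (c' \<star> c)" using compl_not_iso[OF X(2) lappD(1)[OF f] k(1) m(2)] by blast
  then have "iso c" using loc_retract_iso[OF XY c(1) c'(1)] by blast
  then show ?thesis using c unfolding isom_def by blast
qed

text \<open>The criterion is tested against the old cluster, represented by \<open>S\<close>. Its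
  only new condition concerns maps from \<open>M\<close>, and these extend along
  \<open>M -> V\<close> because the cone is \<open>N\<close>; hence the exchange triangle ending in
  \<open>N\<close> is the one used.\<close>

lemma exch_ctc:
  assumes T: "ctc (ob C) (insert M \<U>)" and TT: "S \<in> ob C" "\<And>X. X \<in> Add {S} \<longleftrightarrow> X \<in> Add (insert M \<U>)"
    and e: "exch \<U> N M" and N: "compl N"
  shows "\<exists>R\<in>ob C. (\<forall>X. X \<in> Add {R} \<longleftrightarrow> X \<in> Add (insert N \<U>)) \<and> ctc (ob C) (insert N \<U>)"
proof -
  have No: "loc N" "N \<in> ob C" using N loc_ob by (auto simp: compl_def)
  have Mo: "M \<in> ob C" using T by (auto simp: ctc_def)
  obtain R i p j q where R: "bip R U0 N i p j q" using bip_ex U0(1) No(2) by blast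
  have Ro: "R \<in> ob C" using bip_retr[OF R] by (simp add: retr_def)
  have NR: "N \<in> Add {R}" "U0 \<in> Add {R}"
    using Add_retr[OF bip_retr(1)[OF R] Add_base] Add_retr[OF bip_retr(2)[OF R] Add_base] Ro by auto
  have UR: "X \<in> Add {R}" if "X \<in> Add \<U>" for X
    using U0(2)[of X] that Add_trans[of X "{U0}" "{R}"] NR by blast
  have NA: "N \<in> Add (insert N \<U>)" using No by (auto intro: Add_base)
  have "U0 \<in> Add \<U>" using U0 Add_base by blast
  then have "U0 \<in> Add (insert N \<U>)" using Add_mono[of \<U> "insert N \<U>"] by blast
  then have RA: "R \<in> Add (insert N \<U>)" using bip_Add[OF R] NA by blast
  have UN: "S \<in> Add {R}" if "S \<in> insert N \<U>" for S using that NR UR Add_base U_ob by blast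
  have eq: "X \<in> Add {R} \<longleftrightarrow> X \<in> Add (insert N \<U>)" for X
    using Add_trans[of X "{R}" "insert N \<U>"] Add_trans[of X "insert N \<U>" "{R}"] RA UN by blast
  have EN: "Ext0 A D" if "A \<in> insert N \<U>" "D \<in> insert N \<U>" for A D
    using that UU N Ext0_sym by (auto simp: compl_def)
  have RR: "Ext0 R R" using Ext0_Add_both[OF RA RA EN] .
  obtain V f g h where t: "tri3 M V N f g h" and f: "lapp (Add \<U>) M V f" using e unfolding exch_def by blast
  note m = tri3D[OF t]
  have S: "ctc (ob C) {S}"
    by (rule ctc_cong[OF T]) (use TT Add_base[of _ "insert M \<U>"] Add_base[of S "{S}"] Mo U_ob in auto)
  have "ctc (ob C) {R}"
  proof (rule ct_criterion[OF S RR])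
    fix X x assume X: "Ext0 R X" and x: "x \<in> H S X"
    have NX: "Ext0 N X" using Ext0_Add[OF NR(1)] X Ext0_ob by blast
    show "x \<in> thru {R} S X"
    proof (rule thru_all[OF _ _ x])
      show "S \<in> Add (insert M \<U>)" using TT Add_base by blast
      fix A s assume A: "A \<in> insert M \<U>" and s: "s \<in> H A X"
      have Ao: "A \<in> ob C" using H_ob s by blast
      show "s \<in> thru {R} A X"
      proof (cases "A = M")
        case True
        then have "shf s \<star> h = zr N (sh C X)" using NX s m Ext0D by blast
        then obtain l where "l \<in> H V X" "s = l \<star> f" using extend_f[OF t] s True by blast
        then show ?thesis using thru_via[OF UR[OF lappD(1)[OF f]]] m True by blast
      next
        case False
        then have "A \<in> Add {R}" using A UR Add_base U_ob by blast
        then have "s \<star> un A \<in> thru {R} A X" using thru_via s Ao by blast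
        then show ?thesis using s by (simp add: H_iff)
      qed
    qed
  qed
  then have "ctc (ob C) (insert N \<U>)"
    by (rule ctc_cong) (use UN RA No U_ob in auto)
  then show ?thesis using Ro eq by blast
qed

end

section \<open>Clusters\<close>

context two_CY_category
begin

text \<open>The last conjunct is a finiteness condition: the isomorphism classes are the summands of
  a single object.\<close>

definition is_cluster :: "'o set \<Rightarrow> 'o set \<Rightarrow> bool" where
  "is_cluster \<B> \<S> \<longleftrightarrow> (\<forall>X\<in>\<S>. loc X) \<and> (\<forall>X\<in>\<S>. \<forall>Y. isom X Y \<longrightarrow> Y \<in> \<S>) \<and> ctc \<B> \<S> \<and>
     (\<exists>S\<in>ob C. \<forall>X. X \<in> Add {S} \<longleftrightarrow> X \<in> Add \<S>)"

definition add_closed :: "'o set \<Rightarrow> bool" where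
  "add_closed \<B> \<longleftrightarrow> \<B> \<subseteq> ob C \<and> (\<forall>\<S>. \<S> \<subseteq> \<B> \<longrightarrow> Add \<S> \<subseteq> \<B>)"

lemma add_closed_ob: "add_closed (ob C)"
  using Add_sub by (simp add: add_closed_def)

lemma iso_class_eq: "X \<in> ob C \<Longrightarrow> iso_class C X = {Y. isom X Y}"
  using isomorphic_iff isom_ob by (auto simp: iso_class_def)

lemma loc_Add_isom:
  assumes "loc X" "X \<in> Add \<S>" "\<And>S. S \<in> \<S> \<Longrightarrow> loc S" shows "\<exists>S\<in>\<S>. isom X S"
  using loc_Add[OF assms(1,2)] loc_retr_isom[OF assms(1)] assms(3) by blast

lemma ind_summands_class: "S \<in> ob C \<Longrightarrow> (\<And>X. X \<in> Add {S} \<longleftrightarrow> X \<in> Add \<S>) \<Longrightarrow> (\<And>X. X \<in> \<S> \<Longrightarrow> loc X) \<Longrightarrow>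
    (\<And>X Y. X \<in> \<S> \<Longrightarrow> isom X Y \<Longrightarrow> Y \<in> \<S>) \<Longrightarrow> ind_summands C S = \<S>"
proof
  assume S: "S \<in> ob C" "\<And>X. X \<in> Add {S} \<longleftrightarrow> X \<in> Add \<S>" "\<And>X. X \<in> \<S> \<Longrightarrow> loc X"
    "\<And>X Y. X \<in> \<S> \<Longrightarrow> isom X Y \<Longrightarrow> Y \<in> \<S>"
  show "ind_summands C S \<subseteq> \<S>"
  proof
    fix X assume "X \<in> ind_summands C S"
    then have "loc X" "X \<in> Add \<S>" using S by (auto simp: ind_summands_eq)
    then obtain R where "R \<in> \<S>" "isom X R" using loc_Add_isom S(3) by blast
    then show "X \<in> \<S>" using S(4) isom_sym by blast
  qed
  show "\<S> \<subseteq> ind_summands C S" using S(3) Add_base[of _ \<S>] loc_ob S(2) by (auto simp: ind_summands_eq[OF S(1)])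
qed

lemma ind_summands_Add: "T \<in> ob C \<Longrightarrow> X \<in> Add {T} \<longleftrightarrow> X \<in> Add (ind_summands C T)"
proof
  assume T: "T \<in> ob C"
  show "X \<in> Add {T}" if X: "X \<in> Add (ind_summands C T)"
    using Add_trans[OF X] T by (simp add: ind_summands_eq)
  show "X \<in> Add (ind_summands C T)" if X: "X \<in> Add {T}"
  proof (rule AddI_loc[OF Add_ob[OF X]])
    fix S assume "loc S" "retr S X"
    then have "S \<in> ind_summands C T" using T X Add_retr by (simp add: ind_summands_eq)
    then show "S \<in> Add (ind_summands C T)" using \<open>loc S\<close> loc_ob Add_base by blast
  qed
qed

lemma ind_summands_isom: "T \<in> ob C \<Longrightarrow> X \<in> ind_summands C T \<Longrightarrow> isom X Y \<Longrightarrow> Y \<in> ind_summands C T"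
  using loc_isom isom_retr isom_sym Add_retr by (simp add: ind_summands_eq) blast

lemma ind_summands_loc: "T \<in> ob C \<Longrightarrow> X \<in> ind_summands C T \<Longrightarrow> loc X"
  by (simp add: ind_summands_eq)

lemma ct_clusters_iff: "add_closed \<B> \<Longrightarrow> \<S> \<in> ct_clusters C \<B> \<longleftrightarrow> is_cluster \<B> \<S>"
proof
  assume B: "add_closed \<B>"
  then have Bo: "\<B> \<subseteq> ob C" by (simp add: add_closed_def)
  {
    assume "\<S> \<in> ct_clusters C \<B>"
    then obtain T where T: "\<S> = ind_summands C T" "ctc \<B> {T}"
      using cluster_tilting_iff[OF Bo] by (auto simp: ct_clusters_def)
    have To: "T \<in> ob C" "T \<in> \<B>" using T Bo by (auto simp: ctc_def)
    have "\<S> \<subseteq> Add {T}" using T To by (auto simp: ind_summands_eq)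
    then have "\<S> \<subseteq> \<B>" using B To unfolding add_closed_def by blast
    moreover have "T \<in> Add \<S>" using ind_summands_Add[OF To(1), of T] Add_base[of T "{T}"] To T by simp
    ultimately have "ctc \<B> \<S>" by (intro ctc_cong[OF T(2) _ Bo]) (use \<open>\<S> \<subseteq> Add {T}\<close> in auto)
    then show "is_cluster \<B> \<S>" unfolding is_cluster_def
      using ind_summands_loc[OF To(1)] ind_summands_isom[OF To(1)] ind_summands_Add[OF To(1)] T(1) To(1) by blast
  }
  assume S: "is_cluster \<B> \<S>"
  then obtain T where T: "T \<in> ob C" "\<And>X. X \<in> Add {T} \<longleftrightarrow> X \<in> Add \<S>" by (auto simp: is_cluster_def)
  have c: "ctc \<B> \<S>" "\<S> \<subseteq> \<B>" using S by (auto simp: is_cluster_def ctc_def)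
  have TS: "T \<in> Add \<S>" using T Add_base by blast
  then have TB: "T \<in> \<B>" using B c unfolding add_closed_def by blast
  have "ctc \<B> {T}"
    by (rule ctc_cong[OF c(1) _ Bo]) (use T(2) TS TB Add_base c Bo in auto)
  then have "cluster_tilting C \<B> T" using cluster_tilting_iff[OF Bo] by blast
  moreover have "ind_summands C T = \<S>" by (rule ind_summands_class) (use S T in \<open>auto simp: is_cluster_def\<close>)
  ultimately show "\<S> \<in> ct_clusters C \<B>" unfolding ct_clusters_def by blast
qed

text \<open>Up to isomorphism, members of the subclass occur in a fixed decomposition of
  \<open>T\<close> into local objects, so it suffices to add up the summands that belong to
  it.\<close>

lemma finite_type_subclass:
  assumes T: "T \<in> ob C" and S: "\<And>X. X \<in> \<S> \<Longrightarrow> loc X \<and> X \<in> Add {T}" "\<And>X Y. X \<in> \<S> \<Longrightarrow> isom X Y \<Longrightarrow> Y \<in> \<S>"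
  shows "\<exists>S\<in>ob C. \<forall>X. X \<in> Add {S} \<longleftrightarrow> X \<in> Add \<S>"
proof -
  obtain Ts where Ts: "is_dsum C Ts T" "\<forall>Y\<in>set Ts. local_end C Y" using krull_schmidt T by blast
  note t = is_dsumD[OF Ts(1)]
  define L where "L = filter (\<lambda>X. X \<in> \<S>) Ts"
  have Lo: "set L \<subseteq> ob C" using t(2) by (auto simp: L_def)
  then obtain S where d: "is_dsum C L S" using dsum_exists by blast
  note s = is_dsumD[OF d]
  have "X \<in> Add {S}" if X: "X \<in> \<S>" for X
  proof -
    have "T \<in> Add (set Ts)" using t by (simp add: Add_def)
    then have "X \<in> Add (set Ts)" using Add_trans[of X "{T}" "set Ts"] S(1)[OF X] by blast
    then obtain Y where Y: "Y \<in> set Ts" "isom X Y"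
      using loc_Add_isom S(1)[OF X] Ts(2) local_end_iff t(2) by blast
    then have "Y \<in> set L" using S(2)[OF X] by (simp add: L_def)
    then have "Y \<in> Add {S}" using s Add_retr Add_base by blast
    then show ?thesis using Add_retr isom_retr Y by blast
  qed
  moreover have "S \<in> Add \<S>"
    using dsum_Add_iff[OF d, of \<S>] Add_base[of _ \<S>] Lo by (auto simp: L_def)
  ultimately have "X \<in> Add {S} \<longleftrightarrow> X \<in> Add \<S>" for X
    using Add_trans[of X "{S}" \<S>] Add_trans[of X \<S> "{S}"] by blast
  then show ?thesis using s by blast
qed

definition mutates :: "'o set \<Rightarrow> 'o set \<Rightarrow> 'o \<Rightarrow> 'o \<Rightarrow> bool" where
  "mutates \<B> \<S> M N \<longleftrightarrow> N \<in> \<B> \<and> loc N \<and> \<not> isom M N \<and> is_cluster \<B> (replace_by C \<S> M N)"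

text \<open>Existence comes from \<open>exchange_ex\<close>. For uniqueness, any other replacement
  is again a complement not isomorphic to \<open>M\<close>, so by \<open>exch_back\<close> it too is
  the end of an exchange triangle starting in \<open>M\<close>.\<close>

lemma cluster_mutation:
  assumes T: "is_cluster (ob C) \<T>" and M: "M \<in> \<T>"
  shows "\<exists>N. mutates (ob C) \<T> M N \<and> (\<forall>N'. mutates (ob C) \<T> M N' \<longrightarrow> isom N N') \<and>
    exch (\<T> - iso_class C M) M N \<and> exch (\<T> - iso_class C M) N M \<and> \<not> Ext0 M N"
proof -
  have c: "ctc (ob C) \<T>" and l: "\<And>X. X \<in> \<T> \<Longrightarrow> loc X" and i: "\<And>X Y. X \<in> \<T> \<Longrightarrow> isom X Y \<Longrightarrow> Y \<in> \<T>"
    and E: "\<And>X Y. X \<in> \<T> \<Longrightarrow> Y \<in> \<T> \<Longrightarrow> Ext0 X Y" using T by (auto simp: is_cluster_def ctc_def)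
  obtain S where S: "S \<in> ob C" "\<And>X. X \<in> Add {S} \<longleftrightarrow> X \<in> Add \<T>" using T by (auto simp: is_cluster_def)
  have Mo: "loc M" "M \<in> ob C" using l M loc_ob by auto
  define \<U> where "\<U> = \<T> - iso_class C M"
  have \<U>: "X \<in> \<U> \<longleftrightarrow> X \<in> \<T> \<and> \<not> isom M X" for X using iso_class_eq[OF Mo(2)] by (auto simp: \<U>_def)
  have Uo: "\<U> \<subseteq> ob C" using \<U> l loc_ob by blast
  have Ui: "Y \<in> \<U>" if "X \<in> \<U>" "isom X Y" for X Y using that \<U> i isom_trans isom_sym by blast
  have TA: "X \<in> Add {S}" if "X \<in> \<T>" for X using that S Add_base l loc_ob by blast
  have "\<exists>U0\<in>ob C. \<forall>X. X \<in> Add {U0} \<longleftrightarrow> X \<in> Add \<U>"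
    by (rule finite_type_subclass[OF S(1)]) (use TA \<U> l Ui in blast)+
  then obtain U0 where U0: "U0 \<in> ob C" "\<And>X. X \<in> Add {U0} \<longleftrightarrow> X \<in> Add \<U>" by blast
  interpret almost_complete K C \<U> U0
    by unfold_locales (use Uo U0 E \<U> in auto)
  have MU: "M \<notin> Add \<U>" using loc_Add_isom[OF Mo(1), of \<U>] \<U> l by blast
  have cM: "compl M" using Mo MU E M \<U> by (auto simp: compl_def)
  have AddM: "X \<in> Add (insert M \<U>)" if "X \<in> \<T>" for X
  proof (cases "isom M X")
    case True
    then show ?thesis using Add_retr[OF isom_retr[OF isom_sym[OF True]] Add_base[of M "insert M \<U>"]] Mo by blast
  next
    case False
    then show ?thesis using that \<U> loc_ob[OF l[OF that]] by (auto intro: Add_base)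
  qed
  have insT: "insert M \<U> \<subseteq> \<T>" using \<U> M by blast
  have AT: "X \<in> Add (insert M \<U>) \<longleftrightarrow> X \<in> Add \<T>" for X
    using Add_trans[of X \<T> "insert M \<U>"] AddM Add_mono[OF insT] by blast
  have cT: "ctc (ob C) (insert M \<U>)"
    by (rule ctc_cong[OF c]) (use AddM Add_base[of _ \<T>] insT l loc_ob in auto)
  have S': "X \<in> Add {S} \<longleftrightarrow> X \<in> Add (insert M \<U>)" for X using S AT by blast
  obtain N where N: "compl N" "exch \<U> M N" "\<not> Ext0 M N" using exchange_ex[OF cM] by blast
  have No: "loc N" "N \<in> ob C" using N loc_ob by (auto simp: compl_def)
  have MN: "\<not> isom M N"
  proof
    assume "isom M N"
    then have "Ext0 M N" using E[OF M M] Ext0_retr_right isom_retr isom_sym by blast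
    then show False using N by blast
  qed
  have NM: "exch \<U> N M" by (rule exch_back[OF cT S(1) S' cM N(1) MN])
  obtain R where R: "R \<in> ob C" "\<And>X. X \<in> Add {R} \<longleftrightarrow> X \<in> Add (insert N \<U>)" "ctc (ob C) (insert N \<U>)"
    using exch_ctc[OF cT S(1) S' NM N(1)] by blast
  have rep: "X \<in> replace_by C \<T> M N' \<longleftrightarrow> X \<in> \<U> \<or> isom N' X" if "N' \<in> ob C" for X N'
    using iso_class_eq[OF that] by (auto simp: replace_by_def \<U>_def)
  have repA: "X \<in> Add (insert N \<U>)" if "X \<in> replace_by C \<T> M N" for X
  proof -
    have "X \<in> \<U> \<or> isom N X" using that rep No by blast
    then show ?thesis
    proof
      assume "X \<in> \<U>"
      then show ?thesis using Uo by (auto intro: Add_base)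
    next
      assume "isom N X"
      then show ?thesis using Add_retr[OF isom_retr[OF isom_sym] Add_base[of N "insert N \<U>"]] No by blast
    qed
  qed
  have insN: "insert N \<U> \<subseteq> replace_by C \<T> M N" using rep No isom_refl by blast
  have loc_rep: "loc X" if "X \<in> replace_by C \<T> M N" for X
    using that rep No \<U> l loc_isom by blast
  have cl: "is_cluster (ob C) (replace_by C \<T> M N)"
    unfolding is_cluster_def
  proof (intro conjI ballI allI impI)
    show "loc X" if "X \<in> replace_by C \<T> M N" for X using loc_rep that .
    show "Y \<in> replace_by C \<T> M N" if "X \<in> replace_by C \<T> M N" "isom X Y" for X Y
      using that rep[OF No(2)] Ui isom_trans by blast
    show "ctc (ob C) (replace_by C \<T> M N)"
      by (rule ctc_cong[OF R(3)]) (use repA loc_rep loc_ob insN Add_base in auto)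
    have "X \<in> Add {R} \<longleftrightarrow> X \<in> Add (replace_by C \<T> M N)" for X
      using R(2)[of X] Add_trans[of X "replace_by C \<T> M N" "insert N \<U>"] repA Add_mono[OF insN] by blast
    then show "\<exists>S\<in>ob C. \<forall>X. X \<in> Add {S} \<longleftrightarrow> X \<in> Add (replace_by C \<T> M N)" using R(1) by blast
  qed
  have uniq: "isom N N'" if N': "mutates (ob C) \<T> M N'" for N'
  proof -
    have n: "N' \<in> ob C" "loc N'" "\<not> isom M N'" and cl': "is_cluster (ob C) (replace_by C \<T> M N')"
      using N' by (auto simp: mutates_def)
    have E': "Ext0 X Y" if "X \<in> \<U> \<or> isom N' X" "Y \<in> \<U> \<or> isom N' Y" for X Y
      using cl' that rep[OF n(1)] unfolding is_cluster_def ctc_def by blast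
    have r: "isom N' N'" using isom_refl n by blast
    \<comment> \<open>Otherwise the replaced cluster would lie in add of the remaining elements,
      hence have no extensions with \<open>M\<close>, and cluster tilting would put \<open>M\<close>
      there as well.\<close>
    have "N' \<notin> Add \<U>"
    proof
      assume a: "N' \<in> Add \<U>"
      have ra: "X \<in> Add \<U>" if "X \<in> replace_by C \<T> M N'" for X
      proof -
        have "X \<in> \<U> \<or> isom N' X" using that rep n by blast
        then show ?thesis using Add_base Uo Add_retr[OF isom_retr[OF isom_sym] a] by blast
      qed
      have "Ext0 X M" if "X \<in> replace_by C \<T> M N'" for X using compl_Ext[OF cM ra[OF that]] .
      then have "M \<in> Add (replace_by C \<T> M N')" using cl' Mo unfolding is_cluster_def ctc_def by blast
      then have "M \<in> Add \<U>" using Add_trans ra by blast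
      then show False using MU by blast
    qed
    then have "compl N'" using n E' r unfolding compl_def by blast
    moreover from this have "exch \<U> N' M" using exch_back[OF cT S(1) S' cM _ n(3)] by blast
    ultimately show ?thesis using exch_unique NM N by blast
  qed
  have "mutates (ob C) \<T> M N" using No MN cl by (simp add: mutates_def)
  then show ?thesis using uniq N NM unfolding \<U>_def by blast
qed

lemma exchange_trianglesI:
  assumes o: "T \<subseteq> ob C" and 1: "exch (T - iso_class C L) L L'" and 2: "exch (T - iso_class C L) L' L"
  shows "exchange_triangles C T L L'"
proof -
  have U: "add_of C (T - iso_class C L) = Add (T - iso_class C L)" (is "?U = _") using o by (intro add_of_eq) blast
  have E: "\<exists>V f g h. (N, V, M, f, g, h) \<in> tri C \<and> min_right_approx C ?U V M g \<and> min_left_approx C ?U N V f"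
    if e: "exch (T - iso_class C L) M N" for M N
  proof -
    obtain V f g h where t: "tri3 N V M f g h" and a: "rapp ?U V M g" "\<forall>k\<in>H V V. g \<star> k = g \<longrightarrow> iso k"
      "lapp ?U N V f" "\<forall>k\<in>H V V. k \<star> f = f \<longrightarrow> iso k" using e unfolding exch_def U by blast
    note m = tri3D[OF t]
    have "(N, V, M, val f, val g, val h) \<in> tri C" using t by (simp add: tri3_def)
    moreover have "min_right_approx C ?U V M (val g)" "min_left_approx C ?U N V (val f)"
      using a m unfolding U by (simp_all add: min_right_approx_rapp min_left_approx_lapp Add_sub H_val)
    ultimately show ?thesis by blast
  qed
  show ?thesis unfolding exchange_triangles_def Let_def using E[OF 1] E[OF 2] by blast
qed

lemma exchange_iff: "add_closed \<B> \<Longrightarrow> M \<in> ob C \<Longrightarrow> exchange C \<B> (ct_clusters C \<B>) T M N \<longleftrightarrow> mutates \<B> T M N"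
  unfolding exchange_def mutates_def using ct_clusters_iff indecomposable_iff isomorphic_iff[of M N] loc_ob by blast

lemma weak_cluster_structureI:
  assumes B: "add_closed \<B>" and p: "indec_set C \<B> p"
    and T: "\<And>T. is_cluster \<B> T \<Longrightarrow> p \<subseteq> T"
    and M: "\<And>T M. is_cluster \<B> T \<Longrightarrow> M \<in> T - p \<Longrightarrow> \<exists>N. mutates \<B> T M N \<and> (\<forall>N'. mutates \<B> T M N' \<longrightarrow> isom N N') \<and>
      exch (T - iso_class C M) M N \<and> exch (T - iso_class C M) N M"
  shows "weak_cluster_structure C \<B> (ct_clusters C \<B>) p"
  unfolding weak_cluster_structure_def
proof (intro conjI ballI p)
  fix S assume "S \<in> ct_clusters C \<B>"
  then have S: "is_cluster \<B> S" using ct_clusters_iff B by blast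
  then have SB: "S \<subseteq> \<B>" "S \<subseteq> ob C" using B by (auto simp: is_cluster_def ctc_def add_closed_def)
  show "p \<subseteq> S" using T S by blast
  show "indec_set C \<B> S" unfolding indec_set_def
  proof (intro conjI ballI SB)
    fix X assume X: "X \<in> S"
    then show "indecomposable C X" using S indecomposable_iff unfolding is_cluster_def by blast
    show "iso_class C X \<subseteq> S" using S X iso_class_eq[of X] SB unfolding is_cluster_def by blast
  qed
  fix L assume L: "L \<in> S - p"
  then have Lo: "L \<in> ob C" using SB by blast
  obtain N where N: "mutates \<B> S L N" "\<forall>N'. mutates \<B> S L N' \<longrightarrow> isom N N'"
    "exch (S - iso_class C L) L N" "exch (S - iso_class C L) N L" using M[OF S L] by blast
  have "isomorphic C N N'" if "mutates \<B> S L N'" for N'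
    using that N isom_ob isomorphic_iff by blast
  then show "\<exists>N. exchange C \<B> (ct_clusters C \<B>) S L N \<and>
      (\<forall>N'. exchange C \<B> (ct_clusters C \<B>) S L N' \<longrightarrow> isomorphic C N N') \<and> exchange_triangles C S L N"
    using N exchange_iff[OF B Lo] exchange_trianglesI[OF SB(2)] by blast
qed

lemma weak_cluster_structure_C: "weak_cluster_structure C (ob C) (ct_clusters C (ob C)) {}"
proof (rule weak_cluster_structureI[OF add_closed_ob])
  show "indec_set C (ob C) {}" by (simp add: indec_set_def)
  show "{} \<subseteq> T" for T :: "'o set" by simp
  show "\<exists>N. mutates (ob C) T M N \<and> (\<forall>N'. mutates (ob C) T M N' \<longrightarrow> isom N N') \<and>
      exch (T - iso_class C M) M N \<and> exch (T - iso_class C M) N M" if "is_cluster (ob C) T" "M \<in> T - {}" for T M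
    using cluster_mutation[OF that(1), of M] that(2) by blast
qed

end

section \<open>Clusters of B inside clusters of C\<close>

context cluster_tilting_pair
begin

lemma rigid_W: "rigid C (ob C) W"
  using WW W_ob ext_vanishes_iff by (simp add: rigid_def)

lemma add_closed_B: "add_closed B"
  unfolding add_closed_def using B_ob B_Add by blast

lemma coefficients_iff: "X \<in> ct_coefficients C B \<longleftrightarrow> loc X \<and> X \<in> B \<and> X \<in> Bperp"
  using B_ob ext_vanishes_iff unfolding ct_coefficients_def projective_in_def indecomposable_iff Bperp_def by auto blast+

lemma coefficients_isom: "X \<in> ct_coefficients C B \<Longrightarrow> isom X Y \<Longrightarrow> Y \<in> ct_coefficients C B"
  unfolding coefficients_iff using loc_isom B_retr Bperp_retr isom_retr isom_sym by blast

lemma coefficients_subset: "is_cluster B \<T> \<Longrightarrow> ct_coefficients C B \<subseteq> \<T>"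
proof
  fix X assume T: "is_cluster B \<T>" and X: "X \<in> ct_coefficients C B"
  then have x: "loc X" "X \<in> B" "X \<in> Bperp" using coefficients_iff by auto
  have "X \<in> Add \<T>" using ctc_I[OF _ x(2,3)] T by (simp add: is_cluster_def)
  then obtain S where "S \<in> \<T>" "isom X S" using loc_Add_isom x T unfolding is_cluster_def by blast
  then show "X \<in> \<T>" using T isom_sym unfolding is_cluster_def by blast
qed

lemma W_summands: "X \<in> ind_summands C W \<Longrightarrow> loc X \<and> X \<in> Bperp" and W_summands_B: "X \<in> ind_summands C W \<Longrightarrow> X \<in> B \<Longrightarrow> X \<in> ct_coefficients C B"
proof -
  show *: "X \<in> ind_summands C W \<Longrightarrow> loc X \<and> X \<in> Bperp" for X
    using ind_summands_eq[OF W_ob] loc_Add[of X "{W}"] Bperp_retr W by blast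
  show "X \<in> ind_summands C W \<Longrightarrow> X \<in> B \<Longrightarrow> X \<in> ct_coefficients C B" using * coefficients_iff by blast
qed

lemma is_cluster_extend:
  assumes T: "is_cluster B \<T>" shows "is_cluster (ob C) (\<T> \<union> ind_summands C W)"
proof -
  obtain R where R: "\<T> = ind_summands C R" "ctc B {R}"
    using T ct_clusters_iff[OF add_closed_B] cluster_tilting_iff[OF B_ob] unfolding ct_clusters_def by blast
  have Ro: "R \<in> ob C" using R B_ob by (auto simp: ctc_def)
  have RW: "ctc (ob C) {R, W}" using ctc_extend R by blast
  obtain Q i p j q where Q: "bip Q R W i p j q" using bip_ex Ro W_ob by blast
  have Qo: "Q \<in> ob C" using bip_retr[OF Q] by (simp add: retr_def)
  let ?S = "\<T> \<union> ind_summands C W"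
  have So: "?S \<subseteq> ob C" using R ind_summands_loc[OF Ro] ind_summands_loc[OF W_ob] loc_ob by blast
  have RS: "R \<in> Add ?S" "W \<in> Add ?S"
    using ind_summands_Add[OF Ro, of R] ind_summands_Add[OF W_ob, of W] Add_base[of R "{R}"] Add_base[of W "{W}"]
      Add_mono[of \<T> ?S R] Add_mono[of "ind_summands C W" ?S W] R Ro W_ob by auto
  have SR: "X \<in> Add {R, W}" if "X \<in> ?S" for X
    using that ind_summands_eq[OF Ro] ind_summands_eq[OF W_ob] R Add_mono[of "{R}" "{R, W}" X] Add_mono[of "{W}" "{R, W}" X] by auto
  have QRW: "R \<in> Add {Q}" "W \<in> Add {Q}"
    using Add_retr[OF bip_retr(1)[OF Q] Add_base] Add_retr[OF bip_retr(2)[OF Q] Add_base] Qo by auto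
  have "X \<in> Add {Q} \<longleftrightarrow> X \<in> Add ?S" for X
  proof
    show "X \<in> Add ?S" if "X \<in> Add {Q}" using Add_trans[OF that] bip_Add[OF Q RS] by blast
    show "X \<in> Add {Q}" if "X \<in> Add ?S"
    proof (rule Add_trans[OF that])
      fix S assume "S \<in> ?S"
      then show "S \<in> Add {Q}" using Add_trans[OF SR, of S "{Q}"] QRW by blast
    qed
  qed
  moreover have "ctc (ob C) ?S" by (rule ctc_cong[OF RW So]) (use RS SR in auto)
  moreover have "loc X" if "X \<in> ?S" for X using that R ind_summands_loc Ro W_ob by blast
  moreover have "Y \<in> ?S" if "X \<in> ?S" "isom X Y" for X Y using that R ind_summands_isom Ro W_ob by blast
  ultimately show ?thesis unfolding is_cluster_def using Qo by blast
qed

text \<open>Mutation is performed in \<open>C\<close> on the cluster enlarged by the summands of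
  \<open>W\<close>, and the result is brought back to \<open>B\<close>. The middle terms of the
  exchange triangles lie in \<open>B\<close> by extension closure, which allows the summands of
  \<open>W\<close> to be discarded.\<close>

lemma cluster_mutation_B:
  assumes T: "is_cluster B \<T>" and M: "M \<in> \<T> - ct_coefficients C B"
  shows "\<exists>N. mutates B \<T> M N \<and> (\<forall>N'. mutates B \<T> M N' \<longrightarrow> isom N N') \<and>
    exch (\<T> - iso_class C M) M N \<and> exch (\<T> - iso_class C M) N M"
proof -
  let ?p = "ct_coefficients C B" and ?W = "ind_summands C W"
  define \<S> where "\<S> = \<T> \<union> ?W"
  have S: "is_cluster (ob C) \<S>" using is_cluster_extend T by (simp add: \<S>_def)
  have l: "\<And>X. X \<in> \<T> \<Longrightarrow> loc X" and i: "\<And>X Y. X \<in> \<T> \<Longrightarrow> isom X Y \<Longrightarrow> Y \<in> \<T>"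
    and E: "\<And>X Y. X \<in> \<T> \<Longrightarrow> Y \<in> \<T> \<Longrightarrow> Ext0 X Y" and TB: "\<T> \<subseteq> B" using T by (auto simp: is_cluster_def ctc_def)
  have Mo: "loc M" "M \<in> ob C" "M \<in> B" "M \<in> \<T>" "M \<notin> ?p" using M l loc_ob TB by auto
  define \<U> where "\<U> = \<T> - iso_class C M"
  have \<U>: "X \<in> \<U> \<longleftrightarrow> X \<in> \<T> \<and> \<not> isom M X" for X using iso_class_eq[OF Mo(2)] by (auto simp: \<U>_def)
  \<comment> \<open>A summand of \<open>W\<close> lying in \<open>B\<close> is a coefficient,
    whereas \<open>M\<close> is not; so mutation at \<open>M\<close> leaves the part coming from
    \<open>W\<close> untouched.\<close>
  have MW: "\<not> isom M X" if "X \<in> ?W" for X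
    using W_summands_B[OF ind_summands_isom[OF W_ob that isom_sym]] Mo by blast
  have \<S>U: "\<S> - iso_class C M = \<U> \<union> ?W" using MW iso_class_eq[OF Mo(2)] by (auto simp: \<S>_def \<U>_def)
  have pU: "?p \<subseteq> \<U>" using coefficients_subset[OF T] coefficients_isom isom_sym Mo \<U> by blast
  have repS: "replace_by C \<S> M N = replace_by C \<T> M N \<union> ?W" for N
    using \<S>U by (auto simp: replace_by_def \<U>_def)
  have rep: "X \<in> replace_by C \<T> M N \<longleftrightarrow> X \<in> \<U> \<or> isom N X" if "N \<in> ob C" for X N
    using iso_class_eq[OF that] by (auto simp: replace_by_def \<U>_def)
  have reduce: "V \<in> Add \<V>" if V: "V \<in> Add (\<V> \<union> ?W)" "V \<in> B" and v: "?p \<subseteq> \<V>" "\<And>X. X \<in> \<V> \<Longrightarrow> loc X" for V \<V>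
  proof (rule AddI_loc[OF Add_ob[OF V(1)]])
    fix L assume L: "loc L" "retr L V"
    then obtain R where R: "R \<in> \<V> \<union> ?W" "isom L R" using loc_Add_isom Add_retr V(1) v(2) W_summands by blast
    have "R \<in> B" using B_retr[OF isom_retr[OF isom_sym[OF R(2)]]] B_retr[OF L(2) V(2)] by blast
    then have "R \<in> \<V>" using R v(1) W_summands_B by blast
    then show "L \<in> Add \<V>" using Add_retr[OF isom_retr[OF R(2)]] Add_base v(2) loc_ob by blast
  qed
  obtain N where N: "mutates (ob C) \<S> M N" "\<And>N'. mutates (ob C) \<S> M N' \<Longrightarrow> isom N N'"
    "exch (\<U> \<union> ?W) M N" "exch (\<U> \<union> ?W) N M" "\<not> Ext0 M N"
    using cluster_mutation[OF S, of M] Mo unfolding \<S>U by (auto simp: \<S>_def)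
  have No: "loc N" "N \<in> ob C" "\<not> isom M N" and cN: "is_cluster (ob C) (replace_by C \<T> M N \<union> ?W)"
    using N(1) unfolding mutates_def repS by auto
  have EN: "Ext0 X Y" if "X \<in> replace_by C \<T> M N \<union> ?W" "Y \<in> replace_by C \<T> M N \<union> ?W" for X Y
    using cN that unfolding is_cluster_def ctc_def by blast
  have NN: "N \<in> replace_by C \<T> M N" using rep[OF No(2)] isom_refl No by blast
  have Urep: "\<U> \<subseteq> replace_by C \<T> M N" using rep[OF No(2)] by blast
  \<comment> \<open>All coefficients survive the mutation, so \<open>N\<close> has no extensions
    with the projectives of \<open>B\<close> and the dichotomy applies. The nonzero extension
    between \<open>M\<close> and \<open>N\<close> then excludes the perpendicular class.\<close>
  have "Ext0 N J" if J: "J \<in> B" "J \<in> Bperp" for J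
  proof (rule Ext0_Add_right[OF _ No(2)])
    show "J \<in> Add ?p"
    proof (rule AddI_loc)
      show "J \<in> ob C" using J B_ob by blast
      fix L assume "loc L" "retr L J"
      then show "L \<in> Add ?p" using J B_retr Bperp_retr coefficients_iff loc_ob by (blast intro: Add_base)
    qed
    show "Ext0 N S" if "S \<in> ?p" for S using EN NN Urep pU that by blast
  qed
  then have "N \<in> B \<or> N \<in> Bperp" using decomposition No by blast
  then have NB: "N \<in> B" using Bperp_Ext' Mo N(5) by blast
  have Ul: "\<And>X. X \<in> \<U> \<Longrightarrow> loc X" using \<U> l by blast
  have ex: "exch \<U> A D" if e: "exch (\<U> \<union> ?W) A D" and AD: "A \<in> B" "D \<in> B" for A D
  proof -
    obtain V f g h where t: "tri3 D V A f g h" and g: "rapp (Add (\<U> \<union> ?W)) V A g" "\<forall>k\<in>H V V. g \<star> k = g \<longrightarrow> iso k"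
      and f: "lapp (Add (\<U> \<union> ?W)) D V f" "\<forall>k\<in>H V V. k \<star> f = f \<longrightarrow> iso k" using e unfolding exch_def by blast
    have V: "V \<in> Add \<U>" using reduce[OF rappD(1)[OF g(1)] B_ext[OF t AD(2,1)] pU Ul] .
    have mono: "X \<in> Add (\<U> \<union> ?W)" if "X \<in> Add \<U>" for X using that Add_mono[of \<U> "\<U> \<union> ?W"] by blast
    have "rapp (Add \<U>) V A g" using g(1) V mono unfolding rapp_def by blast
    moreover have "lapp (Add \<U>) D V f" using f(1) V mono unfolding lapp_def by blast
    ultimately show ?thesis unfolding exch_def using t g f by blast
  qed
  have rl: "\<And>X. X \<in> replace_by C \<T> M N \<Longrightarrow> loc X" using cN unfolding is_cluster_def by blast
  have rB: "replace_by C \<T> M N \<subseteq> B"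
  proof
    fix X assume "X \<in> replace_by C \<T> M N"
    then have "X \<in> \<U> \<or> isom N X" using rep[OF No(2)] by blast
    then show "X \<in> B" using \<U> TB B_retr[OF isom_retr[OF isom_sym] NB] by blast
  qed
  have Ui: "Y \<in> \<U>" if "X \<in> \<U>" "isom X Y" for X Y using that \<U> i isom_trans isom_sym by blast
  have ri: "Y \<in> replace_by C \<T> M N" if "X \<in> replace_by C \<T> M N" "isom X Y" for X Y
  proof -
    have "X \<in> \<U> \<or> isom N X" using that(1) rep[OF No(2)] by blast
    then have "Y \<in> \<U> \<or> isom N Y" using Ui isom_trans that(2) by blast
    then show ?thesis using rep[OF No(2)] by blast
  qed
  have "is_cluster B (replace_by C \<T> M N)"
    unfolding is_cluster_def
  proof (intro conjI ballI allI impI)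
    show "loc X" if "X \<in> replace_by C \<T> M N" for X using rl that .
    show "Y \<in> replace_by C \<T> M N" if "X \<in> replace_by C \<T> M N" "isom X Y" for X Y using ri that .
    obtain Q where Q: "Q \<in> ob C" "\<And>X. X \<in> Add {Q} \<longleftrightarrow> X \<in> Add (replace_by C \<T> M N \<union> ?W)"
      using cN unfolding is_cluster_def by blast
    have "X \<in> Add {Q}" if "X \<in> replace_by C \<T> M N" for X
      using Q(2)[of X] that Add_base[of X "replace_by C \<T> M N \<union> ?W"] rl[OF that] loc_ob by blast
    then show "\<exists>S\<in>ob C. \<forall>X. X \<in> Add {S} \<longleftrightarrow> X \<in> Add (replace_by C \<T> M N)"
      using finite_type_subclass[OF Q(1), of "replace_by C \<T> M N"] rl ri by blast
    show "ctc B (replace_by C \<T> M N)" unfolding ctc_def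
    proof (intro conjI ballI impI rB)
      show "Ext0 X Y" if "X \<in> replace_by C \<T> M N" "Y \<in> replace_by C \<T> M N" for X Y using EN that by blast
      fix X assume X: "X \<in> B" "\<forall>Y\<in>replace_by C \<T> M N. Ext0 Y X"
      then have "\<forall>Y\<in>replace_by C \<T> M N \<union> ?W. Ext0 Y X" using W_summands Bperp_Ext by blast
      then have "X \<in> Add (replace_by C \<T> M N \<union> ?W)" using cN X B_ob unfolding is_cluster_def ctc_def by blast
      then show "X \<in> Add (replace_by C \<T> M N)" using reduce X(1) pU Urep rl by blast
    qed
  qed
  then have "mutates B \<T> M N" using No NB by (simp add: mutates_def)
  \<comment> \<open>Enlarging by the summands of \<open>W\<close> turns every mutation in
    \<open>B\<close> into one in \<open>C\<close>, so uniqueness is inherited.\<close>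
  moreover have "isom N N'" if "mutates B \<T> M N'" for N'
  proof (rule N(2))
    show "mutates (ob C) \<S> M N'" using that is_cluster_extend B_ob unfolding mutates_def repS by blast
  qed
  ultimately show ?thesis using ex[OF N(3) Mo(3) NB] ex[OF N(4) NB Mo(3)] unfolding \<U>_def by blast
qed

lemma weak_cluster_structure_B: "weak_cluster_structure C B (ct_clusters C B) (ct_coefficients C B)"
proof (rule weak_cluster_structureI[OF add_closed_B])
  show "indec_set C B (ct_coefficients C B)" unfolding indec_set_def
  proof (intro conjI ballI subsetI)
    fix X assume X: "X \<in> ct_coefficients C B"
    then show "X \<in> B" "indecomposable C X" using coefficients_iff indecomposable_iff by auto
    have "X \<in> ob C" using X coefficients_iff loc_ob by blast
    then show "Y \<in> ct_coefficients C B" if "Y \<in> iso_class C X" for Y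
      using that coefficients_isom[OF X] by (simp add: iso_class_eq)
  qed
qed (use coefficients_subset cluster_mutation_B in blast)+

lemma substructure:
  assumes T: "cluster_tilting C B R"
  shows "determines_substructure C B (ct_clusters C B) (ct_coefficients C B) (ct_clusters C (ob C)) {} (ind_summands C R)"
  unfolding determines_substructure_def
proof (intro conjI subcat ext_closed weak_cluster_structure_B weak_cluster_structure_C)
  show R: "ind_summands C R \<in> ct_clusters C B" using T by (auto simp: ct_clusters_def)
  show "\<exists>A. indec_set C (ob C) A \<and> (\<forall>T'\<in>reachable C B (ct_clusters C B) (ct_coefficients C B) (ind_summands C R).
      T' \<union> A \<in> ct_clusters C (ob C))"
  proof (intro exI[of _ "ind_summands C W"] conjI ballI)
    show "indec_set C (ob C) (ind_summands C W)"
      unfolding indec_set_def using W_summands ind_summands_isom[OF W_ob] iso_class_eq indecomposable_iff loc_ob by blast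
    fix T' assume "T' \<in> reachable C B (ct_clusters C B) (ct_coefficients C B) (ind_summands C R)"
    \<comment> \<open>The exchange relation already requires the replaced set to be a cluster of
      \<open>B\<close>, so reachability never leaves the clusters of \<open>B\<close>, and the one
      set of summands of \<open>W\<close> completes all of them.\<close>
    then have "T' \<in> ct_clusters C B"
      by (induction rule: reachable.induct) (auto simp: R exchange_def)
    then show "T' \<union> ind_summands C W \<in> ct_clusters C (ob C)"
      using ct_clusters_iff[OF add_closed_B] ct_clusters_iff[OF add_closed_ob] is_cluster_extend by blast
  qed
qed

end

theorem corollary1p2p4:
  fixes K :: "('k, 'r) ring_scheme"
    and C :: "('o, 'k, 'm, 'c) tri_cat_scheme"
    and E :: "('p, 'k, 'n, 'd) ex_cat_scheme"
    and B :: "'o set"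
  assumes "algebraically_closed K"
    and "triangulated_category K C"
    and "krull_schmidt_category K C"
    and "hom_finite_category K C"
    and "two_CY K C"
    and "algebraic_by K E C"
    and "\<exists>T. cluster_tilting C (ob C) T"
    and "subcategory C B"
    and "functorially_finite C B"
    and "extension_closed C B"
  shows "((\<exists>T. cluster_tilting C B T) \<and>
          (\<forall>T. maximal_rigid C B T \<longrightarrow> cluster_tilting C B T)) \<and>
         (\<exists>A. rigid C (ob C) A \<and>
            (\<forall>T S. cluster_tilting C B T \<longrightarrow> is_dsum C [T, A] S \<longrightarrow> cluster_tilting C (ob C) S)) \<and>
         (\<forall>T. cluster_tilting C B T \<longrightarrow>
            determines_substructure C B (ct_clusters C B) (ct_coefficients C B)
              (ct_clusters C (ob C)) {} (ind_summands C T))"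
proof -
  interpret tri: triangulated_category K C by fact
  interpret ks: krull_schmidt_category K C by fact
  interpret hf: hom_finite_category K C by fact
  interpret extension_closed_subcategory K C B
    using assms by unfold_locales auto
  obtain T where "cluster_tilting C (ob C) T" using assms by blast
  then have T: "ctc (ob C) {T}" using cluster_tilting_iff by blast
  obtain B0 W where BW: "B0 \<in> B" "W \<in> Bperp" "ctc (ob C) {B0, W}" using cluster_tilting_pair[OF T] by blast
  interpret cluster_tilting_pair K C B T B0 W
    using T BW by unfold_locales
  show ?thesis
  proof (intro conjI allI impI)
    show "\<exists>T. cluster_tilting C B T" using cluster_tilting_ex cluster_tilting_iff[OF B_ob] by blast
    show "cluster_tilting C B R" if "maximal_rigid C B R" for R
      using maximal_rigid_ctc[OF that] cluster_tilting_iff[OF B_ob] by blast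
    have "rigid C (ob C) W" by (rule rigid_W)
    moreover have "cluster_tilting C (ob C) S" if "cluster_tilting C B R" "is_dsum C [R, W] S" for R S
      using dsum_ctc that cluster_tilting_iff[OF B_ob] cluster_tilting_iff[OF order_refl] by blast
    ultimately show "\<exists>A. rigid C (ob C) A \<and>
        (\<forall>T S. cluster_tilting C B T \<longrightarrow> is_dsum C [T, A] S \<longrightarrow> cluster_tilting C (ob C) S)" by blast
    show "determines_substructure C B (ct_clusters C B) (ct_coefficients C B) (ct_clusters C (ob C)) {} (ind_summands C R)"
      if "cluster_tilting C B R" for R using substructure[OF that] .
  qed
qed

end
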